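(* Let $\Gamma$ be a countably infinite group with Kazhdan's property (T), and let $S$ be a finite symmetric generating set of $\Gamma$. Then for every $\varepsilon>0$ there exists a $\Gamma$-invariant probability measure $\mu$ on the set of connected spanning subgraphs of the Cayley graph of $\Gamma$ associated to $S$ such that the average degree satisfies $$\int \deg_\omega(o)\,d\mu(\omega)\le 2+\varepsilon,$$ where $o$ is the identity element of $\Gamma$ and $\deg_\omega(o)$ is the degree of $o$ in the subgraph $\omega$.
   Context: A countable (discrete) group $\Gamma$ has Kazhdan's property (T) if every unitary representation of $\Gamma$ on a Hilbert space that has almost-invariant vectors has a non-zero $\Gamma$-invariant vector. (A representation $\pi$ has almost-invariant vectors if for every finite $F\subseteq\Gamma$ and every $\delta>0$ there is a unit vector $v$ with $\|\pi(g)v-v\|<\delta$ for all $g\in F$.) For a countably infinite group $\Gamma$ this is equivalent, by a theorem of Glasner and Weiss which may be taken as the definition, to the following: the set of ergodic $\Gamma$-invariant Borel probability measures on $\{0,1\}^\Gamma$ (with $\Gamma$ acting by translation) is weak$^*$ closed in the set of all $\Gamma$-invariant Borel probability measures on $\{0,1\}^\Gamma$. Every countable Kazhdan group is finitely generated. The Cayley graph associated to $S$ has vertex set $\Gamma$ and an edge between distinct $a,b\in\Gamma$ whenever $a^{-1}b\in S$. A connected spanning subgraph is a connected subgraph with vertex set all of $\Gamma$, encoded as $\omega\in\{0,1\}^{\Gamma\times\Gamma}$ with $\omega(a,b)=\omega(b,a)$, where $\omega(a,b)=1$ means that $a$ and $b$ are joined by an edge of the subgraph. $\Gamma$ acts by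 $(\gamma\omega)(u,v)=\omega(\gamma^{-1}u,\gamma^{-1}v)$; measures are Borel with respect to the product topology on $\{0,1\}^{\Gamma\times\Gamma}$, and invariance is with respect to this action. *)

theory Defs
  imports "HOL-Probability.Probability" "HOL-Algebra.Generated_Groups"
begin

text \<open>An element of \<open>{0,1}\<^sup>I\<close> is an extensional function on \<open>I\<close> with values in \<^typ>\<open>bool\<close>.\<close>

definition config_topology :: "'i set \<Rightarrow> ('i \<Rightarrow> bool) topology" where
  "config_topology I = product_topology (\<lambda>_. discrete_topology UNIV) I"

definition borel_algebra :: "'x topology \<Rightarrow> 'x measure" where
  "borel_algebra X = sigma (topspace X) {U. openin X U}"

definition borel_prob_measures :: "'x topology \<Rightarrow> 'x measure set" where
  "borel_prob_measures X = {\<mu>. prob_space \<mu> \<and> sets \<mu> = sets (borel_algebra X)}"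

text \<open>
  The weak* topology on a set \<open>P\<close> of Borel probability measures is the coarsest one for which
  \<open>\<mu> \<mapsto> \<integral> f d\<mu>\<close> is continuous for every continuous real function \<open>f\<close> on \<open>X\<close>.
  Values of \<open>f\<close> outside \<^term>\<open>topspace X\<close> are immaterial.
\<close>

definition weak_star_topology :: "'x topology \<Rightarrow> 'x measure set \<Rightarrow> 'x measure topology" where
  "weak_star_topology X P =
     (let C = {f. continuous_map X euclideanreal f} in
      pullback_topology P (\<lambda>\<mu>. \<lambda>f\<in>C. \<integral>x. f x \<partial>\<mu>) (product_topology (\<lambda>_. euclideanreal) C))"

text \<open>
  An action of \<open>G\<close> on the index set \<open>I\<close>, given as \<open>act g i\<close>, induces the action
  \<open>(g \<omega>)(i) = \<omega>(g\<^sup>-\<^sup>1 i)\<close> on configurations.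
\<close>

definition translate ::
    "('a, 'b) monoid_scheme \<Rightarrow> 'i set \<Rightarrow> ('a \<Rightarrow> 'i \<Rightarrow> 'i) \<Rightarrow> 'a \<Rightarrow> ('i \<Rightarrow> bool) \<Rightarrow> ('i \<Rightarrow> bool)" where
  "translate G I act g \<omega> = (\<lambda>i\<in>I. \<omega> (act (inv\<^bsub>G\<^esub> g) i))"

definition invariant_measures ::
    "('a, 'b) monoid_scheme \<Rightarrow> 'i set \<Rightarrow> ('a \<Rightarrow> 'i \<Rightarrow> 'i) \<Rightarrow> ('i \<Rightarrow> bool) measure set" where
  "invariant_measures G I act =
     {\<mu> \<in> borel_prob_measures (config_topology I).
        \<forall>g\<in>carrier G. distr \<mu> \<mu> (translate G I act g) = \<mu>}"

definition ergodic_measures ::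
    "('a, 'b) monoid_scheme \<Rightarrow> 'i set \<Rightarrow> ('a \<Rightarrow> 'i \<Rightarrow> 'i) \<Rightarrow> ('i \<Rightarrow> bool) measure set" where
  "ergodic_measures G I act =
     {\<mu> \<in> invariant_measures G I act.
        \<forall>A\<in>sets \<mu>. (\<forall>g\<in>carrier G. translate G I act g -` A \<inter> space \<mu> = A) \<longrightarrow>
          measure \<mu> A = 0 \<or> measure \<mu> A = 1}"

text \<open>
  Property (T) of a countably infinite group, in the form given by the theorem of Glasner and
  Weiss: the ergodic measures on \<open>{0,1}\<^sup>G\<close> are weak* closed among the invariant ones, where \<open>G\<close>
  acts on itself by left multiplication.
\<close>

definition kazhdan_property_T :: "('a, 'b) monoid_scheme \<Rightarrow> bool" where
  "kazhdan_property_T G \<longleftrightarrow>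
     closedin
       (weak_star_topology (config_topology (carrier G))
          (invariant_measures G (carrier G) (\<lambda>g a. g \<otimes>\<^bsub>G\<^esub> a)))
       (ergodic_measures G (carrier G) (\<lambda>g a. g \<otimes>\<^bsub>G\<^esub> a))"

definition cayley_adj :: "('a, 'b) monoid_scheme \<Rightarrow> 'a set \<Rightarrow> 'a \<Rightarrow> 'a \<Rightarrow> bool" where
  "cayley_adj G S a b \<longleftrightarrow>
     a \<in> carrier G \<and> b \<in> carrier G \<and> a \<noteq> b \<and> inv\<^bsub>G\<^esub> a \<otimes>\<^bsub>G\<^esub> b \<in> S"

definition connected_spanning_subgraphs ::
    "('a, 'b) monoid_scheme \<Rightarrow> 'a set \<Rightarrow> ('a \<times> 'a \<Rightarrow> bool) set" where
  "connected_spanning_subgraphs G S =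
     {\<omega> \<in> topspace (config_topology (carrier G \<times> carrier G)).
        (\<forall>a\<in>carrier G. \<forall>b\<in>carrier G. \<omega> (a, b) = \<omega> (b, a)) \<and>
        (\<forall>a\<in>carrier G. \<forall>b\<in>carrier G. \<omega> (a, b) \<longrightarrow> cayley_adj G S a b) \<and>
        (\<forall>a\<in>carrier G. \<forall>b\<in>carrier G.
           (a, b) \<in> {(u, v). u \<in> carrier G \<and> v \<in> carrier G \<and> \<omega> (u, v)}\<^sup>*)}"

definition subgraph_degree ::
    "('a, 'b) monoid_scheme \<Rightarrow> ('a \<times> 'a \<Rightarrow> bool) \<Rightarrow> 'a \<Rightarrow> nat" where
  "subgraph_degree G \<omega> a = card {b \<in> carrier G. \<omega> (a, b)}"

definition diagonal_action :: "('a, 'b) monoid_scheme \<Rightarrow> 'a \<Rightarrow> 'a \<times> 'a \<Rightarrow> 'a \<times> 'a" where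
  "diagonal_action G g = (\<lambda>(u, v). (g \<otimes>\<^bsub>G\<^esub> u, g \<otimes>\<^bsub>G\<^esub> v))"

end

theory Submission
  imports Defs
begin

text \<open>
  The argument is that of Hutchcroft and Pete, arranged so that only elementary measure theory is
  needed. Start with Bernoulli site percolation of density \<open>p\<close> on the Cayley graph. Repeatedly take
  the union of two independent copies, of density \<open>p (2 - p)\<close>, and keep each cluster of the union
  independently with probability \<open>1 / (2 - p)\<close>. The density remains \<open>p\<close>, but the probability that two
  given vertices disagree tends to \<open>0\<close>, so the laws converge to the non-ergodic mixture of the full and
  the empty configuration. By property (T) the laws cannot all be weakly mixing. At the first stage
  where weak mixing is lost, the union \<open>\<nu>\<close> is still weakly mixing, but the probability that \<open>x\<close> and
  \<open>g y\<close> share a cluster is not small on average over \<open>g\<close>.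

  For a finitely supported probability \<open>a\<close> on the group let \<open>\<lambda>\<^sub>a\<close> be the law of the cluster of two
  independent \<open>a\<close>-random vertices on the event that they share a cluster. Its mass is a quadratic
  form in \<open>a\<close> that is invariant under left translation and bounded below on a suitable convex
  translation-invariant set. By the parallelogram law a minimizing sequence is Cauchy and asymptotically
  invariant, so \<open>\<lambda>\<^sub>a\<close> converges in total variation to an invariant measure on connected non-empty sets;
  weak mixing of \<open>\<nu>\<close> bounds the density of these sets by \<open>p (2 - p)\<close>. Joining every other vertex to a
  neighbour that is closer to the random set adds at most \<open>2\<close> to the expected degree, by mass transport.
\<close>

section \<open>Null functions on a group\<close>

text \<open>Ergodicity itself cannot be carried through the iteration, since the product of two
  ergodic systems may fail to be ergodic; weak mixing passes to independent pairs. It is expressed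
  by averages that may depend on the events (\<open>null\<close>), so that no invariant mean has to
  be chosen. Unions act simply on events that sites are closed (\<open>cylG False\<close>), thinning
  on events that sites are open (\<open>cylG True\<close>); either family generates.

  Disagreement dies out because a cluster is kept or deleted as a whole: adjacent open vertices
  share a coin, so across an edge the union contributes a factor of at most 2 - 2p and the thinning
  a factor 1/(2 - p), with product below 1.

  If a function is not null, there are a fixed \<open>k\<close> and \<delta> > 0 such that the
  average over every \<open>conv a k\<close> exceeds \<delta> after some left translation. The set
  of all \<open>conv a k\<close> is closed under midpoints and left translations, hence it is the
  domain of the minimization; Cauchy-Schwarz turns \<delta> into the lower bound \<delta>^2. The
  parallelogram law is useful because, for a fixed configuration, the quadratic form is a sum of
  squares of cluster masses.\<close>

locale inf_group = group G for G (structure) +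
  assumes countable_carrier: "countable (carrier G)"
    and infinite_carrier: "infinite (carrier G)"
begin

definition finpmf :: "'a pmf set" where
  "finpmf = {a. finite (set_pmf a) \<and> set_pmf a \<subseteq> carrier G}"

definition conv :: "'a pmf \<Rightarrow> 'a pmf \<Rightarrow> 'a pmf" where
  "conv a b = bind_pmf a (\<lambda>g. map_pmf (\<lambda>x. g \<otimes> x) b)"

abbreviation expect :: "'a pmf \<Rightarrow> ('a \<Rightarrow> real) \<Rightarrow> real" where
  "expect a f \<equiv> measure_pmf.expectation a f"

lemma finpmfD: "a \<in> finpmf \<Longrightarrow> finite (set_pmf a)" "a \<in> finpmf \<Longrightarrow> x \<in> set_pmf a \<Longrightarrow> x \<in> carrier G"
  by (auto simp: finpmf_def)

lemma finpmf_return [simp]: "x \<in> carrier G \<Longrightarrow> return_pmf x \<in> finpmf"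
  by (auto simp: finpmf_def)

lemma finpmf_conv [simp]: "a \<in> finpmf \<Longrightarrow> b \<in> finpmf \<Longrightarrow> conv a b \<in> finpmf"
  by (auto simp: finpmf_def conv_def subset_iff)

lemma finpmf_map: "a \<in> finpmf \<Longrightarrow> (\<And>x. x \<in> carrier G \<Longrightarrow> f x \<in> carrier G) \<Longrightarrow> map_pmf f a \<in> finpmf"
  by (auto simp: finpmf_def)

lemma expect_cong: "a \<in> finpmf \<Longrightarrow> (\<And>x. x \<in> carrier G \<Longrightarrow> f x = g x) \<Longrightarrow> expect a f = expect a g"
  by (intro integral_cong_AE) (auto simp: AE_measure_pmf_iff finpmfD)

lemma integrable_finpmf: "a \<in> finpmf \<Longrightarrow> integrable (measure_pmf a) (f :: 'a \<Rightarrow> real)"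
  by (simp add: finpmfD integrable_measure_pmf_finite)

lemma expect_mono:
  "a \<in> finpmf \<Longrightarrow> (\<And>x. x \<in> carrier G \<Longrightarrow> f x \<le> g x) \<Longrightarrow> expect a f \<le> expect a g"
  by (intro integral_mono_AE integrable_finpmf) (auto simp: AE_measure_pmf_iff finpmfD)

lemma expect_add: "a \<in> finpmf \<Longrightarrow> expect a (\<lambda>x. f x + g x) = expect a f + expect a g"
  by (intro Bochner_Integration.integral_add integrable_finpmf)

lemma expect_le_const:
  "a \<in> finpmf \<Longrightarrow> (\<And>x. x \<in> carrier G \<Longrightarrow> f x \<le> c) \<Longrightarrow> expect a f \<le> c"
  using expect_mono[of a f "\<lambda>_. c"] by simp

lemma expect_sum_pmf:
  assumes "finite T" "set_pmf a \<subseteq> T"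
  shows "expect a f = (\<Sum>x\<in>T. pmf a x * f x)"
  using integral_measure_pmf_real[of T a f] assms by (auto simp: mult.commute)

lemma expect_bind:
  assumes "finite (set_pmf a)" "\<And>x. x \<in> set_pmf a \<Longrightarrow> finite (set_pmf (b x))"
  shows "expect (bind_pmf a b) f = measure_pmf.expectation a (\<lambda>x. expect (b x) f)"
  using assms by (subst pmf_expectation_bind[of "set_pmf a"])
    (auto simp: integral_measure_pmf_real[of "set_pmf a"] mult.commute)

lemma expect_conv:
  assumes "a \<in> finpmf" "b \<in> finpmf"
  shows "expect (conv a b) f = expect a (\<lambda>g. expect b (\<lambda>x. f (g \<otimes> x)))"
  using assms unfolding conv_def by (subst expect_bind) (auto simp: finpmfD)

lemma expect_swap:
  assumes "a \<in> finpmf" "b \<in> finpmf"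
  shows "expect a (\<lambda>x. expect b (\<lambda>y. f x y)) = expect b (\<lambda>y. expect a (\<lambda>x. f x y))"
proof -
  have "expect a (\<lambda>x. expect b (\<lambda>y. f x y)) =
      (\<Sum>x\<in>set_pmf a. \<Sum>y\<in>set_pmf b. pmf a x * (pmf b y * f x y))"
    using assms by (simp add: expect_sum_pmf[OF finpmfD(1) order_refl] sum_distrib_left)
  also have "\<dots> = (\<Sum>y\<in>set_pmf b. \<Sum>x\<in>set_pmf a. pmf b y * (pmf a x * f x y))"
    by (subst sum.swap) (simp add: mult.left_commute)
  also have "\<dots> = expect b (\<lambda>y. expect a (\<lambda>x. f x y))"
    using assms by (simp add: expect_sum_pmf[OF finpmfD(1) order_refl] sum_distrib_left)
  finally show ?thesis .
qed

lemma conv_assoc: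
  assumes "a \<in> finpmf" "b \<in> finpmf" "c \<in> finpmf"
  shows "conv (conv a b) c = conv a (conv b c)"
  unfolding conv_def map_pmf_def using assms
  by (auto simp: bind_assoc_pmf bind_return_pmf m_assoc finpmfD intro!: bind_pmf_cong)

text \<open>A substitute for having mean zero. Only an upper bound is asked for, because the notion
  is meant for non-negative functions.\<close>

definition null :: "('a \<Rightarrow> real) \<Rightarrow> bool" where
  "null \<phi> \<longleftrightarrow> (\<forall>k\<in>finpmf. \<forall>\<epsilon>>0. \<exists>a\<in>finpmf. \<forall>h\<in>carrier G. expect (conv a k) (\<lambda>x. \<phi> (h \<otimes> x)) \<le> \<epsilon>)"

text \<open>The averaging measure that serves \<psi> at precision \<open>\<epsilon>/2\<close> serves
  \<phi> as well. This closure under uniform approximation later absorbs the tails of countable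
  unions.\<close>

lemma null_uniform:
  assumes "\<And>\<epsilon>. \<epsilon> > 0 \<Longrightarrow> \<exists>\<psi>. null \<psi> \<and> (\<forall>g\<in>carrier G. \<phi> g \<le> \<psi> g + \<epsilon>)"
  shows "null \<phi>"
  unfolding null_def
proof (intro ballI allI impI)
  fix k and \<epsilon> :: real assume k: "k \<in> finpmf" and \<epsilon>: "\<epsilon> > 0"
  obtain \<psi> where \<psi>: "null \<psi>" "\<forall>g\<in>carrier G. \<phi> g \<le> \<psi> g + \<epsilon>/2" using assms[of "\<epsilon>/2"] \<epsilon> by auto
  obtain a where a: "a \<in> finpmf" "\<forall>h\<in>carrier G. expect (conv a k) (\<lambda>x. \<psi> (h \<otimes> x)) \<le> \<epsilon>/2"
    using \<psi>(1) k \<epsilon> unfolding null_def by (metis half_gt_zero)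
  show "\<exists>a\<in>finpmf. \<forall>h\<in>carrier G. expect (conv a k) (\<lambda>x. \<phi> (h \<otimes> x)) \<le> \<epsilon>"
  proof (rule bexI[OF _ a(1)], rule ballI)
    fix h assume h: "h \<in> carrier G"
    have "expect (conv a k) (\<lambda>x. \<phi> (h \<otimes> x)) \<le> expect (conv a k) (\<lambda>x. \<psi> (h \<otimes> x) + \<epsilon>/2)"
      using \<psi>(2) h a k by (intro expect_mono) auto
    also have "\<dots> = expect (conv a k) (\<lambda>x. \<psi> (h \<otimes> x)) + \<epsilon>/2"
      using a k by (subst expect_add) auto
    also have "\<dots> \<le> \<epsilon>" using a(2) h by fastforce
    finally show "expect (conv a k) (\<lambda>x. \<phi> (h \<otimes> x)) \<le> \<epsilon>" .
  qed
qed

lemma null_mono: "null \<psi> \<Longrightarrow> (\<And>g. g \<in> carrier G \<Longrightarrow> \<phi> g \<le> \<psi> g) \<Longrightarrow> null \<phi>"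
  by (rule null_uniform) (metis add_increasing2 less_imp_le)

lemma null_zero [simp]: "null (\<lambda>_. 0)"
  unfolding null_def using finpmf_return[OF one_closed] by fastforce

text \<open>The averaging measure for a sum is the convolution of one for \<open>\<phi>\<close> (chosen first) and one
  for \<open>\<psi>\<close>, smoothed on the right by the first; this is why \<open>null\<close> demands uniformity in the left
  translation \<open>h\<close> and allows an arbitrary right convolution \<open>k\<close>.\<close>

lemma null_add:
  assumes "null \<phi>" "null \<psi>"
  shows "null (\<lambda>g. \<phi> g + \<psi> g)"
  unfolding null_def
proof (intro ballI allI impI)
  fix k and \<epsilon> :: real assume k: "k \<in> finpmf" and \<epsilon>: "\<epsilon> > 0"
  obtain a where a: "a \<in> finpmf" "\<forall>h\<in>carrier G. expect (conv a k) (\<lambda>x. \<phi> (h \<otimes> x)) \<le> \<epsilon>/2"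
    using assms(1) k \<epsilon> unfolding null_def by (metis half_gt_zero)
  obtain b where b: "b \<in> finpmf"
      "\<forall>h\<in>carrier G. expect (conv b (conv a k)) (\<lambda>x. \<psi> (h \<otimes> x)) \<le> \<epsilon>/2"
    using assms(2) finpmf_conv[OF a(1) k] \<epsilon> unfolding null_def by (metis half_gt_zero)
  show "\<exists>a\<in>finpmf. \<forall>h\<in>carrier G. expect (conv a k) (\<lambda>x. \<phi> (h \<otimes> x) + \<psi> (h \<otimes> x)) \<le> \<epsilon>"
  proof (rule bexI[OF _ finpmf_conv[OF b(1) a(1)]], rule ballI)
    fix h assume h: "h \<in> carrier G"
    have "expect (conv b (conv a k)) (\<lambda>x. \<phi> (h \<otimes> x)) =
        expect b (\<lambda>g. expect (conv a k) (\<lambda>x. \<phi> (h \<otimes> (g \<otimes> x))))"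
      using a b k by (subst expect_conv) auto
    also have "\<dots> = expect b (\<lambda>g. expect (conv a k) (\<lambda>x. \<phi> (h \<otimes> g \<otimes> x)))"
      using a b k h by (intro expect_cong) (auto simp: m_assoc)
    also have "\<dots> \<le> \<epsilon>/2"
    proof (rule expect_le_const[OF b(1)])
      fix g assume "g \<in> carrier G"
      then show "expect (conv a k) (\<lambda>x. \<phi> (h \<otimes> g \<otimes> x)) \<le> \<epsilon>/2" using a(2) h m_closed by blast
    qed
    finally have "expect (conv b (conv a k)) (\<lambda>x. \<phi> (h \<otimes> x)) \<le> \<epsilon>/2" .
    with b(2) h have "expect (conv b (conv a k)) (\<lambda>x. \<phi> (h \<otimes> x) + \<psi> (h \<otimes> x)) \<le> \<epsilon>"
      using a b k by (subst expect_add) fastforce+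
    then show "expect (conv (conv b a) k) (\<lambda>x. \<phi> (h \<otimes> x) + \<psi> (h \<otimes> x)) \<le> \<epsilon>"
      using a b k by (simp add: conv_assoc)
  qed
qed

lemma null_sum: "(\<And>i. i \<in> I \<Longrightarrow> null (\<phi> i)) \<Longrightarrow> null (\<lambda>g. \<Sum>i\<in>I. \<phi> i g)"
  by (induction I rule: infinite_finite_induct) (auto intro: null_add)

lemma null_cmult:
  assumes "null \<phi>" "c \<ge> 0" shows "null (\<lambda>g. c * \<phi> g)"
proof (cases "c = 0")
  case False
  then have c: "c > 0" using assms by simp
  show ?thesis unfolding null_def
  proof (intro ballI allI impI)
    fix k and \<epsilon> :: real assume k: "k \<in> finpmf" and \<epsilon>: "\<epsilon> > 0"
    have "\<epsilon> / c > 0" using \<epsilon> c by simp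
    then obtain a where a: "a \<in> finpmf"
        "\<forall>h\<in>carrier G. expect (conv a k) (\<lambda>x. \<phi> (h \<otimes> x)) \<le> \<epsilon>/c"
      using assms(1) k unfolding null_def by meson
    then show "\<exists>a\<in>finpmf. \<forall>h\<in>carrier G. expect (conv a k) (\<lambda>x. c * \<phi> (h \<otimes> x)) \<le> \<epsilon>"
      using c by (intro bexI[of _ a]) (auto simp: field_simps)
  qed
qed simp

lemma finpmf_exists_le_expect:
  assumes "a \<in> finpmf" shows "\<exists>x\<in>carrier G. f x \<le> expect a f"
proof -
  define x where "x = arg_min_on f (set_pmf a)"
  have fin: "finite (set_pmf a)" using assms by (simp add: finpmfD)
  have x: "x \<in> set_pmf a" unfolding x_def by (rule arg_min_if_finite(1)[OF fin set_pmf_not_empty])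
  have "f x \<le> f y" if "y \<in> set_pmf a" for y
    using arg_min_least[OF fin set_pmf_not_empty that, of f] by (simp add: x_def)
  then have "expect a (\<lambda>_. f x) \<le> expect a f"
    using assms by (intro integral_mono_AE integrable_finpmf) (auto simp: AE_measure_pmf_iff)
  then show ?thesis using x finpmfD(2)[OF assms] by auto
qed

text \<open>A finite average is at least its smallest value, so the trivial choice of
  \<open>k\<close> and \<open>h\<close> already exhibits a good group element.\<close>

lemma null_small:
  assumes "null \<phi>" "\<epsilon> > 0"
  shows "\<exists>g\<in>carrier G. \<phi> g \<le> \<epsilon>"
proof -
  obtain a where a: "a \<in> finpmf"
      "\<forall>h\<in>carrier G. expect (conv a (return_pmf \<one>)) (\<lambda>x. \<phi> (h \<otimes> x)) \<le> \<epsilon>"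
    using assms finpmf_return[OF one_closed] unfolding null_def by blast
  obtain x where "x \<in> carrier G" "\<phi> (\<one> \<otimes> x) \<le> expect (conv a (return_pmf \<one>)) (\<lambda>x. \<phi> (\<one> \<otimes> x))"
    using finpmf_exists_le_expect[OF finpmf_conv[OF a(1) finpmf_return[OF one_closed]]] by metis
  then show ?thesis using a(2) by (metis dual_order.trans l_one one_closed)
qed

text \<open>Average uniformly over \<open>n\<close> distinct elements:
  \<open>g \<mapsto> h \<otimes> (g \<otimes> x)\<close> is injective, so at most
  \<open>card F\<close> of them land in \<open>F\<close>, and the average is at most
  \<open>card F / n\<close> whatever \<open>h\<close> and \<open>k\<close> are. Here the infinitude
  of the group enters.\<close>

lemma null_finite_support:
  assumes F: "finite F" and C: "\<And>g. g \<in> carrier G \<Longrightarrow> \<phi> g \<le> (if g \<in> F then C else 0)"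
  shows "null \<phi>"
proof -
  have "null (\<lambda>g. indicator F g)"
    unfolding null_def
  proof (intro ballI allI impI)
    fix k and \<epsilon> :: real assume k: "k \<in> finpmf" and \<epsilon>: "\<epsilon> > 0"
    obtain m :: nat where m: "real (card F) / \<epsilon> < real m" using reals_Archimedean2 by blast
    \<comment> \<open>The successor keeps \<open>U\<close> non-empty, as \<open>pmf_of_set\<close>
      requires.\<close>
    define n where "n = Suc m"
    have n: "real (card F) / \<epsilon> < real n" "n > 0" using m by (auto simp: n_def)
    obtain U where U: "U \<subseteq> carrier G" "finite U" "card U = n"
      using infinite_arbitrarily_large[OF infinite_carrier] by blast
    then have U0: "U \<noteq> {}" using n by auto
    have a: "pmf_of_set U \<in> finpmf" using U U0 by (auto simp: finpmf_def)
    show "\<exists>a\<in>finpmf. \<forall>h\<in>carrier G. expect (conv a k) (\<lambda>x. indicator F (h \<otimes> x)) \<le> \<epsilon>"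
    proof (rule bexI[OF _ a], rule ballI)
      fix h assume h: "h \<in> carrier G"
      have "expect (conv (pmf_of_set U) k) (\<lambda>x. indicator F (h \<otimes> x)) =
          expect k (\<lambda>x. expect (pmf_of_set U) (\<lambda>g. indicator F (h \<otimes> (g \<otimes> x))))"
        using a k by (simp add: expect_conv) (rule expect_swap)
      also have "\<dots> \<le> real (card F) / real n"
      proof (rule expect_le_const[OF k])
        fix x assume x: "x \<in> carrier G"
        have "expect (pmf_of_set U) (\<lambda>g. indicator F (h \<otimes> (g \<otimes> x))) =
            real (card {g\<in>U. h \<otimes> (g \<otimes> x) \<in> F}) / real n"
          using U U0 by (simp add: integral_pmf_of_set indicator_def sum.If_cases Collect_conj_eq Int_commute)
        also have "card {g\<in>U. h \<otimes> (g \<otimes> x) \<in> F} \<le> card F"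
          using U x h by (intro card_inj_on_le[OF _ _ F, of "\<lambda>g. h \<otimes> (g \<otimes> x)"]) (auto simp: inj_on_def subset_iff)
        finally show "expect (pmf_of_set U) (\<lambda>g. indicator F (h \<otimes> (g \<otimes> x))) \<le> real (card F) / real n"
          by (simp add: divide_right_mono)
      qed
      also have "\<dots> \<le> \<epsilon>" using n \<epsilon> by (simp add: field_simps)
      finally show "expect (conv (pmf_of_set U) k) (\<lambda>x. indicator F (h \<otimes> x)) \<le> \<epsilon>" .
    qed
  qed
  \<comment> \<open>\<open>C\<close> may be negative, while scaling demands a non-negative
    factor.\<close>
  then have "null (\<lambda>g. max C 0 * indicator F g)" by (rule null_cmult) simp
  then show ?thesis by (rule null_mono) (use C in \<open>fastforce simp: indicator_def split: if_splits\<close>)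
qed

end

section \<open>Configurations\<close>

definition cfg :: "'i set \<Rightarrow> ('i \<Rightarrow> bool) measure" where
  "cfg I = PiM I (\<lambda>_. count_space UNIV)"

text \<open>All prescribed values equal the same colour \<open>c\<close>: such events are closed
  under intersection and still generate, so laws need only be computed for one colour, whichever is
  convenient.\<close>

definition cyl :: "'i set \<Rightarrow> bool \<Rightarrow> 'i set \<Rightarrow> ('i \<Rightarrow> bool) set" where
  "cyl I c F = {\<omega> \<in> extensional I. \<forall>i\<in>F. \<omega> i = c}"

definition cyls :: "'i set \<Rightarrow> bool \<Rightarrow> ('i \<Rightarrow> bool) set set" where
  "cyls I c = {cyl I c F | F. finite F \<and> F \<subseteq> I}"

lemma space_cfg [simp]: "space (cfg I) = extensional I"
  by (simp add: cfg_def space_PiM PiE_def)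

lemma topspace_config [simp]: "topspace (config_topology I) = extensional I"
  by (simp add: config_topology_def topspace_product_topology PiE_def)

lemma pred_cfg: "i \<in> I \<Longrightarrow> Measurable.pred (cfg I) (\<lambda>\<omega>. \<omega> i)"
  unfolding cfg_def by (rule measurable_component_singleton)

lemma measurable_cfg:
  "(\<And>i. i \<in> I \<Longrightarrow> Measurable.pred M (\<lambda>x. f x i)) \<Longrightarrow> (\<lambda>x. \<lambda>i\<in>I. f x i) \<in> measurable M (cfg I)"
  unfolding cfg_def by (rule measurable_restrict)

lemma pred_sets: "Measurable.pred M P \<Longrightarrow> {x\<in>space M. P x} \<in> sets M"
  by (simp add: pred_def)

lemma pred_Bex_countable:
  "countable X \<Longrightarrow> (\<And>i. i \<in> X \<Longrightarrow> Measurable.pred M (\<lambda>x. P x i)) \<Longrightarrow> Measurable.pred M (\<lambda>x. \<exists>i\<in>X. P x i)"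
  unfolding pred_def by (simp add: sets.sets_Collect_countable_Bex)

lemma pred_Ball_countable:
  "countable X \<Longrightarrow> (\<And>i. i \<in> X \<Longrightarrow> Measurable.pred M (\<lambda>x. P x i)) \<Longrightarrow> Measurable.pred M (\<lambda>x. \<forall>i\<in>X. P x i)"
  unfolding pred_def by (simp add: sets.sets_Collect_countable_Ball)

lemma pred_cyl: "finite F \<Longrightarrow> F \<subseteq> I \<Longrightarrow> Measurable.pred (cfg I) (\<lambda>\<omega>. \<forall>i\<in>F. \<omega> i = c)"
  by (intro pred_Ball_countable pred_intros_logic measurable_const pred_cfg) (auto intro: countable_finite)

lemma cyl_sets: "finite F \<Longrightarrow> F \<subseteq> I \<Longrightarrow> cyl I c F \<in> sets (cfg I)"
  using pred_sets[OF pred_cyl, of F I c] by (simp add: cyl_def)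

lemma cyl_Int: "cyl I c F \<inter> cyl I c F' = cyl I c (F \<union> F')"
  by (auto simp: cyl_def)

lemma Int_stable_cyls: "Int_stable (cyls I c)"
proof (rule Int_stableI)
  fix A B assume "A \<in> cyls I c" "B \<in> cyls I c"
  then obtain F F' where "A = cyl I c F" "B = cyl I c F'" "finite (F \<union> F')" "F \<union> F' \<subseteq> I"
    by (auto simp: cyls_def)
  then show "A \<inter> B \<in> cyls I c" unfolding cyls_def by (auto simp only: cyl_Int)
qed

lemma cyls_subset: "cyls I c \<subseteq> Pow (extensional I)"
  by (auto simp: cyls_def cyl_def)

text \<open>As there are only two values, complements of one-point cylinders of colour
  \<open>c\<close> supply the opposite colour.\<close>

lemma sets_cfg_cyls: "sets (cfg I) = sigma_sets (extensional I) (cyls I c)"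
proof
  show "sigma_sets (extensional I) (cyls I c) \<subseteq> sets (cfg I)"
    using sets.sigma_sets_subset[of "cyls I c" "cfg I"] cyl_sets[of _ I c] by (force simp: cyls_def)
  have sa: "sigma_algebra (extensional I) (sigma_sets (extensional I) (cyls I c))"
    by (rule sigma_algebra_sigma_sets[OF cyls_subset])
  interpret sigma_algebra "extensional I" "sigma_sets (extensional I) (cyls I c)" by fact
  have "{f \<in> PiE I (\<lambda>_. UNIV). f i \<in> A} \<in> sigma_sets (extensional I) (cyls I c)" if i: "i \<in> I" for i A
  proof -
    have c: "{f \<in> extensional I. f i = c} \<in> sigma_sets (extensional I) (cyls I c)"
      using i by (intro sigma_sets.Basic) (auto simp: cyls_def cyl_def intro!: exI[of _ "{i}"])
    have nc: "{f \<in> extensional I. f i = (\<not> c)} \<in> sigma_sets (extensional I) (cyls I c)"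
      using compl_sets[OF c] by (rule back_subst[where P="\<lambda>x. x \<in> _"]) auto
    have "{f \<in> PiE I (\<lambda>_. UNIV). f i \<in> A} =
       (if c \<in> A then {f \<in> extensional I. f i = c} else {}) \<union>
       (if (\<not> c) \<in> A then {f \<in> extensional I. f i = (\<not> c)} else {})"
      by (cases c) (auto simp: PiE_def, (metis (full_types))+)
    then show ?thesis using c nc by auto
  qed
  then show "sets (cfg I) \<subseteq> sigma_sets (extensional I) (cyls I c)"
    unfolding cfg_def sets_PiM_single space_count_space
    by (simp add: PiE_def) (intro sigma_sets_subset, auto simp: PiE_def)
qed

lemma cfg_measure_eqI:
  assumes "prob_space M" "prob_space N" "sets M = sets (cfg I)" "sets N = sets (cfg I)"
    and eq: "\<And>F. finite F \<Longrightarrow> F \<subseteq> I \<Longrightarrow> measure M (cyl I c F) = measure N (cyl I c F)"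
  shows "M = N"
proof (rule measure_eqI_generator_eq[OF Int_stable_cyls[of I c] cyls_subset])
  interpret M: prob_space M by fact
  interpret N: prob_space N by fact
  show "\<And>X. X \<in> cyls I c \<Longrightarrow> emeasure M X = emeasure N X"
    using eq by (auto simp: cyls_def M.emeasure_eq_measure N.emeasure_eq_measure)
  show "range (\<lambda>_. cyl I c {}) \<subseteq> cyls I c" by (auto simp: cyls_def)
  show "\<Union> (range (\<lambda>_. cyl I c {})) = extensional I" by (auto simp: cyl_def)
  show "emeasure M (cyl I c {}) \<noteq> \<infinity>" by (simp add: M.emeasure_eq_measure)
qed (use assms sets_cfg_cyls[of I c] in auto)

lemma cyl_openin:
  assumes "finite F" "F \<subseteq> I" shows "openin (config_topology I) {\<omega> \<in> extensional I. \<forall>i\<in>F. \<omega> i = v i}"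
proof -
  have "openin (config_topology I) (PiE I (\<lambda>i. if i \<in> F then {v i} else UNIV))"
    unfolding config_topology_def openin_PiE_gen
    using assms by (auto intro!: finite_subset[OF _ assms(1)] split: if_splits)
  also have "(PiE I (\<lambda>i. if i \<in> F then {v i} else UNIV)) = {\<omega> \<in> extensional I. \<forall>i\<in>F. \<omega> i = v i}"
    using assms by (auto simp: PiE_def Pi_def subset_iff split: if_splits)
  finally show ?thesis .
qed

lemma openin_config_cyl:
  assumes U: "openin (config_topology I) U" and \<omega>: "\<omega> \<in> U"
  shows "\<exists>F. finite F \<and> F \<subseteq> I \<and> {\<eta> \<in> extensional I. \<forall>i\<in>F. \<eta> i = \<omega> i} \<subseteq> U"
proof -
  obtain V where V: "finite {i \<in> I. V i \<noteq> UNIV}" "\<omega> \<in> PiE I V" "PiE I V \<subseteq> U"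
    using U \<omega> unfolding config_topology_def openin_product_topology_alt by (auto simp: topspace_discrete_topology)
  then show ?thesis
    by (intro exI[of _ "{i \<in> I. V i \<noteq> UNIV}"]) (fastforce simp: PiE_def Pi_def)
qed

text \<open>Over a countable index set there are only countably many basic cylinders, so every open
  set is a countable union of them and the Borel and product sigma-algebras agree.\<close>

lemma sets_borel_config:
  assumes I: "countable I"
  shows "sets (borel_algebra (config_topology I)) = sets (cfg I)"
proof -
  have sub: "{U. openin (config_topology I) U} \<subseteq> Pow (extensional I)"
    using openin_subset[of "config_topology I"] by auto
  then have B: "sets (borel_algebra (config_topology I)) =
      sigma_sets (extensional I) {U. openin (config_topology I) U}"
    by (simp add: borel_algebra_def)
  have "cyls I True \<subseteq> {U. openin (config_topology I) U}"
    using cyl_openin[of _ I "\<lambda>_. True"] by (auto simp: cyls_def cyl_def)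
  then have 1: "sets (cfg I) \<subseteq> sets (borel_algebra (config_topology I))"
    unfolding B sets_cfg_cyls[of I True] by (rule sigma_sets_mono')
  have "U \<in> sets (cfg I)" if U: "openin (config_topology I) U" for U
  proof -
    \<comment> \<open>A pair records the sites forced open and the sites forced closed; overlapping
      pairs merely give the empty set.\<close>
    define D where "D = {(A, B). A \<in> {F. finite F \<and> F \<subseteq> I} \<and> B \<in> {F. finite F \<and> F \<subseteq> I}}"
    define K where "K = (\<lambda>(A, B). {\<eta> \<in> extensional I. (\<forall>i\<in>A. \<eta> i = True) \<and> (\<forall>i\<in>B. \<eta> i = False)})"
    have "D = {F. finite F \<and> F \<subseteq> I} \<times> {F. finite F \<and> F \<subseteq> I}" by (auto simp: D_def)
    then have "countable D" using I by (simp add: countable_Collect_finite_subset)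
    have "K d \<in> sets (cfg I)" if "d \<in> D" for d
    proof -
      have "K d = cyl I True (fst d) \<inter> cyl I False (snd d)"
        by (auto simp: K_def cyl_def split: prod.splits)
      then show ?thesis using that by (auto simp: D_def intro!: sets.Int cyl_sets)
    qed
    moreover have "U = (\<Union>d\<in>{d\<in>D. K d \<subseteq> U}. K d)"
    proof
      show "U \<subseteq> (\<Union>d\<in>{d\<in>D. K d \<subseteq> U}. K d)"
      proof
        fix \<omega> assume \<omega>: "\<omega> \<in> U"
        then have ext: "\<omega> \<in> extensional I" using sub U by auto
        obtain F where F: "finite F" "F \<subseteq> I" "{\<eta> \<in> extensional I. \<forall>i\<in>F. \<eta> i = \<omega> i} \<subseteq> U"
          using openin_config_cyl[OF U \<omega>] by auto
        let ?d = "({i\<in>F. \<omega> i}, {i\<in>F. \<not> \<omega> i})"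
        have "?d \<in> D" using F by (auto simp: D_def)
        moreover have "K ?d \<subseteq> U" using F(3) by (auto simp: K_def)
        moreover have "\<omega> \<in> K ?d" using ext by (auto simp: K_def)
        ultimately show "\<omega> \<in> (\<Union>d\<in>{d\<in>D. K d \<subseteq> U}. K d)" by blast
      qed
    qed auto
    moreover have "(\<Union>d\<in>{d\<in>D. K d \<subseteq> U}. K d) \<in> sets (cfg I)"
      using \<open>countable D\<close> calculation(1) by (intro sets.countable_UN') auto
    ultimately show ?thesis by simp
  qed
  then have "sets (borel_algebra (config_topology I)) \<subseteq> sets (cfg I)"
    unfolding B using sets.sigma_sets_subset[of "{U. openin (config_topology I) U}" "cfg I"] by auto
  with 1 show ?thesis by auto
qed

text \<open>Reachability is a countable union over path lengths, and each additional step is a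
  quantifier over the countable set \<open>X\<close>.\<close>

lemma pred_rtrancl:
  assumes X: "countable X" and R: "\<And>\<omega>. R \<omega> \<subseteq> X \<times> X"
    and m: "\<And>x y. x \<in> X \<Longrightarrow> y \<in> X \<Longrightarrow> Measurable.pred M (\<lambda>\<omega>. (x, y) \<in> R \<omega>)"
  shows "Measurable.pred M (\<lambda>\<omega>. (x, y) \<in> (R \<omega>)\<^sup>*)"
proof -
  have n: "Measurable.pred M (\<lambda>\<omega>. (x, y) \<in> R \<omega> ^^ n)" for n x
  proof (induction n arbitrary: x)
    case (Suc n)
    have "(x, y) \<in> R \<omega> ^^ Suc n \<longleftrightarrow> x \<in> X \<and> (\<exists>z\<in>X. (x, z) \<in> R \<omega> \<and> (z, y) \<in> R \<omega> ^^ n)" for \<omega>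
    proof
      assume "(x, y) \<in> R \<omega> ^^ Suc n"
      then obtain z where "(x, z) \<in> R \<omega>" "(z, y) \<in> R \<omega> ^^ n" using relpow_Suc_D2 by metis
      then show "x \<in> X \<and> (\<exists>z\<in>X. (x, z) \<in> R \<omega> \<and> (z, y) \<in> R \<omega> ^^ n)" using R[of \<omega>] by blast
    qed (meson relpow_Suc_I2)
    moreover have "Measurable.pred M (\<lambda>\<omega>. x \<in> X \<and> (\<exists>z\<in>X. (x, z) \<in> R \<omega> \<and> (z, y) \<in> R \<omega> ^^ n))"
    proof (cases "x \<in> X")
      case True
      then have "Measurable.pred M (\<lambda>\<omega>. \<exists>z\<in>X. (x, z) \<in> R \<omega> \<and> (z, y) \<in> R \<omega> ^^ n)"
        by (intro pred_Bex_countable[OF X] pred_intros_logic(3) m Suc)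
      then show ?thesis using True by simp
    qed simp
    ultimately show ?case by simp
  qed simp
  have "(x, y) \<in> (R \<omega>)\<^sup>* \<longleftrightarrow> (\<exists>n. (x, y) \<in> R \<omega> ^^ n)" for \<omega>
    by (auto simp: rtrancl_power)
  then show ?thesis using n by simp
qed

section \<open>Invariant measures and weak mixing\<close>

context inf_group
begin

abbreviation "\<Omega> \<equiv> extensional (carrier G) :: ('a \<Rightarrow> bool) set"
abbreviation "cG \<equiv> cfg (carrier G)"
abbreviation "topG \<equiv> config_topology (carrier G)"
abbreviation "cylG \<equiv> cyl (carrier G)"

text \<open>Translation by \<open>inv g\<close>, which keeps inverses out of the formulas: the
  preimage \<open>tset g\<close> of the cylinder over \<open>F\<close> is the cylinder over
  \<open>g F\<close>. Invariance under all \<open>g\<close> is unaffected, but composition reverses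
  the order.\<close>

definition tr :: "'a \<Rightarrow> ('a \<Rightarrow> bool) \<Rightarrow> ('a \<Rightarrow> bool)" where
  "tr g \<omega> = (\<lambda>x\<in>carrier G. \<omega> (g \<otimes> x))"

definition tset :: "'a \<Rightarrow> ('a \<Rightarrow> bool) set \<Rightarrow> ('a \<Rightarrow> bool) set" where
  "tset g A = {\<omega> \<in> \<Omega>. tr g \<omega> \<in> A}"

lemma translate_eq_tr:
  "g \<in> carrier G \<Longrightarrow> translate G (carrier G) (\<lambda>g a. g \<otimes> a) g = tr (inv g)"
  by (auto simp: translate_def tr_def)

lemma tr_apply [simp]: "x \<in> carrier G \<Longrightarrow> tr g \<omega> x = \<omega> (g \<otimes> x)"
  by (simp add: tr_def)

lemma tr_in [simp]: "tr g \<omega> \<in> \<Omega>"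
  by (simp add: tr_def)

lemma tr_tr: "g \<in> carrier G \<Longrightarrow> h \<in> carrier G \<Longrightarrow> tr g (tr h \<omega>) = tr (h \<otimes> g) \<omega>"
  unfolding tr_def by (rule restrict_ext) (simp add: m_assoc)

lemma tr_one: "\<omega> \<in> \<Omega> \<Longrightarrow> tr \<one> \<omega> = \<omega>"
  by (rule extensionalityI[where A = "carrier G"]) (auto simp: tr_def)

lemma tr_measurable: "g \<in> carrier G \<Longrightarrow> tr g \<in> measurable cG cG"
  unfolding tr_def[abs_def] by (intro measurable_cfg pred_cfg) auto

lemma Omega_sets: "\<Omega> \<in> sets cG"
  using sets.top[of cG] by simp

lemma tset_sets: "g \<in> carrier G \<Longrightarrow> A \<in> sets cG \<Longrightarrow> tset g A \<in> sets cG"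
  using measurable_sets[OF tr_measurable, of g A] by (simp add: tset_def vimage_def Int_def conj_commute)

lemma tset_cyl:
  "g \<in> carrier G \<Longrightarrow> F \<subseteq> carrier G \<Longrightarrow> tset g (cylG c F) = cylG c ((\<otimes>) g ` F)"
  by (auto simp: tset_def cyl_def subset_iff)

definition inv_prob :: "('a \<Rightarrow> bool) measure \<Rightarrow> bool" where
  "inv_prob \<mu> \<longleftrightarrow> prob_space \<mu> \<and> sets \<mu> = sets cG \<and>
     (\<forall>g\<in>carrier G. \<forall>A\<in>sets cG. measure \<mu> (tset g A) = measure \<mu> A)"

lemma inv_probD:
  assumes "inv_prob \<mu>"
  shows "prob_space \<mu>" "sets \<mu> = sets cG" "space \<mu> = \<Omega>"
    "g \<in> carrier G \<Longrightarrow> A \<in> sets cG \<Longrightarrow> measure \<mu> (tset g A) = measure \<mu> A"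
  using assms sets_eq_imp_space_eq[of \<mu> cG] by (auto simp: inv_prob_def)

lemma distr_eq_iff_inv:
  assumes "prob_space \<mu>" "sets \<mu> = sets cG" "g \<in> carrier G"
  shows "distr \<mu> \<mu> (tr g) = \<mu> \<longleftrightarrow> (\<forall>A\<in>sets cG. measure \<mu> (tset g A) = measure \<mu> A)"
proof -
  interpret prob_space \<mu> by fact
  have sp: "space \<mu> = \<Omega>" using sets_eq_imp_space_eq[OF assms(2)] by simp
  have m: "tr g \<in> measurable \<mu> \<mu>"
    using tr_measurable[OF assms(3)] by (simp add: measurable_cong_sets[OF assms(2) assms(2)])
  have "emeasure (distr \<mu> \<mu> (tr g)) A = measure \<mu> (tset g A)" if "A \<in> sets cG" for A
    using that m assms by (simp add: emeasure_distr emeasure_eq_measure tset_def vimage_def Int_def conj_commute sp)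
  then show ?thesis
    using assms by (auto intro!: measure_eqI simp: emeasure_eq_measure)
qed

lemma invariant_measures_iff:
  "\<mu> \<in> invariant_measures G (carrier G) (\<lambda>g a. g \<otimes> a) \<longleftrightarrow> inv_prob \<mu>"
proof -
  have "(\<forall>g\<in>carrier G. distr \<mu> \<mu> (translate G (carrier G) (\<lambda>g a. g \<otimes> a) g) = \<mu>) \<longleftrightarrow>
      (\<forall>g\<in>carrier G. distr \<mu> \<mu> (tr g) = \<mu>)"
    by (auto simp: translate_eq_tr) (metis inv_closed inv_inv)
  then show ?thesis
    using distr_eq_iff_inv[of \<mu>]
    by (auto simp: invariant_measures_def borel_prob_measures_def inv_prob_def
        sets_borel_config[OF countable_carrier])
qed

lemma inv_prob_cylI:
  assumes \<mu>: "prob_space \<mu>" "sets \<mu> = sets cG"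
    and cyl: "\<And>g F. g \<in> carrier G \<Longrightarrow> finite F \<Longrightarrow> F \<subseteq> carrier G \<Longrightarrow>
      measure \<mu> (cylG b ((\<otimes>) g ` F)) = measure \<mu> (cylG b F)"
  shows "inv_prob \<mu>"
proof -
  interpret prob_space \<mu> by fact
  have sp: "space \<mu> = \<Omega>" using sets_eq_imp_space_eq[OF \<mu>(2)] by simp
  have "distr \<mu> \<mu> (tr g) = \<mu>" if g: "g \<in> carrier G" for g
  proof (rule cfg_measure_eqI[where I = "carrier G" and c = b])
    have m: "tr g \<in> measurable \<mu> \<mu>"
      using tr_measurable[OF g] by (simp add: measurable_cong_sets[OF \<mu>(2) \<mu>(2)])
    then show "prob_space (distr \<mu> \<mu> (tr g))" by (rule prob_space_distr)
    fix F assume F: "finite F" "F \<subseteq> carrier G"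
    have "measure (distr \<mu> \<mu> (tr g)) (cylG b F) = measure \<mu> (tset g (cylG b F))"
      using m F \<mu> by (simp add: measure_distr cyl_sets tset_def vimage_def Int_def conj_commute sp)
    then show "measure (distr \<mu> \<mu> (tr g)) (cylG b F) = measure \<mu> (cylG b F)"
      using cyl g F by (simp add: tset_cyl)
  qed (use \<mu> in auto)
  then show ?thesis using \<mu> distr_eq_iff_inv[OF \<mu>] by (auto simp: inv_prob_def)
qed

text \<open>Weak mixing with decorrelation only on average over \<open>g\<close>; the averaging
  measures may depend on \<open>A\<close> and \<open>B\<close>.\<close>

definition wmix :: "('a \<Rightarrow> bool) measure \<Rightarrow> bool" where
  "wmix \<mu> \<longleftrightarrow> (\<forall>A\<in>sets cG. \<forall>B\<in>sets cG.
     null (\<lambda>g. \<bar>measure \<mu> (A \<inter> tset g B) - measure \<mu> A * measure \<mu> B\<bar>))"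

lemma wmixD:
  "wmix \<mu> \<Longrightarrow> A \<in> sets cG \<Longrightarrow> B \<in> sets cG \<Longrightarrow>
    null (\<lambda>g. \<bar>measure \<mu> (A \<inter> tset g B) - measure \<mu> A * measure \<mu> B\<bar>)"
  by (auto simp: wmix_def)

text \<open>For an invariant event the correlation does not depend on \<open>g\<close>; a null
  constant is at most 0, so the probability equals its own square.\<close>

lemma wmix_ergodic:
  assumes inv: "inv_prob \<mu>" and wm: "wmix \<mu>"
  shows "\<mu> \<in> ergodic_measures G (carrier G) (\<lambda>g a. g \<otimes> a)"
  unfolding ergodic_measures_def
proof (intro CollectI conjI ballI impI)
  show "\<mu> \<in> invariant_measures G (carrier G) (\<lambda>g a. g \<otimes> a)" using inv by (simp add: invariant_measures_iff)
  fix A assume A: "A \<in> sets \<mu>"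
    and invA: "\<forall>g\<in>carrier G. translate G (carrier G) (\<lambda>g a. g \<otimes> a) g -` A \<inter> space \<mu> = A"
  have "tset g A = A" if g: "g \<in> carrier G" for g
    using invA[rule_format, of "inv g"] g
    by (simp add: translate_eq_tr inv_probD[OF inv] tset_def vimage_def Int_def conj_commute)
  then have "null (\<lambda>g. \<bar>measure \<mu> A - measure \<mu> A * measure \<mu> A\<bar>)"
    using null_mono[OF wmixD[OF wm]] A inv_probD(2)[OF inv] by simp
  then have "\<bar>measure \<mu> A - measure \<mu> A * measure \<mu> A\<bar> \<le> \<epsilon>" if "\<epsilon> > 0" for \<epsilon>
    using null_small that by blast
  then have "measure \<mu> A - measure \<mu> A * measure \<mu> A = 0"
    by (metis abs_le_zero_iff dense_ge)
  then show "measure \<mu> A = 0 \<or> measure \<mu> A = 1" by (simp add: algebra_simps)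
qed

lemma null_Dynkin:
  assumes inv: "inv_prob \<mu>"
    and add: "\<And>g A B. g \<in> carrier G \<Longrightarrow> A \<in> sets cG \<Longrightarrow> B \<in> sets cG \<Longrightarrow> A \<inter> B = {} \<Longrightarrow> M g (A \<union> B) = M g A + M g B"
    and top: "\<And>g. g \<in> carrier G \<Longrightarrow> M g \<Omega> = c"
    and nonneg: "\<And>g A. g \<in> carrier G \<Longrightarrow> A \<in> sets cG \<Longrightarrow> 0 \<le> M g A"
    and dom: "\<And>g A. g \<in> carrier G \<Longrightarrow> A \<in> sets cG \<Longrightarrow> M g A \<le> measure \<mu> A"
    and base: "\<And>F. finite F \<Longrightarrow> F \<subseteq> carrier G \<Longrightarrow>
       null (\<lambda>g. \<bar>M g (cylG b F) - c * measure \<mu> (cylG b F)\<bar>)"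
    and B: "B \<in> sets cG"
  shows "null (\<lambda>g. \<bar>M g B - c * measure \<mu> B\<bar>)"
proof -
  interpret prob_space \<mu> by (rule inv_probD(1)[OF inv])
  note [simp] = inv_probD(2,3)[OF inv]
  have tot: "measure \<mu> \<Omega> = 1" using prob_space by simp
  have c: "0 \<le> c" "c \<le> 1"
    using nonneg[OF one_closed Omega_sets] dom[OF one_closed Omega_sets] top[OF one_closed] tot by auto
  have M0: "M g {} = 0" if "g \<in> carrier G" for g
    using nonneg[OF that, of "{}"] dom[OF that, of "{}"] by simp
  have "B \<in> sigma_sets \<Omega> (cyls (carrier G) b)" using B sets_cfg_cyls[of "carrier G" b] by simp
  with Int_stable_cyls cyls_subset show ?thesis
  proof (induction rule: sigma_sets_induct_disjoint)
    case (basic A)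
    then show ?case using base by (auto simp: cyls_def)
  next
    case empty
    then show ?case by (intro null_mono[OF null_zero]) (simp add: M0)
  next
    case (compl A)
    then have A: "A \<in> sets cG" using sets_cfg_cyls[of "carrier G" b] by simp
    have "A \<subseteq> \<Omega>" using sets.sets_into_space[OF A] by simp
    then have MA: "M g (\<Omega> - A) = c - M g A" if "g \<in> carrier G" for g
      using add[OF that A, of "\<Omega> - A"] Omega_sets A top[OF that] by (simp add: Un_absorb1)
    have pA: "measure \<mu> (\<Omega> - A) = 1 - measure \<mu> A" using prob_compl[of A] A by simp
    show ?case
    proof (intro null_mono[OF compl(2)])
      fix g assume "g \<in> carrier G"
      then have "M g (\<Omega> - A) - c * prob (\<Omega> - A) = - (M g A - c * prob A)"
        by (simp only: MA pA) (simp add: algebra_simps)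
      then show "\<bar>M g (\<Omega> - A) - c * prob (\<Omega> - A)\<bar> \<le> \<bar>M g A - c * prob A\<bar>" by linarith
    qed
  next
    case (union A)
    have A: "A i \<in> sets cG" for i using union(2) sets_cfg_cyls[of "carrier G" b] by auto
    show ?case
    proof (rule null_uniform)
      fix \<epsilon> :: real assume \<epsilon>: "\<epsilon> > 0"
      have "(\<lambda>n. \<Sum>i<n. measure \<mu> (A i)) \<longlonglongrightarrow> measure \<mu> (\<Union>i. A i)"
        using finite_measure_UNION[of A] union(1) A by (auto simp: sums_def)
      \<comment> \<open>Cut the union where the remaining mass under \<mu> is below \<epsilon>; by
        \<open>dom\<close> the tail \<open>T\<close> is then negligible for all \<open>g\<close> at
        once.\<close>
      then obtain n where n: "\<bar>(\<Sum>i<n. measure \<mu> (A i)) - measure \<mu> (\<Union>i. A i)\<bar> < \<epsilon>"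
        using \<epsilon> by (metis LIMSEQ_iff order_refl real_norm_def)
      define U where "U = (\<Union>i<n. A i)"
      define T where "T = (\<Union>i. A i) - U"
      have meas: "U \<in> sets cG" "T \<in> sets cG" using A by (auto simp: U_def T_def)
      have un: "(\<Union>i. A i) = U \<union> T" and dis: "U \<inter> T = {}" by (auto simp: U_def T_def)
      have "measure \<mu> U = (\<Sum>i<n. measure \<mu> (A i))"
        unfolding U_def using union(1) A by (intro finite_measure_finite_Union) (auto simp: disjoint_family_on_def)
      moreover have mu: "measure \<mu> (\<Union>i. A i) = measure \<mu> U + measure \<mu> T"
        unfolding un using meas dis by (intro finite_measure_Union) auto
      ultimately have T: "measure \<mu> T \<le> \<epsilon>" and mU: "measure \<mu> U = (\<Sum>i<n. measure \<mu> (A i))"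
        using n by auto
      have MU: "M g (\<Union>i<m. A i) = (\<Sum>i<m. M g (A i))" if g: "g \<in> carrier G" for g m
      proof (induction m)
        case (Suc m)
        have "A i \<inter> A m = {}" if "i < m" for i
          using union(1) that by (auto simp: disjoint_family_on_def)
        then have "(\<Union>i<m. A i) \<inter> A m = {}" by blast
        then have "M g ((\<Union>i<m. A i) \<union> A m) = M g (\<Union>i<m. A i) + M g (A m)"
          using A by (intro add[OF g]) auto
        then show ?case using Suc by (simp add: lessThan_Suc Un_commute)
      qed (simp add: M0 g)
      show "\<exists>\<psi>. null \<psi> \<and> (\<forall>g\<in>carrier G.
          \<bar>M g (\<Union>i. A i) - c * measure \<mu> (\<Union>i. A i)\<bar> \<le> \<psi> g + \<epsilon>)"
      proof (intro exI conjI ballI)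
        show "null (\<lambda>g. \<Sum>i<n. \<bar>M g (A i) - c * measure \<mu> (A i)\<bar>)" by (intro null_sum union)
        fix g assume g: "g \<in> carrier G"
        have "M g (\<Union>i. A i) = (\<Sum>i<n. M g (A i)) + M g T"
          unfolding un using add[OF g meas dis] MU[OF g, of n] by (simp add: U_def)
        then have "M g (\<Union>i. A i) - c * measure \<mu> (\<Union>i. A i) =
            (\<Sum>i<n. M g (A i) - c * measure \<mu> (A i)) + (M g T - c * measure \<mu> T)"
          by (simp add: mu mU algebra_simps sum_subtractf sum_distrib_left)
        moreover have "\<bar>\<Sum>i<n. M g (A i) - c * measure \<mu> (A i)\<bar> \<le> (\<Sum>i<n. \<bar>M g (A i) - c * measure \<mu> (A i)\<bar>)"
          by (rule sum_abs)
        moreover have "\<bar>M g T - c * measure \<mu> T\<bar> \<le> \<epsilon>"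
        proof -
          have "0 \<le> c * measure \<mu> T" "c * measure \<mu> T \<le> measure \<mu> T"
            using c by (auto intro: mult_left_le_one_le)
          then show ?thesis using nonneg[OF g meas(2)] dom[OF g meas(2)] T by linarith
        qed
        ultimately show "\<bar>M g (\<Union>i. A i) - c * measure \<mu> (\<Union>i. A i)\<bar> \<le>
            (\<Sum>i<n. \<bar>M g (A i) - c * measure \<mu> (A i)\<bar>) + \<epsilon>" by linarith
      qed
    qed
  qed
qed

text \<open>Two passes of \<open>null_Dynkin\<close>: first the second event becomes arbitrary while
  the first is a cylinder, then the first becomes arbitrary too. In the first pass invariance of
  \<mu> supplies the domination.\<close>

lemma wmix_cylI:
  assumes inv: "inv_prob \<mu>"
    and cyl: "\<And>F F'. finite F \<Longrightarrow> F \<subseteq> carrier G \<Longrightarrow> finite F' \<Longrightarrow> F' \<subseteq> carrier G \<Longrightarrow>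
       null (\<lambda>g. \<bar>measure \<mu> (cylG b (F \<union> (\<otimes>) g ` F')) -
           measure \<mu> (cylG b F) * measure \<mu> (cylG b F')\<bar>)"
  shows "wmix \<mu>"
proof -
  interpret prob_space \<mu> by (rule inv_probD(1)[OF inv])
  note [simp] = inv_probD(2,3)[OF inv]
  have tot: "measure \<mu> \<Omega> = 1" using prob_space by simp
  have tdis: "tset g A \<inter> tset g B = {}" if "A \<inter> B = {}" for A B g using that by (auto simp: tset_def)
  have tun: "tset g (A \<union> B) = tset g A \<union> tset g B" for A B g by (auto simp: tset_def)
  have ttop: "tset g \<Omega> = \<Omega>" for g by (auto simp: tset_def)
  have cylm: "cylG b F \<in> sets cG" if "finite F" "F \<subseteq> carrier G" for F
    using that by (rule cyl_sets)
  have 1: "null (\<lambda>g. \<bar>measure \<mu> (cylG b F \<inter> tset g B) - measure \<mu> (cylG b F) * measure \<mu> B\<bar>)"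
    if F: "finite F" "F \<subseteq> carrier G" and B: "B \<in> sets cG" for F B
  proof (rule null_Dynkin[OF inv _ _ _ _ _ B, where b = b])
    fix g A B assume "g \<in> carrier G" "A \<in> sets cG" "B \<in> sets cG" "A \<inter> B = {}"
    then show "measure \<mu> (cylG b F \<inter> tset g (A \<union> B)) =
        measure \<mu> (cylG b F \<inter> tset g A) + measure \<mu> (cylG b F \<inter> tset g B)"
      using F tdis[of A B g] unfolding tun Int_Un_distrib
      by (intro finite_measure_Union) (auto intro: tset_sets cylm)
  next
    fix g assume "g \<in> carrier G"
    then show "measure \<mu> (cylG b F \<inter> tset g \<Omega>) = measure \<mu> (cylG b F)"
      unfolding ttop by (intro arg_cong[where f = "measure \<mu>"]) (auto simp: cyl_def)
  next
    fix g A assume "g \<in> carrier G" "A \<in> sets cG"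
    then show "measure \<mu> (cylG b F \<inter> tset g A) \<le> measure \<mu> A"
      using finite_measure_mono[of "cylG b F \<inter> tset g A" "tset g A"] inv_probD(4)[OF inv]
      by (simp add: tset_sets)
  next
    fix F' assume F': "finite F'" "F' \<subseteq> carrier G"
    show "null (\<lambda>g. \<bar>measure \<mu> (cylG b F \<inter> tset g (cylG b F')) -
        measure \<mu> (cylG b F) * measure \<mu> (cylG b F')\<bar>)"
      by (rule null_mono[OF cyl[OF F F']]) (simp add: tset_cyl F' cyl_Int)
  qed auto
  have "null (\<lambda>g. \<bar>measure \<mu> (A \<inter> tset g B) - measure \<mu> B * measure \<mu> A\<bar>)"
    if A: "A \<in> sets cG" and B: "B \<in> sets cG" for A B
  proof (rule null_Dynkin[OF inv _ _ _ _ _ A, where b = b])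
    fix g A A' assume "g \<in> carrier G" "A \<in> sets cG" "A' \<in> sets cG" "A \<inter> A' = {}"
    then show "measure \<mu> ((A \<union> A') \<inter> tset g B) = measure \<mu> (A \<inter> tset g B) + measure \<mu> (A' \<inter> tset g B)"
      using B unfolding Int_Un_distrib2
      by (intro finite_measure_Union) (auto intro: tset_sets)
  next
    fix g assume g: "g \<in> carrier G"
    have "\<Omega> \<inter> tset g B = tset g B" by (auto simp: tset_def)
    then show "measure \<mu> (\<Omega> \<inter> tset g B) = measure \<mu> B" using inv_probD(4)[OF inv g B] by simp
  next
    fix g A assume "g \<in> carrier G" "A \<in> sets cG"
    then show "measure \<mu> (A \<inter> tset g B) \<le> measure \<mu> A"
      using finite_measure_mono[of "A \<inter> tset g B" A] by simp
  next
    fix F assume F: "finite F" "F \<subseteq> carrier G"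
    show "null (\<lambda>g. \<bar>measure \<mu> (cylG b F \<inter> tset g B) - measure \<mu> B * measure \<mu> (cylG b F)\<bar>)"
      using 1[OF F B] by (simp add: mult.commute)
  qed auto
  then show ?thesis by (simp add: wmix_def mult.commute)
qed

end

section \<open>Percolation clusters\<close>

text \<open>Two functions with the same fibres have equally many values. It is used to identify the
  number of coins that decide about \<open>F\<close> with the number of clusters meeting
  \<open>F\<close>.\<close>

lemma card_image_cong_inj:
  assumes "\<And>x y. x \<in> F \<Longrightarrow> y \<in> F \<Longrightarrow> f x = f y \<longleftrightarrow> g x = g y"
  shows "card (f ` F) = card (g ` F)"
proof (rule bij_betw_same_card[of "\<lambda>z. g (inv_into F f z)"])
  have 1: "f (inv_into F f (f x)) = f x" "inv_into F f (f x) \<in> F" if "x \<in> F" for x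
    using that by (auto intro: f_inv_into_f inv_into_into)
  have 2: "g (inv_into F f (f x)) = g x" if "x \<in> F" for x
    using 1[OF that] assms[of "inv_into F f (f x)" x] that by blast
  have "inj_on (\<lambda>z. g (inv_into F f z)) (f ` F)"
    by (rule inj_onI) (use 2 assms in force)
  moreover have "(\<lambda>z. g (inv_into F f z)) ` (f ` F) = g ` F"
    unfolding image_image using 2 by (rule image_cong[OF refl])
  ultimately show "bij_betw (\<lambda>z. g (inv_into F f z)) (f ` F) (g ` F)"
    by (simp add: bij_betw_def)
qed

locale cayley = inf_group G for G (structure) +
  fixes S :: "'a set"
  assumes S_sub: "S \<subseteq> carrier G"
    and S_fin: "finite S"
    and S_inv: "\<And>s. s \<in> S \<Longrightarrow> inv s \<in> S"
    and S_gen: "generate G S = carrier G"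
begin

definition crel :: "('a \<Rightarrow> bool) \<Rightarrow> 'a rel" where
  "crel \<omega> = {(u, v). cayley_adj G S u v \<and> \<omega> u \<and> \<omega> v}"

text \<open>The reflexive closure relates every point to itself, so openness of \<open>x\<close> is
  demanded separately: a closed vertex belongs to no cluster.\<close>

definition conn :: "('a \<Rightarrow> bool) \<Rightarrow> 'a \<Rightarrow> 'a \<Rightarrow> bool" where
  "conn \<omega> x y \<longleftrightarrow> x \<in> carrier G \<and> \<omega> x \<and> (x, y) \<in> (crel \<omega>)\<^sup>*"

lemma cayley_adj_sym: "cayley_adj G S a b \<Longrightarrow> cayley_adj G S b a"
  using S_inv[of "inv a \<otimes> b"] by (auto simp: cayley_adj_def inv_mult_group)

lemma cayley_adj_carrier: "cayley_adj G S a b \<Longrightarrow> a \<in> carrier G \<and> b \<in> carrier G"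
  by (auto simp: cayley_adj_def)

lemma cayley_adj_mult:
  assumes "g \<in> carrier G" "a \<in> carrier G" "b \<in> carrier G"
  shows "cayley_adj G S (g \<otimes> a) (g \<otimes> b) \<longleftrightarrow> cayley_adj G S a b"
proof -
  have "inv (g \<otimes> a) \<otimes> (g \<otimes> b) = inv a \<otimes> b"
    using assms by (simp add: inv_mult_group m_assoc) (simp add: m_assoc[symmetric])
  then show ?thesis using assms by (auto simp: cayley_adj_def)
qed

lemma crel_sym: "sym ((crel \<omega>)\<^sup>*)"
  by (rule sym_rtrancl) (auto simp: sym_def crel_def intro: cayley_adj_sym)

lemma conn_refl: "x \<in> carrier G \<Longrightarrow> \<omega> x \<Longrightarrow> conn \<omega> x x"
  by (simp add: conn_def)

lemma connD: assumes "conn \<omega> x y" shows "x \<in> carrier G" "y \<in> carrier G" "\<omega> x" "\<omega> y"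
proof -
  have "(x, y) \<in> (crel \<omega>)\<^sup>*" and x: "x \<in> carrier G" "\<omega> x" using assms by (auto simp: conn_def)
  then have "y \<in> carrier G \<and> \<omega> y"
    by (induction rule: rtrancl_induct) (auto simp: crel_def cayley_adj_def)
  with x show "x \<in> carrier G" "y \<in> carrier G" "\<omega> x" "\<omega> y" by auto
qed

lemma conn_sym: "conn \<omega> x y \<Longrightarrow> conn \<omega> y x"
  unfolding conn_def[of \<omega> y x] by (meson connD(2,4) conn_def crel_sym symD)

lemma conn_trans: "conn \<omega> x y \<Longrightarrow> conn \<omega> y z \<Longrightarrow> conn \<omega> x z"
  by (auto simp: conn_def intro: rtrancl_trans)

lemma conn_cong: "conn \<omega> x y \<Longrightarrow> conn \<omega> x z \<longleftrightarrow> conn \<omega> y z"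
  using conn_trans conn_sym by blast

lemma conn_adj: "cayley_adj G S x y \<Longrightarrow> \<omega> x \<Longrightarrow> \<omega> y \<Longrightarrow> conn \<omega> x y"
  by (auto simp: conn_def crel_def cayley_adj_def)

lemma pred_conn: "Measurable.pred cG (\<lambda>\<omega>. conn \<omega> x y)"
proof (cases "x \<in> carrier G")
  case True
  have "Measurable.pred cG (\<lambda>\<omega>. (x, y) \<in> (crel \<omega>)\<^sup>*)"
  proof (rule pred_rtrancl[OF countable_carrier])
    show "crel \<omega> \<subseteq> carrier G \<times> carrier G" for \<omega> by (auto simp: crel_def cayley_adj_def)
    show "Measurable.pred cG (\<lambda>\<omega>. (x, y) \<in> crel \<omega>)" if "x \<in> carrier G" "y \<in> carrier G" for x y
      using that unfolding crel_def by (simp, intro pred_intros_logic(3) pred_cfg) auto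
  qed
  then have "Measurable.pred cG (\<lambda>\<omega>. \<omega> x \<and> (x, y) \<in> (crel \<omega>)\<^sup>*)"
    by (intro pred_intros_logic(3) pred_cfg True)
  then show ?thesis using True by (simp add: conn_def)
qed (simp add: conn_def)

abbreviation together :: "'a \<Rightarrow> 'a \<Rightarrow> ('a \<Rightarrow> bool) set" where
  "together x y \<equiv> {\<omega>\<in>\<Omega>. conn \<omega> x y}"

lemma conn_sets: "together x y \<in> sets cG"
  using pred_sets[OF pred_conn] by simp

lemma conn_tr_imp:
  assumes g: "g \<in> carrier G" and c: "conn (tr g \<omega>) x y"
  shows "conn \<omega> (g \<otimes> x) (g \<otimes> y)"
proof -
  have "(x, y) \<in> (crel (tr g \<omega>))\<^sup>*" and x: "x \<in> carrier G" "\<omega> (g \<otimes> x)"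
    using c by (auto simp: conn_def)
  then have "(g \<otimes> x, g \<otimes> y) \<in> (crel \<omega>)\<^sup>*"
  proof (induction rule: rtrancl_induct)
    case (step y z)
    then have "(g \<otimes> y, g \<otimes> z) \<in> crel \<omega>"
      using g cayley_adj_carrier[of y z] by (auto simp: crel_def cayley_adj_mult)
    then show ?case using step by auto
  qed simp
  then show ?thesis using g x by (simp add: conn_def)
qed

lemma conn_cong_carrier:
  assumes "\<And>x. x \<in> carrier G \<Longrightarrow> \<omega> x = \<eta> x"
  shows "conn \<omega> = conn \<eta>"
proof -
  have "crel \<omega> = crel \<eta>" using assms by (auto simp: crel_def cayley_adj_def)
  then show ?thesis using assms by (auto simp: conn_def fun_eq_iff)
qed

lemma conn_tr:
  assumes "g \<in> carrier G" "x \<in> carrier G" "y \<in> carrier G"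
  shows "conn (tr g \<omega>) x y \<longleftrightarrow> conn \<omega> (g \<otimes> x) (g \<otimes> y)"
proof
  assume "conn \<omega> (g \<otimes> x) (g \<otimes> y)"
  \<comment> \<open>The two translations cancel only on the carrier, since \<omega> need not be
    extensional; \<open>conn\<close> does not see values elsewhere.\<close>
  moreover have "conn (tr (inv g) (tr g \<omega>)) = conn \<omega>"
    using assms by (intro conn_cong_carrier) (simp add: m_assoc[symmetric])
  ultimately have "conn (tr g \<omega>) (inv g \<otimes> (g \<otimes> x)) (inv g \<otimes> (g \<otimes> y))"
    using assms conn_tr_imp[of "inv g" "tr g \<omega>" "g \<otimes> x" "g \<otimes> y"] by simp
  then show "conn (tr g \<omega>) x y" using assms by (simp add: m_assoc[symmetric])
qed (use conn_tr_imp assms in auto)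

section \<open>The number of clusters that meet a finite set\<close>

definition cls :: "('a \<Rightarrow> bool) \<Rightarrow> 'a set \<Rightarrow> 'a \<Rightarrow> 'a set" where
  "cls \<omega> F x = {y\<in>F. conn \<omega> x y}"

text \<open>Clusters are counted through their traces on \<open>F\<close>. This is the number of
  clusters meeting \<open>F\<close> when all of \<open>F\<close> is open; closed points would
  contribute the empty trace, so it is paired with \<open>cylG True F\<close> below.\<close>

definition ncl :: "('a \<Rightarrow> bool) \<Rightarrow> 'a set \<Rightarrow> nat" where
  "ncl \<omega> F = card (cls \<omega> F ` F)"

definition ncyl :: "'a set \<Rightarrow> nat \<Rightarrow> ('a \<Rightarrow> bool) set" where
  "ncyl F j = {\<omega> \<in> cylG True F. ncl \<omega> F = j}"

lemma ncl_le: "finite F \<Longrightarrow> ncl \<omega> F \<le> card F"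
  by (simp add: ncl_def card_image_le)

lemma ncl_tr:
  assumes g: "g \<in> carrier G" and F: "F \<subseteq> carrier G"
  shows "ncl (tr g \<omega>) F = ncl \<omega> ((\<otimes>) g ` F)"
proof -
  have "cls \<omega> ((\<otimes>) g ` F) (g \<otimes> x) = (\<otimes>) g ` cls (tr g \<omega>) F x" if "x \<in> F" for x
    using assms that by (auto simp: cls_def conn_tr subset_iff)
  then have "cls \<omega> ((\<otimes>) g ` F) ` ((\<otimes>) g ` F) = (\<lambda>A. (\<otimes>) g ` A) ` (cls (tr g \<omega>) F ` F)"
    by (auto simp: image_image)
  moreover have "inj_on (\<lambda>A. (\<otimes>) g ` A) (cls (tr g \<omega>) F ` F)"
  proof (rule inj_on_subset[OF inj_on_image_Pow])
    show "inj_on ((\<otimes>) g) F" using assms by (auto simp: inj_on_def subset_iff)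
  qed (auto simp: cls_def)
  ultimately show ?thesis unfolding ncl_def by (simp add: card_image)
qed

lemma tset_ncyl:
  "g \<in> carrier G \<Longrightarrow> F \<subseteq> carrier G \<Longrightarrow> tset g (ncyl F j) = ncyl ((\<otimes>) g ` F) j"
  using tset_cyl[of g F True] by (auto simp: ncyl_def ncl_tr tset_def)

text \<open>The count depends only on the connectivity pattern on \<open>F \<times> F\<close>; there
  are finitely many patterns, each a finite conjunction of measurable conditions.\<close>

lemma ncyl_sets:
  assumes F: "finite F" "F \<subseteq> carrier G"
  shows "ncyl F j \<in> sets cG"
proof -
  define P where "P = (\<lambda>\<omega>. {(x, y)\<in>F\<times>F. conn \<omega> x y})"
  define n where "n = (\<lambda>Q. card ((\<lambda>x. {y\<in>F. (x, y) \<in> Q}) ` F))"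
  have ncl: "ncl \<omega> F = n (P \<omega>)" for \<omega>
    unfolding ncl_def n_def P_def cls_def by (intro arg_cong[where f = card] image_cong) auto
  have *: "{\<omega>\<in>\<Omega>. P \<omega> = Q} \<in> sets cG" if "Q \<subseteq> F \<times> F" for Q
  proof -
    have eq: "{\<omega>\<in>\<Omega>. P \<omega> = Q} = {\<omega>\<in>space cG. \<forall>xy\<in>F\<times>F. conn \<omega> (fst xy) (snd xy) = (xy \<in> Q)}"
      using that by (auto simp: P_def)
    have "Measurable.pred cG (\<lambda>\<omega>. \<forall>xy\<in>F\<times>F. conn \<omega> (fst xy) (snd xy) = (xy \<in> Q))"
    proof (intro pred_Ball_countable pred_intros_logic(6) pred_conn)
      show "countable (F \<times> F)" using F by (simp add: countable_finite)
    qed simp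
    then show ?thesis unfolding eq by (rule pred_sets)
  qed
  have "ncyl F j = cylG True F \<inter> (\<Union>Q\<in>{Q\<in>Pow (F\<times>F). n Q = j}. {\<omega>\<in>\<Omega>. P \<omega> = Q})"
    by (auto simp: ncyl_def ncl cyl_def P_def)
  moreover have "(\<Union>Q\<in>{Q\<in>Pow (F\<times>F). n Q = j}. {\<omega>\<in>\<Omega>. P \<omega> = Q}) \<in> sets cG"
    using F * by (intro sets.finite_UN) auto
  ultimately show ?thesis using F by (auto intro: cyl_sets)
qed

lemma cls_eq_iff: "F \<subseteq> carrier G \<Longrightarrow> \<forall>x\<in>F. \<omega> x \<Longrightarrow> x \<in> F \<Longrightarrow> y \<in> F \<Longrightarrow> cls \<omega> F x = cls \<omega> F y \<longleftrightarrow> conn \<omega> x y"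
proof
  assume "F \<subseteq> carrier G" "\<forall>x\<in>F. \<omega> x" "y \<in> F" "cls \<omega> F x = cls \<omega> F y"
  then have "y \<in> cls \<omega> F x" using conn_refl[of y \<omega>] by (auto simp: cls_def)
  then show "conn \<omega> x y" by (simp add: cls_def)
qed (auto simp: cls_def dest: conn_cong)

text \<open>If no cluster meets both sets, no coin is shared; additivity of the count becomes a
  product of survival probabilities.\<close>

lemma ncl_Un:
  assumes F: "finite F" "F \<subseteq> carrier G" "finite F'" "F' \<subseteq> carrier G" and \<omega>: "\<forall>x\<in>F\<union>F'. \<omega> x"
    and sep: "\<And>x y. x \<in> F \<Longrightarrow> y \<in> F' \<Longrightarrow> \<not> conn \<omega> x y"
  shows "ncl \<omega> (F \<union> F') = ncl \<omega> F + ncl \<omega> F'"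
proof -
  have 1: "cls \<omega> (F \<union> F') x = cls \<omega> F x" if "x \<in> F" for x using sep that by (auto simp: cls_def)
  have 2: "cls \<omega> (F \<union> F') x = cls \<omega> F' x" if "x \<in> F'" for x
    using sep that by (auto simp: cls_def dest: conn_sym)
  have "cls \<omega> (F \<union> F') ` (F \<union> F') = cls \<omega> F ` F \<union> cls \<omega> F' ` F'"
    by (simp add: image_Un 1 2)
  moreover have "cls \<omega> F ` F \<inter> cls \<omega> F' ` F' = {}"
  proof -
    have "cls \<omega> F x \<noteq> cls \<omega> F' y" if "x \<in> F" "y \<in> F'" for x y
    proof -
      have "x \<in> cls \<omega> F x" using that F \<omega> by (auto simp: cls_def intro: conn_refl)
      moreover have "x \<notin> cls \<omega> F' y" using sep[OF that] by (auto simp: cls_def dest: conn_sym)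
      ultimately show ?thesis by blast
    qed
    then show ?thesis by blast
  qed
  ultimately show ?thesis using F unfolding ncl_def by (simp add: card_Un_disjoint)
qed

section \<open>Bernoulli percolation, unions and thinning\<close>

definition bern :: "'i set \<Rightarrow> real \<Rightarrow> ('i \<Rightarrow> bool) measure" where
  "bern I p = PiM I (\<lambda>_. measure_pmf (bernoulli_pmf p))"

lemma sets_bern [measurable_cong]: "sets (bern I p) = sets (cfg I)"
  unfolding bern_def cfg_def by (rule sets_PiM_cong) auto

lemma space_bern [simp]: "space (bern I p) = extensional I"
  using sets_eq_imp_space_eq[OF sets_bern] by simp

lemma prob_bern: "prob_space (bern I p)"
  unfolding bern_def by (rule prob_space_PiM) (rule measure_pmf.prob_space_axioms)

lemma bern_cyl:
  assumes F: "finite F" "F \<subseteq> I" and p: "0 \<le> p" "p \<le> 1"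
  shows "measure (bern I p) (cyl I True F) = p ^ card F"
proof -
  interpret product_prob_space "\<lambda>_. measure_pmf (bernoulli_pmf p)" I
    by unfold_locales
  have "emeasure (bern I p) {x\<in>space (bern I p). \<forall>i\<in>F. x i \<in> {True}} = (\<Prod>i\<in>F. emeasure (bernoulli_pmf p) {True})"
    unfolding bern_def using F by (intro emeasure_PiM_Collect) auto
  also have "\<dots> = ennreal (p ^ card F)" using p by (simp add: emeasure_pmf_single ennreal_power)
  finally show ?thesis using p by (simp add: cyl_def measure_def)
qed

lemma inv_prob_bern: "0 \<le> p \<Longrightarrow> p \<le> 1 \<Longrightarrow> inv_prob (bern (carrier G) p)"
proof (rule inv_prob_cylI[OF prob_bern sets_bern, where b = True])
  fix g F assume *: "g \<in> carrier G" "finite F" "F \<subseteq> carrier G" "0 \<le> p" "p \<le> 1"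
  then have "inj_on ((\<otimes>) g) F" by (auto simp: inj_on_def subset_iff)
  moreover have "(\<otimes>) g ` F \<subseteq> carrier G" using * by auto
  ultimately show "measure (bern (carrier G) p) (cylG True ((\<otimes>) g ` F)) =
      measure (bern (carrier G) p) (cylG True F)"
    using * by (simp add: bern_cyl card_image)
qed

text \<open>Disjoint sets of sites are exactly independent, so the correlation can be non-zero only
  if \<open>g F'\<close> meets \<open>F\<close>, which forces \<open>g\<close> into the finite set
  of quotients \<open>x \<otimes> inv y\<close>.\<close>

lemma wmix_bern:
  assumes p: "0 \<le> p" "p \<le> 1" shows "wmix (bern (carrier G) p)"
proof (rule wmix_cylI[OF inv_prob_bern[OF p], where b = True])
  fix F F' assume F: "finite F" "F \<subseteq> carrier G" "finite F'" "F' \<subseteq> carrier G"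
  let ?\<mu> = "measure (bern (carrier G) p)"
  let ?\<phi> = "\<lambda>g. \<bar>?\<mu> (cylG True (F \<union> (\<otimes>) g ` F')) - ?\<mu> (cylG True F) * ?\<mu> (cylG True F')\<bar>"
  interpret prob_space "bern (carrier G) p" by (rule prob_bern)
  show "null ?\<phi>"
  proof (rule null_finite_support)
    show "finite ((\<lambda>(x, y). x \<otimes> inv y) ` (F \<times> F'))" using F by simp
    fix g assume g: "g \<in> carrier G"
    show "?\<phi> g \<le> (if g \<in> (\<lambda>(x, y). x \<otimes> inv y) ` (F \<times> F') then 1 else 0)"
    proof (cases "F \<inter> (\<otimes>) g ` F' = {}")
      case True
      have gF: "(\<otimes>) g ` F' \<subseteq> carrier G" "finite ((\<otimes>) g ` F')" using F g by auto
      have "inj_on ((\<otimes>) g) F'" using g F by (auto simp: inj_on_def subset_iff)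
      then have "card (F \<union> (\<otimes>) g ` F') = card F + card F'"
        using True F by (simp add: card_Un_disjoint card_image)
      then have "?\<phi> g = 0" using F gF p by (simp add: bern_cyl power_add)
      then show ?thesis by simp
    next
      case False
      then obtain x y where xy: "x \<in> F" "y \<in> F'" "x = g \<otimes> y" by auto
      then have "g = x \<otimes> inv y" using F g by (auto simp: m_assoc subset_iff)
      then have "g \<in> (\<lambda>(x, y). x \<otimes> inv y) ` (F \<times> F')" using xy by force
      moreover have "\<bar>a - b * c\<bar> \<le> 1" if "0 \<le> a" "a \<le> 1" "0 \<le> b" "b \<le> 1" "0 \<le> c" "c \<le> 1" for a b c :: real
        using that mult_nonneg_nonneg[of b c] mult_le_one[of b c] by linarith
      ultimately show ?thesis by simp
    qed
  qed
qed

section \<open>The union of two independent copies\<close>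

definition uni :: "('a \<Rightarrow> bool) measure \<Rightarrow> ('a \<Rightarrow> bool) measure" where
  "uni \<mu> = distr (\<mu> \<Otimes>\<^sub>M \<mu>) cG (\<lambda>(a, b). \<lambda>x\<in>carrier G. a x \<or> b x)"

lemma uni_measurable:
  assumes "sets \<mu> = sets cG"
  shows "(\<lambda>(a, b). \<lambda>x\<in>carrier G. a x \<or> b x) \<in> measurable (\<mu> \<Otimes>\<^sub>M \<mu>) cG"
  unfolding case_prod_beta
proof (intro measurable_cfg pred_intros_logic(5))
  fix x assume x: "x \<in> carrier G"
  have "Measurable.pred \<mu> (\<lambda>\<omega>. \<omega> x)" using pred_cfg[OF x] measurable_cong_sets[OF assms refl] by blast
  then show "Measurable.pred (\<mu> \<Otimes>\<^sub>M \<mu>) (\<lambda>z. fst z x)" "Measurable.pred (\<mu> \<Otimes>\<^sub>M \<mu>) (\<lambda>z. snd z x)"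
    by (auto intro: measurable_compose[OF measurable_fst] measurable_compose[OF measurable_snd])
qed

lemma prob_uni:
  assumes "inv_prob \<mu>" shows "prob_space (uni \<mu>)" "sets (uni \<mu>) = sets cG"
proof -
  interpret prob_space \<mu> by (rule inv_probD(1)[OF assms])
  interpret pair_prob_space \<mu> \<mu> ..
  show "prob_space (uni \<mu>)" unfolding uni_def
    by (intro P.prob_space_distr uni_measurable inv_probD(2)[OF assms])
qed (simp add: uni_def)

text \<open>A set is closed in the union exactly if it is closed in both copies, so independence
  squares the probability.\<close>

lemma uni_cyl:
  assumes \<mu>: "inv_prob \<mu>" and F: "finite F" "F \<subseteq> carrier G"
  shows "measure (uni \<mu>) (cylG False F) = (measure \<mu> (cylG False F))\<^sup>2"
proof -
  interpret prob_space \<mu> by (rule inv_probD(1)[OF \<mu>])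
  let ?C = "cylG False F"
  have C: "?C \<in> sets \<mu>" using F inv_probD(2)[OF \<mu>] by (simp add: cyl_sets)
  have "measure (uni \<mu>) ?C = measure (\<mu> \<Otimes>\<^sub>M \<mu>)
      ((\<lambda>(a, b). \<lambda>x\<in>carrier G. a x \<or> b x) -` ?C \<inter> space (\<mu> \<Otimes>\<^sub>M \<mu>))"
    unfolding uni_def using F by (intro measure_distr uni_measurable inv_probD(2)[OF \<mu>] cyl_sets)
  also have "(\<lambda>(a, b). \<lambda>x\<in>carrier G. a x \<or> b x) -` ?C \<inter> space (\<mu> \<Otimes>\<^sub>M \<mu>) = ?C \<times> ?C"
    using F by (auto simp: cyl_def space_pair_measure inv_probD(3)[OF \<mu>] subset_iff)
  also have "measure (\<mu> \<Otimes>\<^sub>M \<mu>) (?C \<times> ?C) = (measure \<mu> ?C)\<^sup>2"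
    using emeasure_pair_measure_Times[OF C C]
    by (simp add: measure_def enn2real_mult power2_eq_square)
  finally show ?thesis .
qed

lemma inv_prob_uni: assumes \<mu>: "inv_prob \<mu>" shows "inv_prob (uni \<mu>)"
proof (rule inv_prob_cylI[OF prob_uni[OF \<mu>], where b = False])
  fix g F assume *: "g \<in> carrier G" "finite F" "F \<subseteq> carrier G"
  moreover have "(\<otimes>) g ` F \<subseteq> carrier G" using * by auto
  ultimately show "measure (uni \<mu>) (cylG False ((\<otimes>) g ` F)) = measure (uni \<mu>) (cylG False F)"
    using inv_probD(4)[OF \<mu> *(1) cyl_sets[OF *(2,3), of False]] by (simp add: uni_cyl \<mu> tset_cyl)
qed

lemma wmix_uni: assumes \<mu>: "inv_prob \<mu>" "wmix \<mu>" shows "wmix (uni \<mu>)"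
proof (rule wmix_cylI[OF inv_prob_uni[OF \<mu>(1)], where b = False])
  fix F F' assume F: "finite F" "F \<subseteq> carrier G" "finite F'" "F' \<subseteq> carrier G"
  interpret prob_space \<mu> by (rule inv_probD(1)[OF \<mu>(1)])
  let ?c = "\<lambda>F. cylG False F"
  have "null (\<lambda>g. 2 * \<bar>measure \<mu> (?c F \<inter> tset g (?c F')) - measure \<mu> (?c F) * measure \<mu> (?c F')\<bar>)"
    using F by (intro null_cmult wmixD[OF \<mu>(2)] cyl_sets) auto
  then show "null (\<lambda>g. \<bar>measure (uni \<mu>) (?c (F \<union> (\<otimes>) g ` F')) - measure (uni \<mu>) (?c F) * measure (uni \<mu>) (?c F')\<bar>)"
  proof (rule null_mono)
    fix g assume g: "g \<in> carrier G"
    \<comment> \<open>Squaring is 2-Lipschitz on the unit interval: this is the factor 2 in the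
      majorant above.\<close>
    have sq: "\<bar>a\<^sup>2 - b\<^sup>2\<bar> \<le> 2 * \<bar>a - b\<bar>" if "0 \<le> a" "a \<le> 1" "0 \<le> b" "b \<le> 1" for a b :: real
    proof -
      have "\<bar>a\<^sup>2 - b\<^sup>2\<bar> = (a + b) * \<bar>a - b\<bar>"
        using that by (simp add: power2_eq_square square_diff_square_factored abs_mult)
      also have "\<dots> \<le> 2 * \<bar>a - b\<bar>" using that by (intro mult_right_mono) auto
      finally show ?thesis .
    qed
    have gF: "(\<otimes>) g ` F' \<subseteq> carrier G" "finite ((\<otimes>) g ` F')" using F g by auto
    have "measure (uni \<mu>) (?c (F \<union> (\<otimes>) g ` F')) = (measure \<mu> (?c F \<inter> tset g (?c F')))\<^sup>2"
      using F gF g by (simp add: uni_cyl \<mu> tset_cyl cyl_Int)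
    moreover have "measure (uni \<mu>) (?c F) * measure (uni \<mu>) (?c F') = (measure \<mu> (?c F) * measure \<mu> (?c F'))\<^sup>2"
      using F by (simp add: uni_cyl \<mu> power_mult_distrib)
    ultimately show "\<bar>measure (uni \<mu>) (?c (F \<union> (\<otimes>) g ` F')) - measure (uni \<mu>) (?c F) * measure (uni \<mu>) (?c F')\<bar>
        \<le> 2 * \<bar>measure \<mu> (?c F \<inter> tset g (?c F')) - measure \<mu> (?c F) * measure \<mu> (?c F')\<bar>"
      by (simp add: sq mult_le_one)
  qed
qed


text \<open>The least vertex of the cluster of \<open>x\<close> in a fixed enumeration of \<open>G\<close>, so that independent
  coins attached to \<open>nat\<close> can decide about clusters.\<close>

definition rep :: "('a \<Rightarrow> bool) \<Rightarrow> 'a \<Rightarrow> nat" where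
  "rep \<omega> x = (LEAST n. conn \<omega> x (from_nat_into (carrier G) n))"

lemma rep_eq_iff:
  assumes "x \<in> carrier G" "y \<in> carrier G" "\<omega> x" "\<omega> y"
  shows "rep \<omega> x = rep \<omega> y \<longleftrightarrow> conn \<omega> x y"
proof
  have ex: "\<exists>n. conn \<omega> z (from_nat_into (carrier G) n)" if "z \<in> carrier G" "\<omega> z" for z
    using conn_refl[of z \<omega>] from_nat_into_surj[OF countable_carrier that(1)] that by metis
  have "conn \<omega> z (from_nat_into (carrier G) (rep \<omega> z))" if "z \<in> carrier G" "\<omega> z" for z
    unfolding rep_def using ex[OF that] by (rule LeastI_ex)
  then show "rep \<omega> x = rep \<omega> y \<Longrightarrow> conn \<omega> x y"
    using assms by (metis conn_sym conn_trans)
next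
  assume "conn \<omega> x y"
  then have "conn \<omega> x = conn \<omega> y" by (intro ext conn_cong)
  then show "rep \<omega> x = rep \<omega> y" by (simp add: rep_def)
qed

lemma rep_measurable: "(\<lambda>\<omega>. rep \<omega> x) \<in> measurable cG (count_space UNIV)"
  unfolding rep_def by (intro measurable_Least pred_conn)

definition thin_map :: "('a \<Rightarrow> bool) \<times> (nat \<Rightarrow> bool) \<Rightarrow> 'a \<Rightarrow> bool" where
  "thin_map = (\<lambda>(\<omega>, \<theta>). \<lambda>x\<in>carrier G. \<omega> x \<and> \<theta> (rep \<omega> x))"

definition thin :: "real \<Rightarrow> ('a \<Rightarrow> bool) measure \<Rightarrow> ('a \<Rightarrow> bool) measure" where
  "thin q \<nu> = distr (\<nu> \<Otimes>\<^sub>M bern UNIV q) cG thin_map"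

lemma thin_map_measurable:
  assumes "sets \<nu> = sets cG"
  shows "thin_map \<in> measurable (\<nu> \<Otimes>\<^sub>M bern UNIV q) cG"
  unfolding thin_map_def case_prod_beta
proof (intro measurable_cfg pred_intros_logic(3))
  let ?M = "\<nu> \<Otimes>\<^sub>M bern (UNIV :: nat set) q"
  have f: "fst \<in> measurable ?M cG"
    using measurable_fst[of \<nu> "bern UNIV q"] measurable_cong_sets[OF refl assms] by blast
  have s: "snd \<in> measurable ?M (cfg UNIV)"
    using measurable_snd[of \<nu> "bern UNIV q"] measurable_cong_sets[OF refl sets_bern] by blast
  fix x assume x: "x \<in> carrier G"
  show "Measurable.pred ?M (\<lambda>z. fst z x)"
    by (rule measurable_compose[OF f pred_cfg[OF x]])
  \<comment> \<open>The coin is read at a random index; splitting over its value leaves coins at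
    fixed indices.\<close>
  have "Measurable.pred ?M (\<lambda>z. \<exists>n. rep (fst z) x = n \<and> snd z n)"
  proof (intro pred_intros_countable(2) pred_intros_logic(3))
    fix n
    show "Measurable.pred ?M (\<lambda>z. snd z n)" by (rule measurable_compose[OF s pred_cfg]) simp
    show "Measurable.pred ?M (\<lambda>z. rep (fst z) x = n)"
      using measurable_compose[OF f rep_measurable[of x]] by (rule pred_eq_const1) simp
  qed
  then show "Measurable.pred ?M (\<lambda>z. snd z (rep (fst z) x))" by simp
qed

lemma prob_thin:
  assumes "inv_prob \<nu>" shows "prob_space (thin q \<nu>)" "sets (thin q \<nu>) = sets cG"
proof -
  interpret A: prob_space \<nu> by (rule inv_probD(1)[OF assms])
  interpret B: prob_space "bern UNIV q :: (nat \<Rightarrow> bool) measure" by (rule prob_bern)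
  interpret pair_prob_space \<nu> "bern UNIV q :: (nat \<Rightarrow> bool) measure" ..
  show "prob_space (thin q \<nu>)" unfolding thin_def
    by (intro P.prob_space_distr thin_map_measurable inv_probD(2)[OF assms])
qed (simp add: thin_def)

text \<open>The conditional probability, given the configuration \<open>\<omega>\<close>, that \<open>F\<close> survives the thinning.\<close>

definition wt :: "real \<Rightarrow> 'a set \<Rightarrow> ('a \<Rightarrow> bool) \<Rightarrow> real" where
  "wt q F \<omega> = indicator (cylG True F) \<omega> * q ^ ncl \<omega> F"

text \<open>Splitting by the number of clusters makes the weight a finite combination of indicators
  of events, to which measurability, invariance and weak mixing of \<nu> apply.\<close>

lemma wt_eq_sum: "finite F \<Longrightarrow> wt q F \<omega> = (\<Sum>j\<le>card F. q ^ j * indicator (ncyl F j) \<omega>)"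
  using ncl_le[of F \<omega>] by (auto simp: wt_def ncyl_def indicator_def if_distrib sum.If_cases cong: if_cong)

lemma wt_bounds: "0 \<le> q \<Longrightarrow> q \<le> 1 \<Longrightarrow> 0 \<le> wt q F \<omega>" "0 \<le> q \<Longrightarrow> q \<le> 1 \<Longrightarrow> wt q F \<omega> \<le> 1"
  by (auto simp: wt_def indicator_def power_le_one)

lemma wt_measurable: "finite F \<Longrightarrow> F \<subseteq> carrier G \<Longrightarrow> wt q F \<in> borel_measurable cG"
proof -
  assume F: "finite F" "F \<subseteq> carrier G"
  have "(\<lambda>\<omega>. \<Sum>j\<le>card F. q ^ j * indicator (ncyl F j) \<omega>) \<in> borel_measurable cG"
    using ncyl_sets[OF F] by (intro borel_measurable_sum borel_measurable_times borel_measurable_const borel_measurable_indicator)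
  then show ?thesis using wt_eq_sum[OF F(1)] by presburger
qed

lemma integrable_wt:
  assumes "inv_prob \<nu>" "finite F" "F \<subseteq> carrier G" "0 \<le> q" "q \<le> 1"
  shows "integrable \<nu> (wt q F)"
proof -
  interpret prob_space \<nu> by (rule inv_probD(1)[OF assms(1)])
  show ?thesis
  proof (rule integrable_const_bound[of _ 1])
    show "wt q F \<in> borel_measurable \<nu>"
      using wt_measurable assms measurable_cong_sets[OF inv_probD(2)[OF assms(1)] refl] by blast
  qed (use wt_bounds[of q F] assms in auto)
qed

lemma thin_cyl:
  assumes \<nu>: "inv_prob \<nu>" and F: "finite F" "F \<subseteq> carrier G" and q: "0 \<le> q" "q \<le> 1"
  shows "measure (thin q \<nu>) (cylG True F) = (\<integral>\<omega>. wt q F \<omega> \<partial>\<nu>)"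
proof -
  interpret B: prob_space "bern UNIV q :: (nat \<Rightarrow> bool) measure" by (rule prob_bern)
  interpret T: prob_space "thin q \<nu>" by (rule prob_thin[OF \<nu>])
  let ?C = "cylG True F"
  let ?M = "\<nu> \<Otimes>\<^sub>M bern (UNIV :: nat set) q"
  let ?E = "thin_map -` ?C \<inter> space ?M"
  have m: "thin_map \<in> measurable ?M cG" by (rule thin_map_measurable[OF inv_probD(2)[OF \<nu>]])
  have C: "?C \<in> sets cG" using F by (rule cyl_sets)
  have "emeasure (thin q \<nu>) ?C = emeasure ?M ?E"
    unfolding thin_def using m C by (rule emeasure_distr)
  also have "\<dots> = (\<integral>\<^sup>+\<omega>. emeasure (bern UNIV q) (Pair \<omega> -` ?E) \<partial>\<nu>)"
    using measurable_sets[OF m C] by (rule B.emeasure_pair_measure_alt)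
  also have "\<dots> = (\<integral>\<^sup>+\<omega>. ennreal (wt q F \<omega>) \<partial>\<nu>)"
  proof (rule nn_integral_cong)
    fix \<omega> assume "\<omega> \<in> space \<nu>"
    then have \<omega>: "\<omega> \<in> \<Omega>" by (simp add: inv_probD[OF \<nu>])
    show "emeasure (bern UNIV q) (Pair \<omega> -` ?E) = ennreal (wt q F \<omega>)"
    proof (cases "\<forall>x\<in>F. \<omega> x")
      case True
      have "Pair \<omega> -` ?E = cyl UNIV True (rep \<omega> ` F)"
        using True F \<omega> by (auto simp: thin_map_def cyl_def space_pair_measure inv_probD[OF \<nu>] subset_iff)
      moreover have "card (rep \<omega> ` F) = ncl \<omega> F"
        unfolding ncl_def using True F
        by (intro card_image_cong_inj) (auto simp: rep_eq_iff cls_eq_iff subset_iff)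
      moreover have "wt q F \<omega> = q ^ ncl \<omega> F" using True \<omega> by (simp add: wt_def cyl_def)
      moreover have "emeasure (bern UNIV q) (cyl UNIV True (rep \<omega> ` F)) = ennreal (q ^ card (rep \<omega> ` F))"
        using F q by (simp add: B.emeasure_eq_measure bern_cyl)
      ultimately show ?thesis by simp
    next
      case False
      then have "Pair \<omega> -` ?E = {}" using F by (auto simp: thin_map_def cyl_def subset_iff)
      moreover have "wt q F \<omega> = 0" using False by (simp add: wt_def cyl_def)
      ultimately show ?thesis by simp
    qed
  qed
  also have "\<dots> = ennreal (\<integral>\<omega>. wt q F \<omega> \<partial>\<nu>)"
    using wt_bounds q by (intro nn_integral_eq_integral integrable_wt[OF \<nu> F q]) auto
  finally have "ennreal (measure (thin q \<nu>) ?C) = ennreal (\<integral>\<omega>. wt q F \<omega> \<partial>\<nu>)"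
    by (simp add: T.emeasure_eq_measure)
  then show ?thesis
    using wt_bounds q by (subst (asm) ennreal_inj) (auto intro!: Bochner_Integration.integral_nonneg)
qed

lemma integral_wt:
  assumes \<nu>: "inv_prob \<nu>" and F: "finite F" "F \<subseteq> carrier G"
  shows "(\<integral>\<omega>. wt q F \<omega> \<partial>\<nu>) = (\<Sum>j\<le>card F. q ^ j * measure \<nu> (ncyl F j))"
proof -
  interpret prob_space \<nu> by (rule inv_probD(1)[OF \<nu>])
  have "ncyl F j \<in> sets \<nu>" for j using ncyl_sets[OF F] inv_probD(2)[OF \<nu>] by simp
  then show ?thesis unfolding wt_eq_sum[OF F(1)]
    by (subst Bochner_Integration.integral_sum) (auto simp: emeasure_eq_measure)
qed

text \<open>The enumeration behind \<open>rep\<close> is not invariant, but cylinder probabilities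
  see it only through the number of clusters, which is.\<close>

lemma inv_prob_thin:
  assumes \<nu>: "inv_prob \<nu>" and q: "0 \<le> q" "q \<le> 1" shows "inv_prob (thin q \<nu>)"
proof (rule inv_prob_cylI[OF prob_thin[OF \<nu>], where b = True])
  fix g F assume *: "g \<in> carrier G" "finite F" "F \<subseteq> carrier G"
  have gF: "(\<otimes>) g ` F \<subseteq> carrier G" "finite ((\<otimes>) g ` F)" using * by auto
  have "inj_on ((\<otimes>) g) F" using * by (auto simp: inj_on_def subset_iff)
  then show "measure (thin q \<nu>) (cylG True ((\<otimes>) g ` F)) = measure (thin q \<nu>) (cylG True F)"
    using * gF q inv_probD(4)[OF \<nu> *(1) ncyl_sets[OF *(2,3)]]
    by (simp add: thin_cyl[OF \<nu>] integral_wt[OF \<nu>] card_image tset_ncyl)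
qed

text \<open>Without a cluster meeting both sets the weights factor exactly; otherwise the error is
  at most 1 and is charged to a connected pair.\<close>

lemma wt_Un_approx:
  assumes F: "finite F" "F \<subseteq> carrier G" "finite F'" "F' \<subseteq> carrier G" and q: "0 \<le> q" "q \<le> 1"
    and \<omega>: "\<omega> \<in> \<Omega>"
  shows "\<bar>wt q (F \<union> F') \<omega> - wt q F \<omega> * wt q F' \<omega>\<bar> \<le> (\<Sum>x\<in>F. \<Sum>y\<in>F'. indicator (together x y) \<omega>)"
proof (cases "\<exists>x\<in>F. \<exists>y\<in>F'. conn \<omega> x y")
  case True
  then obtain x y where xy: "x \<in> F" "y \<in> F'" "conn \<omega> x y" by auto
  have "\<bar>wt q (F \<union> F') \<omega> - wt q F \<omega> * wt q F' \<omega>\<bar> \<le> 1"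
    using wt_bounds[OF q, of "F \<union> F'" \<omega>] wt_bounds[OF q, of F \<omega>] wt_bounds[OF q, of F' \<omega>]
      mult_le_one[of "wt q F \<omega>" "wt q F' \<omega>"] mult_nonneg_nonneg[of "wt q F \<omega>" "wt q F' \<omega>"] by linarith
  also have "1 = (indicator (together x y) \<omega> :: real)" using xy \<omega> by simp
  also have "\<dots> \<le> (\<Sum>y\<in>F'. indicator (together x y) \<omega>)"
    using xy F by (intro member_le_sum) auto
  also have "\<dots> \<le> (\<Sum>x\<in>F. \<Sum>y\<in>F'. indicator (together x y) \<omega>)"
    using xy F by (intro member_le_sum[where f = "\<lambda>x. \<Sum>y\<in>F'. indicator (together x y) \<omega>"]) (auto intro: sum_nonneg)
  finally show ?thesis .
next
  case False
  have "wt q (F \<union> F') \<omega> = wt q F \<omega> * wt q F' \<omega>"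
  proof (cases "\<forall>x\<in>F \<union> F'. \<omega> x")
    case True
    then show ?thesis using False F \<omega> by (simp add: wt_def cyl_def ncl_Un power_add)
  qed (auto simp: wt_def cyl_def indicator_def)
  then show ?thesis by (simp add: sum_nonneg)
qed

text \<open>Two sources of dependence are bounded separately: coins shared by clusters that join
  \<open>F\<close> to \<open>g F'\<close> (the sum \<open>A\<close>, null by \<open>sep\<close>),
  and correlations of \<nu> between cluster-count events (the sum \<open>B\<close>, null by weak
  mixing). The assumption \<open>sep\<close> is thus the only way in which thinning could destroy
  weak mixing.\<close>

lemma wmix_thin:
  assumes \<nu>: "inv_prob \<nu>" "wmix \<nu>" and q: "0 \<le> q" "q \<le> 1"
    and sep: "\<And>x y. x \<in> carrier G \<Longrightarrow> y \<in> carrier G \<Longrightarrow> null (\<lambda>g. measure \<nu> (together x (g \<otimes> y)))"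
  shows "wmix (thin q \<nu>)"
proof (rule wmix_cylI[OF inv_prob_thin[OF \<nu>(1) q], where b = True])
  fix F F' assume F: "finite F" "F \<subseteq> carrier G" "finite F'" "F' \<subseteq> carrier G"
  interpret prob_space \<nu> by (rule inv_probD(1)[OF \<nu>(1)])
  note [simp] = inv_probD(2,3)[OF \<nu>(1)]
  let ?u = "\<lambda>F. measure (thin q \<nu>) (cylG True F)"
  define A where "A = (\<lambda>g. \<Sum>x\<in>F. \<Sum>y\<in>F'. measure \<nu> (together x (g \<otimes> y)))"
  define B where "B = (\<lambda>g. \<Sum>i\<le>card F. \<Sum>j\<le>card F'.
    \<bar>measure \<nu> (ncyl F i \<inter> tset g (ncyl F' j)) - measure \<nu> (ncyl F i) * measure \<nu> (ncyl F' j)\<bar>)"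
  have "null A" unfolding A_def using F by (intro null_sum sep) auto
  moreover have "null B" unfolding B_def using F by (intro null_sum wmixD[OF \<nu>(2)] ncyl_sets) auto
  ultimately have "null (\<lambda>g. A g + B g)" by (rule null_add)
  then show "null (\<lambda>g. \<bar>?u (F \<union> (\<otimes>) g ` F') - ?u F * ?u F'\<bar>)"
  proof (rule null_mono)
    fix g assume g: "g \<in> carrier G"
    let ?F = "(\<otimes>) g ` F'"
    have gF: "?F \<subseteq> carrier G" "finite ?F" using F g by auto
    have inj: "inj_on ((\<otimes>) g) F'" using g F by (auto simp: inj_on_def subset_iff)
    have E: "ncyl F i \<in> sets \<nu>" "ncyl ?F j \<in> sets \<nu>" for i j using F gF by (auto intro: ncyl_sets)
    have EO: "ncyl F i \<inter> ncyl ?F j \<inter> \<Omega> = ncyl F i \<inter> ncyl ?F j" for i j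
      by (auto simp: ncyl_def cyl_def)
    have EI: "integrable \<nu> (indicator (ncyl F i \<inter> ncyl ?F j) :: _ \<Rightarrow> real)" for i j
      using E(1)[of i] E(2)[of j] by (intro integrable_real_indicator) (auto simp: emeasure_eq_measure)
    have prod: "wt q F \<omega> * wt q ?F \<omega> =
        (\<Sum>i\<le>card F. \<Sum>j\<le>card F'. q ^ i * q ^ j * indicator (ncyl F i \<inter> ncyl ?F j) \<omega>)" for \<omega>
      using F gF inj
      by (simp add: wt_eq_sum card_image sum_product indicator_inter_arith mult_ac
          del: sum_mult_indicator sum_indicator_mult)
    have int2: "integrable \<nu> (\<lambda>\<omega>. wt q F \<omega> * wt q ?F \<omega>)"
      unfolding prod by (intro Bochner_Integration.integrable_sum integrable_mult_right EI)
    have "\<bar>?u (F \<union> ?F) - (\<integral>\<omega>. wt q F \<omega> * wt q ?F \<omega> \<partial>\<nu>)\<bar> \<le> A g"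
    proof -
      have int1: "integrable \<nu> (wt q (F \<union> ?F))" using F gF q by (intro integrable_wt[OF \<nu>(1)]) auto
      have "?u (F \<union> ?F) - (\<integral>\<omega>. wt q F \<omega> * wt q ?F \<omega> \<partial>\<nu>) = (\<integral>\<omega>. wt q (F \<union> ?F) \<omega> - wt q F \<omega> * wt q ?F \<omega> \<partial>\<nu>)"
        using F gF q int1 int2 by (simp add: thin_cyl[OF \<nu>(1)])
      also have "\<bar>\<dots>\<bar> \<le> (\<integral>\<omega>. \<bar>wt q (F \<union> ?F) \<omega> - wt q F \<omega> * wt q ?F \<omega>\<bar> \<partial>\<nu>)"
        by (rule integral_abs_bound)
      also have "\<dots> \<le> (\<integral>\<omega>. (\<Sum>x\<in>F. \<Sum>y\<in>?F. indicator (together x y) \<omega>) \<partial>\<nu>)"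
        using F gF q int1 int2 conn_sets
        by (intro integral_mono integrable_abs Bochner_Integration.integrable_diff
             Bochner_Integration.integrable_sum wt_Un_approx) (auto simp: emeasure_eq_measure)
      also have "\<dots> = (\<Sum>x\<in>F. \<Sum>y\<in>?F. measure \<nu> (together x y))"
        using conn_sets by (subst Bochner_Integration.integral_sum
           | intro Bochner_Integration.integrable_sum sum.cong refl
           | simp add: emeasure_eq_measure Int_absorb2)+
      also have "\<dots> = A g" unfolding A_def using inj by (simp add: sum.reindex)
      finally show ?thesis .
    qed
    moreover have "\<bar>(\<integral>\<omega>. wt q F \<omega> * wt q ?F \<omega> \<partial>\<nu>) - ?u F * ?u F'\<bar> \<le> B g"
    proof -
      have "(\<integral>\<omega>. wt q F \<omega> * wt q ?F \<omega> \<partial>\<nu>) =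
          (\<Sum>i\<le>card F. \<Sum>j\<le>card F'. q ^ i * q ^ j * measure \<nu> (ncyl F i \<inter> ncyl ?F j))"
        unfolding prod
        by (simp add: EI EO Bochner_Integration.integral_sum Bochner_Integration.integrable_sum
            del: sum_mult_indicator sum_indicator_mult)
      moreover have "?u F * ?u F' =
          (\<Sum>i\<le>card F. \<Sum>j\<le>card F'. q ^ i * q ^ j * (measure \<nu> (ncyl F i) * measure \<nu> (ncyl F' j)))"
        using F q by (simp only: thin_cyl[OF \<nu>(1)] integral_wt[OF \<nu>(1)] sum_product) (simp add: mult_ac)
      ultimately have eq: "(\<integral>\<omega>. wt q F \<omega> * wt q ?F \<omega> \<partial>\<nu>) - ?u F * ?u F' =
         (\<Sum>i\<le>card F. \<Sum>j\<le>card F'. q ^ i * q ^ j *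
           (measure \<nu> (ncyl F i \<inter> ncyl ?F j) - measure \<nu> (ncyl F i) * measure \<nu> (ncyl F' j)))"
        by (simp add: sum_subtractf algebra_simps)
      have "\<bar>(\<integral>\<omega>. wt q F \<omega> * wt q ?F \<omega> \<partial>\<nu>) - ?u F * ?u F'\<bar> \<le> (\<Sum>i\<le>card F. \<Sum>j\<le>card F'. \<bar>q ^ i * q ^ j *
           (measure \<nu> (ncyl F i \<inter> ncyl ?F j) - measure \<nu> (ncyl F i) * measure \<nu> (ncyl F' j))\<bar>)"
        unfolding eq by (intro order_trans[OF sum_abs] sum_mono sum_abs)
      also have "\<dots> \<le> B g" unfolding B_def
      proof (intro sum_mono)
        fix i j
        have "q ^ i * q ^ j \<le> 1" using q by (intro mult_le_one power_le_one) auto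
        then show "\<bar>q ^ i * q ^ j * (measure \<nu> (ncyl F i \<inter> ncyl ?F j) - measure \<nu> (ncyl F i) * measure \<nu> (ncyl F' j))\<bar>
          \<le> \<bar>measure \<nu> (ncyl F i \<inter> tset g (ncyl F' j)) - measure \<nu> (ncyl F i) * measure \<nu> (ncyl F' j)\<bar>"
          using g F q by (simp add: tset_ncyl abs_mult mult_left_le_one_le)
      qed
      finally show ?thesis .
    qed
    ultimately show "\<bar>?u (F \<union> ?F) - ?u F * ?u F'\<bar> \<le> A g + B g" by linarith
  qed
qed

section \<open>The iteration and its limit\<close>


definition dens :: "('a \<Rightarrow> bool) measure \<Rightarrow> 'a \<Rightarrow> real" where
  "dens \<mu> x = measure \<mu> (cylG True {x})"

text \<open>Only one direction of disagreement: under an invariant law both vertices have the same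
  density, so the other direction is equally likely.\<close>

definition disag :: "('a \<Rightarrow> bool) measure \<Rightarrow> 'a \<Rightarrow> 'a \<Rightarrow> real" where
  "disag \<mu> x y = measure \<mu> {\<omega>\<in>\<Omega>. \<omega> x \<and> \<not> \<omega> y}"

lemma disag_sets: "x \<in> carrier G \<Longrightarrow> y \<in> carrier G \<Longrightarrow> {\<omega>\<in>\<Omega>. \<omega> x \<and> \<not> \<omega> y} \<in> sets cG"
  using pred_sets[OF pred_intros_logic(3)[OF pred_cfg pred_intros_logic(2)[OF pred_cfg]], of x "carrier G" y] by simp

text \<open>The form with open cylinders suits thinning, the form with closed cylinders suits
  unions.\<close>

lemma disag_eq:
  assumes \<mu>: "inv_prob \<mu>" and xy: "x \<in> carrier G" "y \<in> carrier G"
  shows "disag \<mu> x y = dens \<mu> x - measure \<mu> (cylG True {x, y})"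
    and "disag \<mu> x y = measure \<mu> (cylG False {y}) - measure \<mu> (cylG False {x, y})"
proof -
  interpret prob_space \<mu> by (rule inv_probD(1)[OF \<mu>])
  have s: "cylG b F \<in> events" if "finite F" "F \<subseteq> carrier G" for b F
    using that inv_probD(2)[OF \<mu>] by (simp add: cyl_sets)
  have "{\<omega>\<in>\<Omega>. \<omega> x \<and> \<not> \<omega> y} = cylG True {x} - cylG True {x, y}"
    by (auto simp: cyl_def)
  also have "measure \<mu> \<dots> = dens \<mu> x - measure \<mu> (cylG True {x, y})"
    unfolding dens_def using xy by (intro finite_measure_Diff s) (auto simp: cyl_def)
  finally show "disag \<mu> x y = dens \<mu> x - measure \<mu> (cylG True {x, y})" by (simp add: disag_def)
  have "{\<omega>\<in>\<Omega>. \<omega> x \<and> \<not> \<omega> y} = cylG False {y} - cylG False {x, y}"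
    by (auto simp: cyl_def)
  also have "measure \<mu> \<dots> = measure \<mu> (cylG False {y}) - measure \<mu> (cylG False {x, y})"
    using xy by (intro finite_measure_Diff s) (auto simp: cyl_def)
  finally show "disag \<mu> x y = measure \<mu> (cylG False {y}) - measure \<mu> (cylG False {x, y})"
    by (simp add: disag_def)
qed

lemma cyl_False_dens:
  assumes \<mu>: "inv_prob \<mu>" and x: "x \<in> carrier G"
  shows "measure \<mu> (cylG False {x}) = 1 - dens \<mu> x"
proof -
  interpret prob_space \<mu> by (rule inv_probD(1)[OF \<mu>])
  have "cylG False {x} = space \<mu> - cylG True {x}"
    by (auto simp: cyl_def inv_probD[OF \<mu>])
  then show ?thesis unfolding dens_def
    using x prob_compl[of "cylG True {x}"] inv_probD(2)[OF \<mu>] by (simp add: cyl_sets)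
qed

lemma disag_triangle:
  assumes \<mu>: "inv_prob \<mu>" and xyz: "x \<in> carrier G" "y \<in> carrier G" "z \<in> carrier G"
  shows "disag \<mu> x z \<le> disag \<mu> x y + disag \<mu> y z"
proof -
  interpret prob_space \<mu> by (rule inv_probD(1)[OF \<mu>])
  note s = disag_sets inv_probD(2)[OF \<mu>]
  have "disag \<mu> x z \<le> measure \<mu> ({\<omega>\<in>\<Omega>. \<omega> x \<and> \<not> \<omega> y} \<union> {\<omega>\<in>\<Omega>. \<omega> y \<and> \<not> \<omega> z})"
    unfolding disag_def using xyz by (intro finite_measure_mono) (auto simp: s)
  also have "\<dots> \<le> disag \<mu> x y + disag \<mu> y z"
    unfolding disag_def using xyz by (intro measure_Un_le) (auto simp: s)
  finally show ?thesis .
qed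

lemma dens_uni:
  assumes \<mu>: "inv_prob \<mu>" and x: "x \<in> carrier G"
  shows "dens (uni \<mu>) x = dens \<mu> x * (2 - dens \<mu> x)"
proof -
  have "1 - dens (uni \<mu>) x = (1 - dens \<mu> x)\<^sup>2"
    using uni_cyl[OF \<mu>, of "{x}"] x cyl_False_dens[OF \<mu> x] cyl_False_dens[OF inv_prob_uni[OF \<mu>] x] by simp
  then show ?thesis by (simp add: power2_eq_square algebra_simps)
qed

text \<open>Both closed-cylinder probabilities are squared, and \<open>a\<^sup>2 - b\<^sup>2\<close>
  factors as \<open>(a - b) * (2 * a - (a - b))\<close> with \<open>a\<close> the probability of
  being closed.\<close>

lemma disag_uni:
  assumes \<mu>: "inv_prob \<mu>" and xy: "x \<in> carrier G" "y \<in> carrier G"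
  shows "disag (uni \<mu>) x y = disag \<mu> x y * (2 - 2 * dens \<mu> y - disag \<mu> x y)"
proof -
  define a where "a = measure \<mu> (cylG False {y})"
  define b where "b = measure \<mu> (cylG False {x, y})"
  have 1: "disag (uni \<mu>) x y = a\<^sup>2 - b\<^sup>2"
    using disag_eq(2)[OF inv_prob_uni[OF \<mu>] xy] uni_cyl[OF \<mu>, of "{y}"] uni_cyl[OF \<mu>, of "{x, y}"] xy
    by (simp add: a_def b_def)
  have 2: "disag \<mu> x y = a - b" using disag_eq(2)[OF \<mu> xy] by (simp add: a_def b_def)
  have "a = 1 - dens \<mu> y" using cyl_False_dens[OF \<mu> xy(2)] by (simp add: a_def)
  then have 3: "2 - 2 * dens \<mu> y = 2 * a" by simp
  show ?thesis unfolding 1 2 3 by (simp add: power2_eq_square algebra_simps)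
qed

lemma thin_cyl_connected:
  assumes \<nu>: "inv_prob \<nu>" and F: "finite F" "F \<subseteq> carrier G" and q: "0 \<le> q" "q \<le> 1"
    and 1: "\<And>\<omega>. \<omega> \<in> cylG True F \<Longrightarrow> ncl \<omega> F = 1"
  shows "measure (thin q \<nu>) (cylG True F) = q * measure \<nu> (cylG True F)"
proof -
  interpret prob_space \<nu> by (rule inv_probD(1)[OF \<nu>])
  have "wt q F \<omega> = q * indicator (cylG True F) \<omega>" for \<omega>
    using 1[of \<omega>] by (auto simp: wt_def indicator_def)
  moreover have "cylG True F \<in> events" using F inv_probD(2)[OF \<nu>] by (simp add: cyl_sets)
  ultimately show ?thesis by (simp add: thin_cyl[OF \<nu> F q] emeasure_eq_measure)
qed

lemma dens_thin:
  assumes \<nu>: "inv_prob \<nu>" and x: "x \<in> carrier G" and q: "0 \<le> q" "q \<le> 1"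
  shows "dens (thin q \<nu>) x = q * dens \<nu> x"
  unfolding dens_def using x by (intro thin_cyl_connected[OF \<nu> _ _ q]) (auto simp: ncl_def)

text \<open>Adjacency is essential: if both ends are open they share a cluster and hence a coin, so
  thinning creates no new disagreement.\<close>

lemma disag_thin:
  assumes \<nu>: "inv_prob \<nu>" and xy: "cayley_adj G S x y" and q: "0 \<le> q" "q \<le> 1"
  shows "disag (thin q \<nu>) x y = q * disag \<nu> x y"
proof -
  have c: "x \<in> carrier G" "y \<in> carrier G" using cayley_adj_carrier[OF xy] by auto
  have "ncl \<omega> {x, y} = 1" if "\<omega> \<in> cylG True {x, y}" for \<omega>
  proof -
    have "\<omega> x" "\<omega> y" using that by (auto simp: cyl_def)
    then have "cls \<omega> {x, y} x = cls \<omega> {x, y} y"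
      using c conn_adj[OF xy] by (subst cls_eq_iff) auto
    then show ?thesis by (simp add: ncl_def)
  qed
  then have "measure (thin q \<nu>) (cylG True {x, y}) = q * measure \<nu> (cylG True {x, y})"
    using c by (intro thin_cyl_connected[OF \<nu> _ _ q]) auto
  then show ?thesis
    using c by (simp add: disag_eq(1)[OF inv_prob_thin[OF \<nu> q]] disag_eq(1)[OF \<nu>] dens_thin[OF \<nu> _ q] algebra_simps)
qed

primrec perc :: "real \<Rightarrow> nat \<Rightarrow> ('a \<Rightarrow> bool) measure" where
  "perc p 0 = bern (carrier G) p"
| "perc p (Suc n) = thin (1 / (2 - p)) (uni (perc p n))"

lemma inv_prob_perc: assumes "0 < p" "p < 1" shows "inv_prob (perc p n)"
  using assms by (induction n) (auto intro!: inv_prob_bern inv_prob_thin inv_prob_uni)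

lemma dens_perc:
  assumes p: "0 < p" "p < 1" and x: "x \<in> carrier G"
  shows "dens (perc p n) x = p"
proof (induction n)
  case 0
  then show ?case using bern_cyl[of "{x}" "carrier G" p] p x by (simp add: dens_def)
next
  case (Suc n)
  have "dens (perc p (Suc n)) x = 1 / (2 - p) * (p * (2 - p))"
    using p x Suc inv_prob_perc[OF p, of n] by (simp add: dens_thin inv_prob_uni dens_uni)
  then show ?case using p by simp
qed

lemma disag_nonneg: "0 \<le> disag \<mu> x y"
  by (simp add: disag_def)

text \<open>Each round multiplies the disagreement by at most 2 - 2p (union) times 1/(2 - p)
  (thinning); the ratio is below 1 because p > 0.\<close>

lemma disag_perc_adj:
  assumes p: "0 < p" "p < 1" and xy: "cayley_adj G S x y"
  shows "disag (perc p n) x y \<le> ((2 - 2 * p) / (2 - p)) ^ n"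
proof (induction n)
  case 0
  interpret prob_space "bern (carrier G) p" by (rule prob_bern)
  show ?case by (simp add: disag_def)
next
  case (Suc n)
  have c: "x \<in> carrier G" "y \<in> carrier G" using cayley_adj_carrier[OF xy] by auto
  let ?d = "disag (perc p n) x y"
  have "disag (perc p (Suc n)) x y = 1 / (2 - p) * (?d * (2 - 2 * p - ?d))"
    using p xy c inv_prob_perc[OF p, of n] by (simp add: disag_thin inv_prob_uni disag_uni dens_perc)
  also have "\<dots> \<le> 1 / (2 - p) * (?d * (2 - 2 * p))"
    using p disag_nonneg[of "perc p n" x y] by (intro mult_left_mono) auto
  also have "\<dots> = (2 - 2 * p) / (2 - p) * ?d" by simp
  also have "\<dots> \<le> (2 - 2 * p) / (2 - p) * ((2 - 2 * p) / (2 - p)) ^ n"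
    using p Suc by (intro mult_left_mono) auto
  finally show ?case by simp
qed

text \<open>The contraction is available across edges only; the triangle inequality carries the
  limit along words in the generators.\<close>

lemma disag_perc_tendsto:
  assumes p: "0 < p" "p < 1" and x: "x \<in> carrier G" and y: "y \<in> carrier G"
  shows "(\<lambda>n. disag (perc p n) x y) \<longlonglongrightarrow> 0"
proof -
  have adj: "(\<lambda>n. disag (perc p n) x y) \<longlonglongrightarrow> 0" if "cayley_adj G S x y" for x y
  proof (rule tendsto_sandwich[OF _ _ tendsto_const])
    show "\<forall>\<^sub>F n in sequentially. 0 \<le> disag (perc p n) x y" by (simp add: disag_nonneg)
    show "\<forall>\<^sub>F n in sequentially. disag (perc p n) x y \<le> ((2 - 2 * p) / (2 - p)) ^ n"
      using disag_perc_adj[OF p that] by simp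
    show "(\<lambda>n. ((2 - 2 * p) / (2 - p)) ^ n) \<longlonglongrightarrow> 0"
      using p by (intro LIMSEQ_realpow_zero) auto
  qed
  \<comment> \<open>\<open>S\<close> may contain the identity, which gives no edge of the Cayley
    graph.\<close>
  have step: "(\<lambda>n. disag (perc p n) x (x \<otimes> s)) \<longlonglongrightarrow> 0" if "s \<in> S" "x \<in> carrier G" for s x
  proof (cases "s = \<one>")
    case True
    then show ?thesis using that by (simp add: disag_def)
  next
    case False
    have s: "s \<in> carrier G" using that S_sub by auto
    have "x \<otimes> s \<noteq> x" using False s that by simp
    then have "cayley_adj G S x (x \<otimes> s)"
      using s that by (auto simp: cayley_adj_def m_assoc[symmetric])
    then show ?thesis by (rule adj)
  qed
  have gen: "\<forall>x\<in>carrier G. (\<lambda>n. disag (perc p n) x (x \<otimes> h)) \<longlonglongrightarrow> 0" if "h \<in> generate G S" for h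
    using that
  proof (induction rule: generate.induct)
    case one
    then show ?case by (simp add: disag_def)
  next
    case (eng h1 h2)
    then have h: "h1 \<in> carrier G" "h2 \<in> carrier G" using S_gen by auto
    show ?case
    proof
      fix x assume x: "x \<in> carrier G"
      have "(\<lambda>n. disag (perc p n) x (x \<otimes> h1) + disag (perc p n) (x \<otimes> h1) (x \<otimes> h1 \<otimes> h2)) \<longlonglongrightarrow> 0 + 0"
        using eng h x by (intro tendsto_add) auto
      then have lim: "(\<lambda>n. disag (perc p n) x (x \<otimes> h1) + disag (perc p n) (x \<otimes> h1) (x \<otimes> h1 \<otimes> h2)) \<longlonglongrightarrow> 0" by simp
      show "(\<lambda>n. disag (perc p n) x (x \<otimes> (h1 \<otimes> h2))) \<longlonglongrightarrow> 0"
        using x h disag_triangle[OF inv_prob_perc[OF p], of x "x \<otimes> h1" "x \<otimes> h1 \<otimes> h2"]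
        by (intro tendsto_sandwich[OF _ _ tendsto_const lim]) (auto simp: disag_nonneg m_assoc)
    qed
  qed (auto intro: step S_inv)
  have "inv x \<otimes> y \<in> generate G S" using x y S_gen by simp
  from gen[OF this] x have "(\<lambda>n. disag (perc p n) x (x \<otimes> (inv x \<otimes> y))) \<longlonglongrightarrow> 0" by blast
  then show ?thesis using x y by (simp add: m_assoc[symmetric])
qed

section \<open>The non-ergodic limit of the iteration\<close>

definition const_cfg :: "bool \<Rightarrow> 'a \<Rightarrow> bool" where
  "const_cfg b = (\<lambda>x\<in>carrier G. b)"

definition two_point :: "real \<Rightarrow> ('a \<Rightarrow> bool) measure" where
  "two_point p = distr (measure_pmf (bernoulli_pmf p)) cG const_cfg"

lemma const_cfg_in [simp]: "const_cfg b \<in> \<Omega>"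
  by (simp add: const_cfg_def)

lemma const_cfg_measurable: "const_cfg \<in> measurable (measure_pmf (bernoulli_pmf p)) cG"
  by (auto simp: measurable_def)

lemma tr_const_cfg: "g \<in> carrier G \<Longrightarrow> tr g (const_cfg b) = const_cfg b"
  by (auto simp: tr_def const_cfg_def intro!: restrict_ext)

lemma measure_two_point:
  assumes "A \<in> sets cG"
  shows "measure (two_point p) A = measure (measure_pmf (bernoulli_pmf p)) {b. const_cfg b \<in> A}"
  unfolding two_point_def using assms by (simp add: measure_distr[OF const_cfg_measurable] vimage_def)

lemma inv_prob_two_point: "inv_prob (two_point p)"
  unfolding inv_prob_def
proof (intro conjI ballI)
  show "prob_space (two_point p)"
    unfolding two_point_def by (rule prob_space.prob_space_distr[OF measure_pmf.prob_space_axioms const_cfg_measurable])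
  show "sets (two_point p) = sets cG" by (simp add: two_point_def)
  fix g A assume "g \<in> carrier G" "A \<in> sets cG"
  then show "measure (two_point p) (tset g A) = measure (two_point p) A"
    by (simp add: measure_two_point tset_sets) (simp add: tset_def tr_const_cfg)
qed

text \<open>The full configuration alone forms an invariant event of probability \<open>p\<close>,
  which is neither 0 nor 1.\<close>

lemma two_point_not_ergodic:
  assumes p: "0 < p" "p < 1"
  shows "two_point p \<notin> ergodic_measures G (carrier G) (\<lambda>g a. g \<otimes> a)"
proof
  assume erg: "two_point p \<in> ergodic_measures G (carrier G) (\<lambda>g a. g \<otimes> a)"
  have A: "{const_cfg True} = {\<omega>\<in>space cG. \<forall>x\<in>carrier G. \<omega> x}"
    by (auto simp: const_cfg_def intro: extensionalityI[where A = "carrier G"])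
  have As: "{const_cfg True} \<in> sets cG"
    unfolding A by (intro pred_sets pred_Ball_countable countable_carrier pred_cfg)
  have "translate G (carrier G) (\<lambda>g a. g \<otimes> a) g -` {const_cfg True} \<inter> space (two_point p) = {const_cfg True}"
    if g: "g \<in> carrier G" for g
  proof -
    have "tr (inv g) \<omega> = const_cfg True \<longleftrightarrow> \<omega> = const_cfg True" if \<omega>: "\<omega> \<in> \<Omega>" for \<omega>
    proof
      assume "tr (inv g) \<omega> = const_cfg True"
      then have "tr g (tr (inv g) \<omega>) = const_cfg True" using g tr_const_cfg by simp
      then show "\<omega> = const_cfg True" using g \<omega> by (simp add: tr_tr tr_one)
    qed (use g tr_const_cfg in auto)
    then show ?thesis unfolding translate_eq_tr[OF g] inv_probD(3)[OF inv_prob_two_point] by auto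
  qed
  moreover have "{const_cfg True} \<in> sets (two_point p)" using As by (simp add: two_point_def)
  ultimately have "measure (two_point p) {const_cfg True} = 0 \<or> measure (two_point p) {const_cfg True} = 1"
    using erg unfolding ergodic_measures_def by simp
  moreover have "measure (two_point p) {const_cfg True} = p"
  proof -
    have "const_cfg False \<noteq> const_cfg True" using one_closed by (auto simp: const_cfg_def fun_eq_iff restrict_def)
    then have "const_cfg b = const_cfg True \<longleftrightarrow> b" for b by (cases b) auto
    then have "{b. const_cfg b \<in> {const_cfg True}} = {True}" by auto
    then show ?thesis using p by (simp add: measure_two_point[OF As] measure_pmf_single)
  qed
  ultimately show False using p by simp
qed

text \<open>If the identity is open but \<open>F\<close> is not entirely open, some \<open>y\<close>
  in \<open>F\<close> disagrees with the identity; a union bound over \<open>F\<close> squeezes the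
  probability. The closed case is symmetric.\<close>

lemma perc_cyl_tendsto:
  assumes p: "0 < p" "p < 1" and F: "finite F" "F \<subseteq> carrier G" "\<one> \<in> F"
  shows "(\<lambda>n. measure (perc p n) (cylG True F)) \<longlonglongrightarrow> p"
    and "(\<lambda>n. measure (perc p n) (cylG False F)) \<longlonglongrightarrow> 1 - p"
proof -
  have 1: "p - (\<Sum>y\<in>F. disag (perc p n) \<one> y) \<le> measure (perc p n) (cylG True F)
     \<and> measure (perc p n) (cylG True F) \<le> p" (is "?A n")
    and 2: "1 - p - (\<Sum>y\<in>F. disag (perc p n) y \<one>) \<le> measure (perc p n) (cylG False F)
     \<and> measure (perc p n) (cylG False F) \<le> 1 - p" (is "?B n") for n
  proof -
    note \<mu> = inv_prob_perc[OF p, of n]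
    interpret prob_space "perc p n" by (rule inv_probD(1)[OF \<mu>])
    have s: "cylG b F' \<in> events" if "finite F'" "F' \<subseteq> carrier G" for b F'
      using that inv_probD(2)[OF \<mu>] by (simp add: cyl_sets)
    have d: "{\<omega>\<in>\<Omega>. \<omega> x \<and> \<not> \<omega> y} \<in> events" if "x \<in> carrier G" "y \<in> carrier G" for x y
      using that inv_probD(2)[OF \<mu>] by (simp add: disag_sets)
    have p1: "prob (cylG True {\<one>}) = p" using dens_perc[OF p one_closed] by (simp add: dens_def)
    have p2: "prob (cylG False {\<one>}) = 1 - p"
      using cyl_False_dens[OF \<mu> one_closed] dens_perc[OF p one_closed] by simp
    have fF: "F \<subseteq> carrier G" "finite F" using F by auto
    have "prob (cylG True {\<one>}) \<le>
        prob (cylG True F \<union> (\<Union>y\<in>F. {\<omega>\<in>\<Omega>. \<omega> \<one> \<and> \<not> \<omega> y}))"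
      using F by (intro finite_measure_mono sets.Un sets.finite_UN d s) (auto simp: cyl_def)
    also have "\<dots> \<le> prob (cylG True F) + prob (\<Union>y\<in>F. {\<omega>\<in>\<Omega>. \<omega> \<one> \<and> \<not> \<omega> y})"
      using F by (intro measure_Un_le sets.finite_UN d s) auto
    also have "prob (\<Union>y\<in>F. {\<omega>\<in>\<Omega>. \<omega> \<one> \<and> \<not> \<omega> y}) \<le> (\<Sum>y\<in>F. disag (perc p n) \<one> y)"
      unfolding disag_def using F d by (intro finite_measure_subadditive_finite) auto
    finally have l1: "p - (\<Sum>y\<in>F. disag (perc p n) \<one> y) \<le> prob (cylG True F)" using p1 by simp
    have "prob (cylG True F) \<le> prob (cylG True {\<one>})"
      using F by (intro finite_measure_mono s) (auto simp: cyl_def)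
    with l1 p1 show "?A n" by simp
    have "prob (cylG False {\<one>}) \<le>
        prob (cylG False F \<union> (\<Union>y\<in>F. {\<omega>\<in>\<Omega>. \<omega> y \<and> \<not> \<omega> \<one>}))"
      using F by (intro finite_measure_mono sets.Un sets.finite_UN d s) (auto simp: cyl_def)
    also have "\<dots> \<le> prob (cylG False F) + prob (\<Union>y\<in>F. {\<omega>\<in>\<Omega>. \<omega> y \<and> \<not> \<omega> \<one>})"
      using F by (intro measure_Un_le sets.finite_UN d s) auto
    also have "prob (\<Union>y\<in>F. {\<omega>\<in>\<Omega>. \<omega> y \<and> \<not> \<omega> \<one>}) \<le> (\<Sum>y\<in>F. disag (perc p n) y \<one>)"
      unfolding disag_def using F d by (intro finite_measure_subadditive_finite) auto
    finally have l2: "1 - p - (\<Sum>y\<in>F. disag (perc p n) y \<one>) \<le> prob (cylG False F)" using p2 by simp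
    have "prob (cylG False F) \<le> prob (cylG False {\<one>})"
      using F by (intro finite_measure_mono s) (auto simp: cyl_def)
    with l2 p2 show "?B n" by simp
  qed
  have "(\<lambda>n. p - (\<Sum>y\<in>F. disag (perc p n) \<one> y)) \<longlonglongrightarrow> p - (\<Sum>y\<in>F. 0)"
    using F by (intro tendsto_diff tendsto_sum tendsto_const disag_perc_tendsto[OF p]) auto
  then have L1: "(\<lambda>n. p - (\<Sum>y\<in>F. disag (perc p n) \<one> y)) \<longlonglongrightarrow> p" by simp
  show "(\<lambda>n. measure (perc p n) (cylG True F)) \<longlonglongrightarrow> p"
    by (rule tendsto_sandwich[OF _ _ L1 tendsto_const]) (use 1 in simp_all)
  have "(\<lambda>n. 1 - p - (\<Sum>y\<in>F. disag (perc p n) y \<one>)) \<longlonglongrightarrow> 1 - p - (\<Sum>y\<in>F. 0)"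
    using F by (intro tendsto_diff tendsto_sum tendsto_const disag_perc_tendsto[OF p]) auto
  then have L2: "(\<lambda>n. 1 - p - (\<Sum>y\<in>F. disag (perc p n) y \<one>)) \<longlonglongrightarrow> 1 - p" by simp
  show "(\<lambda>n. measure (perc p n) (cylG False F)) \<longlonglongrightarrow> 1 - p"
    by (rule tendsto_sandwich[OF _ _ L2 tendsto_const]) (use 2 in simp_all)
qed

lemma continuous_config_measurable:
  assumes "continuous_map topG euclideanreal f"
  shows "f \<in> borel_measurable cG"
proof (rule borel_measurableI_greater)
  fix y
  have "openin topG {x \<in> topspace topG. f x \<in> {y<..}}"
    by (rule openin_continuous_map_preimage[OF assms]) simp
  then have "{x \<in> \<Omega>. y < f x} \<in> {U. openin topG U}" by simp
  then have "{x \<in> \<Omega>. y < f x} \<in> sets (borel_algebra topG)"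
    unfolding borel_algebra_def
    by (subst sets_measure_of) (auto intro: sigma_sets.Basic dest: openin_subset simp del: topspace_config)
  then show "{x \<in> space cG. y < f x} \<in> sets cG"
    by (simp add: sets_borel_config[OF countable_carrier])
qed

lemma continuous_config_bounded:
  assumes "continuous_map topG euclideanreal f"
  obtains B where "B \<ge> 0" "\<And>\<omega>. \<omega> \<in> \<Omega> \<Longrightarrow> \<bar>f \<omega>\<bar> \<le> B"
proof -
  have "compact_space topG"
    unfolding config_topology_def by (simp add: compact_space_product_topology compact_space_discrete_topology)
  then have "compactin euclideanreal (f ` \<Omega>)"
    using image_compactin[OF _ assms, of "topspace topG"] by (simp add: compact_space_def)
  then have "bounded (f ` \<Omega>)" by (simp add: compact_imp_bounded)
  then obtain B where B: "\<And>\<omega>. \<omega> \<in> \<Omega> \<Longrightarrow> \<bar>f \<omega>\<bar> \<le> B" unfolding bounded_iff by auto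
  moreover have "B \<ge> 0" using B[OF const_cfg_in[of True]] by linarith
  ultimately show ?thesis using that by blast
qed

lemma continuous_config_cyl:
  assumes "continuous_map topG euclideanreal f" "e > 0"
  obtains F where "finite F" "F \<subseteq> carrier G" "\<And>\<omega>. \<omega> \<in> cylG b F \<Longrightarrow> \<bar>f \<omega> - f (const_cfg b)\<bar> < e"
proof -
  have o: "openin topG {x \<in> topspace topG. f x \<in> ball (f (const_cfg b)) e}"
    by (rule openin_continuous_map_preimage[OF assms(1)]) simp
  then obtain F where F: "finite F" "F \<subseteq> carrier G"
      "{\<eta> \<in> \<Omega>. \<forall>i\<in>F. \<eta> i = const_cfg b i} \<subseteq> {x \<in> topspace topG. f x \<in> ball (f (const_cfg b)) e}"
    using openin_config_cyl[OF o, of "const_cfg b"] assms(2) by auto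
  have "\<bar>f \<omega> - f (const_cfg b)\<bar> < e" if "\<omega> \<in> cylG b F" for \<omega>
  proof -
    have "\<omega> \<in> {\<eta> \<in> \<Omega>. \<forall>i\<in>F. \<eta> i = const_cfg b i}" using that F(2) by (auto simp: cyl_def const_cfg_def subset_iff)
    then have "f \<omega> \<in> ball (f (const_cfg b)) e" using F(3) by blast
    then show ?thesis by (simp add: dist_real_def abs_minus_commute)
  qed
  then show ?thesis using F that by blast
qed

text \<open>A continuous function is nearly constant on a cylinder around each of the two constant
  configurations. In the limit these cylinders carry all the mass, with weights \<open>p\<close> and
  \<open>1 - p\<close>, and boundedness of \<open>f\<close> controls the rest.\<close>

lemma perc_weak_limit:
  assumes p: "0 < p" "p < 1" and f: "continuous_map topG euclideanreal f"
  shows "(\<lambda>n. \<integral>\<omega>. f \<omega> \<partial>perc p n) \<longlonglongrightarrow> (\<integral>\<omega>. f \<omega> \<partial>two_point p)"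
proof -
  have fm: "f \<in> borel_measurable cG" by (rule continuous_config_measurable[OF f])
  obtain B where B: "B \<ge> 0" "\<And>\<omega>. \<omega> \<in> \<Omega> \<Longrightarrow> \<bar>f \<omega>\<bar> \<le> B" using continuous_config_bounded[OF f] by blast
  let ?t = "f (const_cfg True)" and ?u = "f (const_cfg False)"
  have lim: "(\<integral>\<omega>. f \<omega> \<partial>two_point p) = ?t * p + ?u * (1 - p)"
    unfolding two_point_def using p by (subst integral_distr[OF const_cfg_measurable fm]) simp
  show ?thesis
  proof (rule LIMSEQ_I)
    fix r :: real assume r: "0 < r"
    obtain F1 where F1: "finite F1" "F1 \<subseteq> carrier G"
        "\<And>\<omega>. \<omega> \<in> cylG True F1 \<Longrightarrow> \<bar>f \<omega> - ?t\<bar> < r / 2"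
      using continuous_config_cyl[OF f, of "r/2" True] r by auto
    obtain F2 where F2: "finite F2" "F2 \<subseteq> carrier G"
        "\<And>\<omega>. \<omega> \<in> cylG False F2 \<Longrightarrow> \<bar>f \<omega> - ?u\<bar> < r / 2"
      using continuous_config_cyl[OF f, of "r/2" False] r by auto
    \<comment> \<open>Including the identity makes the open and closed cylinders disjoint and gives
      access to the limits of their probabilities.\<close>
    define F where "F = insert \<one> (F1 \<union> F2)"
    have F: "finite F" "F \<subseteq> carrier G" "\<one> \<in> F" using F1 F2 by (auto simp: F_def)
    let ?A = "cylG True F" and ?B = "cylG False F"
    have dis: "?A \<inter> ?B = {}" using F by (auto simp: cyl_def)
    let ?a = "\<lambda>n. measure (perc p n) ?A" and ?b = "\<lambda>n. measure (perc p n) ?B"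
    \<comment> \<open>The error beyond \<open>r / 2\<close>: mass outside both cylinders, and
      deviation of the two weights from \<open>p\<close> and \<open>1 - p\<close>.\<close>
    define g where "g = (\<lambda>n. B * (1 - ?a n - ?b n) + \<bar>?t\<bar> * \<bar>?a n - p\<bar> + \<bar>?u\<bar> * \<bar>?b n - (1 - p)\<bar>)"
    have "g \<longlonglongrightarrow> B * (1 - p - (1 - p)) + \<bar>?t\<bar> * \<bar>p - p\<bar> + \<bar>?u\<bar> * \<bar>1 - p - (1 - p)\<bar>"
      unfolding g_def by (intro tendsto_intros perc_cyl_tendsto[OF p F])
    then have "g \<longlonglongrightarrow> 0" by simp
    then obtain N where N: "\<And>n. n \<ge> N \<Longrightarrow> \<bar>g n\<bar> < r / 2"
      using r by (metis LIMSEQ_D half_gt_zero diff_zero real_norm_def)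
    have "\<bar>(\<integral>\<omega>. f \<omega> \<partial>perc p n) - (\<integral>\<omega>. f \<omega> \<partial>two_point p)\<bar> \<le> r / 2 + g n" for n
    proof -
      note \<mu> = inv_prob_perc[OF p, of n]
      interpret prob_space "perc p n" by (rule inv_probD(1)[OF \<mu>])
      note [simp] = inv_probD(2,3)[OF \<mu>]
      have AB: "?A \<in> events" "?B \<in> events" using F by (auto simp: cyl_sets)
      have AO: "?A \<inter> \<Omega> = ?A" "?B \<inter> \<Omega> = ?B" by (auto simp: cyl_def)
      have fi: "integrable (perc p n) f"
      proof (rule integrable_const_bound[of _ B])
        show "f \<in> borel_measurable (perc p n)"
          using fm measurable_cong_sets[OF inv_probD(2)[OF \<mu>] refl] by blast
      qed (use B in auto)
      have ii: "integrable (perc p n) (indicator X :: _ \<Rightarrow> real)" if "X \<in> events" for X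
        using that by (intro integrable_real_indicator) (auto simp: emeasure_eq_measure)
      have pw: "\<bar>f \<omega> - ?t * indicator ?A \<omega> - ?u * indicator ?B \<omega>\<bar>
          \<le> r / 2 + B * (1 - indicator ?A \<omega> - indicator ?B \<omega>)" if "\<omega> \<in> space (perc p n)" for \<omega>
      proof -
        consider "\<omega> \<in> ?A" | "\<omega> \<in> ?B" | "\<omega> \<notin> ?A" "\<omega> \<notin> ?B" by auto
        then show ?thesis
        proof cases
          case 1
          then have "\<omega> \<notin> ?B" "\<omega> \<in> cylG True F1" using dis by (auto simp: F_def cyl_def)
          then show ?thesis using 1 F1(3)[of \<omega>] by simp
        next
          case 2
          then have "\<omega> \<notin> ?A" "\<omega> \<in> cylG False F2" using dis by (auto simp: F_def cyl_def)
          then show ?thesis using 2 F2(3)[of \<omega>] by simp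
        next
          case 3
          then show ?thesis using B(2)[of \<omega>] that r by simp
        qed
      qed
      have "\<bar>(\<integral>\<omega>. f \<omega> \<partial>perc p n) - ?t * ?a n - ?u * ?b n\<bar> =
          \<bar>\<integral>\<omega>. f \<omega> - ?t * indicator ?A \<omega> - ?u * indicator ?B \<omega> \<partial>perc p n\<bar>"
        using fi AB ii by (simp add: AO)
      also have "\<dots> \<le> (\<integral>\<omega>. \<bar>f \<omega> - ?t * indicator ?A \<omega> - ?u * indicator ?B \<omega>\<bar> \<partial>perc p n)"
        by (rule integral_abs_bound)
      also have "\<dots> \<le> (\<integral>\<omega>. r / 2 + B * (1 - indicator ?A \<omega> - indicator ?B \<omega>) \<partial>perc p n)"
        using fi AB ii by (intro integral_mono pw) auto
      also have "\<dots> = r / 2 + B * (1 - ?a n - ?b n)"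
        using AB ii prob_space by (simp add: AO)
      finally have 1: "\<bar>(\<integral>\<omega>. f \<omega> \<partial>perc p n) - ?t * ?a n - ?u * ?b n\<bar> \<le> r / 2 + B * (1 - ?a n - ?b n)" .
      have 2: "\<bar>?t * ?a n - ?t * p\<bar> = \<bar>?t\<bar> * \<bar>?a n - p\<bar>" by (simp add: abs_mult[symmetric] algebra_simps)
      have 3: "\<bar>?u * ?b n - ?u * (1 - p)\<bar> = \<bar>?u\<bar> * \<bar>?b n - (1 - p)\<bar>"
        by (simp only: abs_mult[symmetric] right_diff_distrib)
      have tri: "\<bar>z - (t * p + u * (1 - p))\<bar> \<le> c + \<bar>t * a - t * p\<bar> + \<bar>u * b - u * (1 - p)\<bar>"
        if "\<bar>z - t * a - u * b\<bar> \<le> c" for z t a u b c :: real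
        using that by linarith
      show ?thesis unfolding lim g_def using tri[OF 1] unfolding 2 3 by simp
    qed
    then show "\<exists>N. \<forall>n\<ge>N. norm ((\<integral>\<omega>. f \<omega> \<partial>perc p n) - (\<integral>\<omega>. f \<omega> \<partial>two_point p)) < r"
      using N by (intro exI[of _ N]) (smt (verit) real_norm_def field_sum_of_halves)
  qed
qed

text \<open>If every union of a weakly mixing stage had null connections, induction would keep all
  stages weakly mixing, hence ergodic, and closedness would make their limit ergodic. So the union
  at some stage is the required \<nu>; its density p(2 - p) is at most 2p.\<close>

lemma kazhdan_imp_long_connections:
  assumes T: "kazhdan_property_T G" and p: "0 < p" "p < 1"
  obtains \<nu> x y where "inv_prob \<nu>" "wmix \<nu>" "\<And>z. z \<in> carrier G \<Longrightarrow> dens \<nu> z \<le> 2 * p"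
    "x \<in> carrier G" "y \<in> carrier G" "\<not> null (\<lambda>g. measure \<nu> (together x (g \<otimes> y)))"
proof (rule ccontr)
  assume no: "\<not> thesis"
  note long = that
  note inv = inv_prob_perc[OF p]
  have wm: "wmix (perc p n)" for n
  proof (induction n)
    case 0
    then show ?case using p by (simp add: wmix_bern)
  next
    case (Suc n)
    have 1: "inv_prob (uni (perc p n))" "wmix (uni (perc p n))"
      using Suc inv by (auto intro: inv_prob_uni wmix_uni)
    have d: "dens (uni (perc p n)) z \<le> 2 * p" if "z \<in> carrier G" for z
      using \<open>z \<in> carrier G\<close> p by (simp add: dens_uni inv dens_perc algebra_simps)
    have "null (\<lambda>g. measure (uni (perc p n)) (together x (g \<otimes> y)))"
      if xy: "x \<in> carrier G" "y \<in> carrier G" for x y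
    proof (rule ccontr)
      assume "\<not> null (\<lambda>g. measure (uni (perc p n)) (together x (g \<otimes> y)))"
      then have thesis by (intro long[OF 1 _ xy] d)
      with no show False by contradiction
    qed
    then show ?case using p by (auto intro!: wmix_thin 1)
  qed
  let ?act = "\<lambda>g a. g \<otimes> a"
  let ?P = "invariant_measures G (carrier G) ?act"
  let ?C = "{f. continuous_map topG euclideanreal f}"
  let ?h = "\<lambda>\<mu>. \<lambda>f\<in>?C. \<integral>x. f x \<partial>\<mu>"
  let ?T = "product_topology (\<lambda>_. euclideanreal) ?C"
  let ?W = "weak_star_topology topG ?P"
  have W: "?W = pullback_topology ?P ?h ?T" by (simp add: weak_star_topology_def Let_def)
  have P: "perc p n \<in> ?P" "two_point p \<in> ?P" for n
    using inv inv_prob_two_point by (simp_all add: invariant_measures_iff)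
  have lim: "limitin ?T (\<lambda>n. ?h (perc p n)) (?h (two_point p)) sequentially"
    unfolding limitin_componentwise
    using perc_weak_limit[OF p] by (auto simp: topspace_product_topology)
  \<comment> \<open>The weak* topology is pulled back from a product, so convergence of the integral
    of each continuous function is enough.\<close>
  have "limitin ?W (perc p) (two_point p) sequentially"
    unfolding limitin_def W
  proof (intro conjI allI impI)
    show "two_point p \<in> topspace (pullback_topology ?P ?h ?T)"
      using P by (auto simp: topspace_pullback_topology topspace_product_topology)
    fix U assume U: "openin (pullback_topology ?P ?h ?T) U \<and> two_point p \<in> U"
    then obtain V where V: "openin ?T V" "U = ?h -` V \<inter> ?P" unfolding openin_pullback_topology by blast
    then have "\<forall>\<^sub>F n in sequentially. ?h (perc p n) \<in> V"
      using lim U unfolding limitin_def by blast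
    then show "\<forall>\<^sub>F n in sequentially. perc p n \<in> U"
      by (rule eventually_mono) (use V P in auto)
  qed
  moreover have "closedin ?W (ergodic_measures G (carrier G) ?act)"
    using T by (simp add: kazhdan_property_T_def)
  ultimately have "two_point p \<in> ergodic_measures G (carrier G) ?act"
    using wmix_ergodic[OF inv wm] by (intro limitin_closedin) auto
  then show False using two_point_not_ergodic[OF p] by simp
qed

end

section \<open>A random connected set chosen among the clusters\<close>

text \<open>The midpoint of two laws; the parallelogram law asks for no other convex
  combinations.\<close>

definition mid_pmf :: "'a pmf \<Rightarrow> 'a pmf \<Rightarrow> 'a pmf" where
  "mid_pmf a b = bind_pmf (bernoulli_pmf (1/2)) (\<lambda>c. if c then a else b)"

lemma pmf_mid: "pmf (mid_pmf a b) x = (pmf a x + pmf b x) / 2"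
  by (simp add: mid_pmf_def pmf_bind)

lemma set_pmf_mid: "set_pmf (mid_pmf a b) = set_pmf a \<union> set_pmf b"
  by (auto simp: mid_pmf_def set_pmf_bernoulli split: if_splits)

context cayley
begin

text \<open>A cluster is encoded as a configuration, so that laws of random clusters live on the
  same measurable space.\<close>

definition clus :: "('a \<Rightarrow> bool) \<Rightarrow> 'a \<Rightarrow> ('a \<Rightarrow> bool)" where
  "clus \<omega> x = (\<lambda>y\<in>carrier G. conn \<omega> x y)"

definition connset :: "('a \<Rightarrow> bool) set" where
  "connset = {W \<in> \<Omega>. (\<exists>x\<in>carrier G. W x) \<and> (\<forall>x\<in>carrier G. \<forall>y\<in>carrier G. W x \<and> W y \<longrightarrow> conn W x y)}"

definition joined :: "'a \<Rightarrow> 'a \<Rightarrow> ('a \<Rightarrow> bool) set \<Rightarrow> ('a \<Rightarrow> bool) set" where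
  "joined x y A = {\<omega> \<in> \<Omega>. conn \<omega> x y \<and> clus \<omega> x \<in> A}"

lemma clus_in [simp]: "clus \<omega> x \<in> \<Omega>"
  by (simp add: clus_def)

lemma clus_measurable: "(\<lambda>\<omega>. clus \<omega> x) \<in> measurable cG cG"
  unfolding clus_def by (intro measurable_cfg pred_conn)

lemma clus_eq_iff:
  assumes "y \<in> carrier G" "\<omega> y"
  shows "clus \<omega> x = clus \<omega> y \<longleftrightarrow> conn \<omega> x y"
proof
  assume "clus \<omega> x = clus \<omega> y"
  then have "clus \<omega> x y = clus \<omega> y y" by simp
  then show "conn \<omega> x y" using conn_refl[where \<omega> = \<omega>, OF assms] assms by (simp add: clus_def)
next
  assume "conn \<omega> x y"
  then have "conn \<omega> x = conn \<omega> y" by (intro ext conn_cong)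
  then show "clus \<omega> x = clus \<omega> y" by (simp add: clus_def)
qed

lemma clus_tr: "g \<in> carrier G \<Longrightarrow> x \<in> carrier G \<Longrightarrow> clus (tr g \<omega>) x = tr g (clus \<omega> (g \<otimes> x))"
  unfolding clus_def tr_def by (rule restrict_ext) (simp add: conn_tr[unfolded tr_def])

text \<open>Every vertex of an open path from \<open>x\<close> lies in the cluster of
  \<open>x\<close>, so the path survives when all other clusters are erased.\<close>

lemma conn_clus:
  assumes "conn \<omega> x y" shows "conn (clus \<omega> x) x y"
proof -
  have x: "x \<in> carrier G" "\<omega> x" and "(x, y) \<in> (crel \<omega>)\<^sup>*" using assms by (auto simp: conn_def)
  from this(3,1,2) have "(x, y) \<in> (crel (clus \<omega> x))\<^sup>*"
  proof (induction rule: rtrancl_induct)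
    case (step y z)
    have "conn \<omega> x y" "conn \<omega> x z" using x step(1,2) by (auto simp: conn_def)
    then have "(y, z) \<in> crel (clus \<omega> x)"
      using step(2) by (auto simp: crel_def clus_def dest: cayley_adj_carrier)
    then show ?case using step by auto
  qed simp
  then show ?thesis using x conn_refl[where \<omega> = \<omega>, OF x] by (simp add: conn_def clus_def)
qed

lemma clus_connset:
  assumes "x \<in> carrier G" "\<omega> x" shows "clus \<omega> x \<in> connset"
  unfolding connset_def
proof (intro CollectI conjI ballI impI)
  show "clus \<omega> x \<in> \<Omega>" by simp
  show "\<exists>y\<in>carrier G. clus \<omega> x y" using assms conn_refl[where \<omega> = \<omega>, OF assms] by (auto simp: clus_def)
  fix y z assume yz: "y \<in> carrier G" "z \<in> carrier G" "clus \<omega> x y \<and> clus \<omega> x z"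
  then have c: "conn \<omega> x y" "conn \<omega> x z" by (auto simp: clus_def)
  then have "conn \<omega> y z" using conn_sym conn_trans by blast
  then have "conn (clus \<omega> y) y z" by (rule conn_clus)
  moreover have "clus \<omega> x = clus \<omega> y" using c connD[OF c(1)] by (simp add: clus_eq_iff)
  ultimately show "conn (clus \<omega> x) y z" by simp
qed

lemma connset_sets: "connset \<in> sets cG"
  unfolding connset_def space_cfg[symmetric]
  by (intro pred_sets pred_intros_logic(3,4) pred_Bex_countable pred_Ball_countable countable_carrier
      pred_cfg pred_conn)

lemma joined_sets: "A \<in> sets cG \<Longrightarrow> joined x y A \<in> sets cG"
proof -
  assume A: "A \<in> sets cG"
  have eq: "joined x y A = together x y \<inter> ((\<lambda>\<omega>. clus \<omega> x) -` A \<inter> space cG)"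
    by (auto simp: joined_def)
  show ?thesis unfolding eq by (intro sets.Int conn_sets measurable_sets[OF clus_measurable A])
qed

lemma tset_joined:
  assumes "g \<in> carrier G" "x \<in> carrier G" "y \<in> carrier G"
  shows "joined (g \<otimes> x) (g \<otimes> y) (tset g A) = tset g (joined x y A)"
  using assms by (auto simp: joined_def tset_def conn_tr clus_tr)

section \<open>The quadratic form of common clusters\<close>

definition quad :: "'a set \<Rightarrow> ('a \<Rightarrow> real) \<Rightarrow> ('a \<Rightarrow> 'a \<Rightarrow> real) \<Rightarrow> real" where
  "quad T \<alpha> k = (\<Sum>x\<in>T. \<Sum>y\<in>T. \<alpha> x * \<alpha> y * k x y)"

text \<open>For a fixed configuration, being in a common cluster is an equivalence relation on open
  vertices. Grouping by clusters diagonalizes the form into squares of cluster masses, with signed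
  weights allowed.\<close>

lemma quad_joined_eq:
  assumes T: "finite T" "T \<subseteq> carrier G" and \<omega>: "\<omega> \<in> \<Omega>"
  shows "quad T \<alpha> (\<lambda>x y. indicator (joined x y A) \<omega>) =
    (\<Sum>c\<in>clus \<omega> ` {x\<in>T. \<omega> x}. indicator A c * (\<Sum>x\<in>{x\<in>T. \<omega> x \<and> clus \<omega> x = c}. \<alpha> x)\<^sup>2)"
proof -
  let ?T = "{x\<in>T. \<omega> x}"
  have fin: "finite ?T" using T by simp
  define W where "W = (\<lambda>c. \<Sum>x\<in>{x\<in>T. \<omega> x \<and> clus \<omega> x = c}. \<alpha> x)"
  have ind: "indicator (joined x y A) \<omega> = (if \<omega> x \<and> \<omega> y \<and> clus \<omega> y = clus \<omega> x then indicator A (clus \<omega> x) else 0 :: real)"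
    if "x \<in> T" "y \<in> T" for x y
  proof -
    have c: "x \<in> carrier G" "y \<in> carrier G" using that T by auto
    show ?thesis using \<omega> clus_eq_iff[OF c(2), of \<omega> x] connD[of \<omega> x y] by (auto simp: joined_def indicator_def)
  qed
  have "quad T \<alpha> (\<lambda>x y. indicator (joined x y A) \<omega>) =
      (\<Sum>x\<in>T. \<Sum>y\<in>T. if \<omega> x \<and> \<omega> y \<and> clus \<omega> y = clus \<omega> x then indicator A (clus \<omega> x) * \<alpha> x * \<alpha> y else 0)"
    unfolding quad_def by (intro sum.cong refl) (simp add: ind)
  also have "\<dots> = (\<Sum>x\<in>T. if \<omega> x then indicator A (clus \<omega> x) * \<alpha> x * W (clus \<omega> x) else 0)"
  proof (intro sum.cong refl)
    fix x
    have "(\<Sum>y\<in>T. if \<omega> x \<and> \<omega> y \<and> clus \<omega> y = clus \<omega> x then indicator A (clus \<omega> x) * \<alpha> x * \<alpha> y else 0) =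
       (if \<omega> x then (\<Sum>y\<in>{y\<in>T. \<omega> y \<and> clus \<omega> y = clus \<omega> x}. indicator A (clus \<omega> x) * \<alpha> x * \<alpha> y) else 0)"
      using T(1) by (simp add: sum.inter_filter)
    then show "(\<Sum>y\<in>T. if \<omega> x \<and> \<omega> y \<and> clus \<omega> y = clus \<omega> x then indicator A (clus \<omega> x) * \<alpha> x * \<alpha> y else 0) =
       (if \<omega> x then indicator A (clus \<omega> x) * \<alpha> x * W (clus \<omega> x) else 0)"
      by (simp add: W_def sum_distrib_left)
  qed
  also have "\<dots> = (\<Sum>x\<in>?T. indicator A (clus \<omega> x) * \<alpha> x * W (clus \<omega> x))"
    using T(1) by (simp add: sum.inter_filter)
  also have "\<dots> = (\<Sum>c\<in>clus \<omega> ` ?T. \<Sum>x\<in>{x. x \<in> ?T \<and> clus \<omega> x = c}. indicator A (clus \<omega> x) * \<alpha> x * W (clus \<omega> x))"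
    by (rule sum.image_gen[OF fin])
  also have "\<dots> = (\<Sum>c\<in>clus \<omega> ` ?T. indicator A c * (W c)\<^sup>2)"
  proof (intro sum.cong refl)
    fix c
    have "(\<Sum>x\<in>{x. x \<in> ?T \<and> clus \<omega> x = c}. indicator A (clus \<omega> x) * \<alpha> x * W (clus \<omega> x)) =
        (\<Sum>x\<in>{x\<in>T. \<omega> x \<and> clus \<omega> x = c}. \<alpha> x * (indicator A c * W c))"
      by (intro sum.cong) auto
    also have "\<dots> = W c * (indicator A c * W c)" unfolding W_def by (rule sum_distrib_right[symmetric])
    finally show "(\<Sum>x\<in>{x. x \<in> ?T \<and> clus \<omega> x = c}. indicator A (clus \<omega> x) * \<alpha> x * W (clus \<omega> x)) = indicator A c * (W c)\<^sup>2"
      by (simp add: power2_eq_square)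
  qed
  finally show ?thesis by (simp add: W_def)
qed

text \<open>AM-GM: \<open>\<bar>u\<^sup>2 - v\<^sup>2\<bar> = \<bar>u + v\<bar> \<bar>u - v\<bar> \<le> (t (u + v)\<^sup>2 + (u - v)\<^sup>2 / t) / 2\<close> on every cluster,
  \<open>u\<close> and \<open>v\<close> being the masses that \<open>\<alpha>\<close> and \<open>\<beta>\<close> give to it.\<close>

lemma quad_joined_diff:
  assumes T: "finite T" "T \<subseteq> carrier G" and \<omega>: "\<omega> \<in> \<Omega>" and t: "t > 0"
  shows "\<bar>quad T \<alpha> (\<lambda>x y. indicator (joined x y A) \<omega>) - quad T \<beta> (\<lambda>x y. indicator (joined x y A) \<omega>)\<bar> \<le>
    t / 2 * quad T (\<lambda>x. \<alpha> x + \<beta> x) (\<lambda>x y. indicator (joined x y \<Omega>) \<omega>) +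
    1 / (2 * t) * quad T (\<lambda>x. \<alpha> x - \<beta> x) (\<lambda>x y. indicator (joined x y \<Omega>) \<omega>)"
proof -
  define C where "C = clus \<omega> ` {x\<in>T. \<omega> x}"
  define w where "w = (\<lambda>\<alpha> c. \<Sum>x\<in>{x\<in>T. \<omega> x \<and> clus \<omega> x = c}. \<alpha> x :: real)"
  have q: "quad T \<gamma> (\<lambda>x y. indicator (joined x y B) \<omega>) = (\<Sum>c\<in>C. indicator B c * (w \<gamma> c)\<^sup>2)" for \<gamma> B
    unfolding C_def w_def by (rule quad_joined_eq[OF T \<omega>])
  have wadd: "w (\<lambda>x. \<alpha> x + \<beta> x) c = w \<alpha> c + w \<beta> c" "w (\<lambda>x. \<alpha> x - \<beta> x) c = w \<alpha> c - w \<beta> c" for c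
    by (simp_all add: w_def sum.distrib sum_subtractf)
  have am: "\<bar>u\<^sup>2 - v\<^sup>2\<bar> \<le> t / 2 * (u + v)\<^sup>2 + 1 / (2 * t) * (u - v)\<^sup>2" for u v :: real
  proof -
    have "0 \<le> (t * \<bar>u + v\<bar> - \<bar>u - v\<bar>)\<^sup>2" by simp
    then have "2 * t * (\<bar>u + v\<bar> * \<bar>u - v\<bar>) \<le> t\<^sup>2 * (u + v)\<^sup>2 + (u - v)\<^sup>2"
      by (simp add: power2_diff power_mult_distrib algebra_simps)
    moreover have "\<bar>u + v\<bar> * \<bar>u - v\<bar> = \<bar>u\<^sup>2 - v\<^sup>2\<bar>"
      by (simp add: abs_mult[symmetric] power2_eq_square algebra_simps)
    ultimately show ?thesis using t by (simp add: field_simps power2_eq_square)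
  qed
  have "\<bar>(\<Sum>c\<in>C. indicator A c * (w \<alpha> c)\<^sup>2) - (\<Sum>c\<in>C. indicator A c * (w \<beta> c)\<^sup>2)\<bar> \<le>
      (\<Sum>c\<in>C. \<bar>indicator A c * (w \<alpha> c)\<^sup>2 - indicator A c * (w \<beta> c)\<^sup>2\<bar>)"
    unfolding sum_subtractf[symmetric] by (rule sum_abs)
  also have "\<dots> \<le> (\<Sum>c\<in>C. t / 2 * (indicator \<Omega> c * (w \<alpha> c + w \<beta> c)\<^sup>2) + 1 / (2 * t) * (indicator \<Omega> c * (w \<alpha> c - w \<beta> c)\<^sup>2))"
  proof (intro sum_mono)
    fix c assume "c \<in> C"
    then have "c \<in> \<Omega>" by (auto simp: C_def)
    moreover have "0 \<le> t / 2 * (w \<alpha> c + w \<beta> c)\<^sup>2 + 1 / (2 * t) * (w \<alpha> c - w \<beta> c)\<^sup>2" using t by simp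
    ultimately show "\<bar>indicator A c * (w \<alpha> c)\<^sup>2 - indicator A c * (w \<beta> c)\<^sup>2\<bar> \<le>
        t / 2 * (indicator \<Omega> c * (w \<alpha> c + w \<beta> c)\<^sup>2) + 1 / (2 * t) * (indicator \<Omega> c * (w \<alpha> c - w \<beta> c)\<^sup>2)"
      using am[of "w \<alpha> c" "w \<beta> c"] by (cases "c \<in> A") auto
  qed
  also have "\<dots> = t / 2 * (\<Sum>c\<in>C. indicator \<Omega> c * (w \<alpha> c + w \<beta> c)\<^sup>2) + 1 / (2 * t) * (\<Sum>c\<in>C. indicator \<Omega> c * (w \<alpha> c - w \<beta> c)\<^sup>2)"
    by (simp only: sum.distrib sum_distrib_left)
  finally show ?thesis unfolding q wadd .
qed

text \<open>The law of the common cluster of two independent \<open>a\<close>-random vertices, restricted to the event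
  that there is one.\<close>

definition lam :: "('a \<Rightarrow> bool) measure \<Rightarrow> 'a pmf \<Rightarrow> ('a \<Rightarrow> bool) set \<Rightarrow> real" where
  "lam \<nu> a A = quad (set_pmf a) (pmf a) (\<lambda>x y. measure \<nu> (joined x y A))"

text \<open>Enlarging the index set lets forms of measures with different supports be compared on a
  common one.\<close>

lemma lam_eq:
  assumes "finite T" "set_pmf a \<subseteq> T"
  shows "lam \<nu> a A = quad T (pmf a) (\<lambda>x y. measure \<nu> (joined x y A))"
proof -
  have 0: "pmf a x = 0" if "x \<in> T - set_pmf a" for x using that by (simp add: set_pmf_iff)
  have "quad T (pmf a) (\<lambda>x y. measure \<nu> (joined x y A)) =
      (\<Sum>x\<in>set_pmf a. \<Sum>y\<in>T. pmf a x * pmf a y * measure \<nu> (joined x y A))"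
    unfolding quad_def using assms 0 by (intro sum.mono_neutral_right) auto
  also have "\<dots> = (\<Sum>x\<in>set_pmf a. \<Sum>y\<in>set_pmf a. pmf a x * pmf a y * measure \<nu> (joined x y A))"
    using assms 0 by (intro sum.cong refl sum.mono_neutral_right) auto
  finally show ?thesis by (simp add: lam_def quad_def)
qed

lemma lam_expect:
  assumes "a \<in> finpmf"
  shows "lam \<nu> a A = expect a (\<lambda>x. expect a (\<lambda>y. measure \<nu> (joined x y A)))"
  using assms unfolding lam_def quad_def
  by (simp add: expect_sum_pmf[OF finpmfD(1) order_refl] sum_distrib_left mult.assoc)

lemma lam_nonneg: "0 \<le> lam \<nu> a A"
  unfolding lam_def quad_def by (intro sum_nonneg) simp

lemma lam_le_one:
  assumes "prob_space \<nu>" "a \<in> finpmf" shows "lam \<nu> a A \<le> 1"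
proof -
  interpret prob_space \<nu> by fact
  show ?thesis unfolding lam_expect[OF assms(2)] by (intro expect_le_const assms prob_le_1)
qed

lemma lam_add:
  assumes \<nu>: "inv_prob \<nu>" and AB: "A \<in> sets cG" "B \<in> sets cG" "A \<inter> B = {}"
  shows "lam \<nu> a (A \<union> B) = lam \<nu> a A + lam \<nu> a B"
proof -
  interpret prob_space \<nu> by (rule inv_probD(1)[OF \<nu>])
  have "measure \<nu> (joined x y (A \<union> B)) = measure \<nu> (joined x y A) + measure \<nu> (joined x y B)" for x y
  proof -
    have "joined x y (A \<union> B) = joined x y A \<union> joined x y B" "joined x y A \<inter> joined x y B = {}"
      using AB by (auto simp: joined_def)
    then show ?thesis using AB inv_probD(2)[OF \<nu>] by (simp add: finite_measure_Union joined_sets)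
  qed
  then show ?thesis by (simp add: lam_def quad_def sum.distrib algebra_simps)
qed

lemma lam_translate:
  assumes \<nu>: "inv_prob \<nu>" and g: "g \<in> carrier G" and a: "a \<in> finpmf" and A: "A \<in> sets cG"
  shows "lam \<nu> (map_pmf ((\<otimes>) g) a) (tset g A) = lam \<nu> a A"
proof -
  have ga: "map_pmf ((\<otimes>) g) a \<in> finpmf" using a g by (intro finpmf_map) auto
  have "lam \<nu> (map_pmf ((\<otimes>) g) a) (tset g A) =
      expect a (\<lambda>x. expect a (\<lambda>y. measure \<nu> (joined (g \<otimes> x) (g \<otimes> y) (tset g A))))"
    by (simp add: lam_expect[OF ga])
  also have "\<dots> = lam \<nu> a A"
    unfolding lam_expect[OF a]
    by (intro expect_cong[OF a]) (simp add: tset_joined g inv_probD(4)[OF \<nu> g joined_sets[OF A]])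
  finally show ?thesis .
qed

text \<open>Integrate \<open>quad_joined_diff\<close> over \<nu>. Since \<open>a + b\<close> is
  twice the midpoint, its form is 4 times that of the midpoint, and the parallelogram law expresses
  the form of \<open>a - b\<close>. The bound uses only total masses, so it is uniform in
  \<open>A\<close>.\<close>

lemma lam_diff:
  assumes \<nu>: "inv_prob \<nu>" and ab: "a \<in> finpmf" "b \<in> finpmf" and A: "A \<in> sets cG" and t: "t > 0"
  shows "\<bar>lam \<nu> a A - lam \<nu> b A\<bar> \<le> 2 * t * lam \<nu> (mid_pmf a b) \<Omega> +
    1 / (2 * t) * (2 * lam \<nu> a \<Omega> + 2 * lam \<nu> b \<Omega> - 4 * lam \<nu> (mid_pmf a b) \<Omega>)"
proof -
  interpret prob_space \<nu> by (rule inv_probD(1)[OF \<nu>])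
  define T where "T = set_pmf a \<union> set_pmf b"
  have T: "finite T" "T \<subseteq> carrier G" using ab by (auto simp: T_def finpmf_def)
  let ?k = "\<lambda>A x y. measure \<nu> (joined x y A)"
  let ?i = "\<lambda>A \<omega> x y. indicator (joined x y A) \<omega> :: real"
  have jm: "joined x y B \<in> events" if "B \<in> sets cG" for x y B
    using joined_sets[OF that] inv_probD(2)[OF \<nu>] by simp
  have ji: "integrable \<nu> (\<lambda>\<omega>. ?i B \<omega> x y)" if "B \<in> sets cG" for x y B
    using jm[OF that] by (intro integrable_real_indicator) (auto simp: emeasure_eq_measure)
  have qi: "integrable \<nu> (\<lambda>\<omega>. quad T \<gamma> (?i B \<omega>))" if "B \<in> sets cG" for \<gamma> B
    unfolding quad_def by (intro Bochner_Integration.integrable_sum integrable_mult_right ji that)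
  have qint: "(\<integral>\<omega>. quad T \<gamma> (?i B \<omega>) \<partial>\<nu>) = quad T \<gamma> (?k B)" if "B \<in> sets cG" for \<gamma> B
  proof -
    have [simp]: "joined x y B \<inter> space \<nu> = joined x y B" for x y
      using sets.sets_into_space[OF jm[OF that]] by blast
    show ?thesis unfolding quad_def
      using ji[OF that] by (simp add: Bochner_Integration.integral_sum Bochner_Integration.integrable_sum
          del: sum_mult_indicator sum_indicator_mult)
  qed
  have "\<bar>quad T (pmf a) (?k A) - quad T (pmf b) (?k A)\<bar> = \<bar>\<integral>\<omega>. quad T (pmf a) (?i A \<omega>) - quad T (pmf b) (?i A \<omega>) \<partial>\<nu>\<bar>"
    using qi A by (simp add: qint)
  also have "\<dots> \<le> (\<integral>\<omega>. \<bar>quad T (pmf a) (?i A \<omega>) - quad T (pmf b) (?i A \<omega>)\<bar> \<partial>\<nu>)"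
    by (rule integral_abs_bound)
  also have "\<dots> \<le> (\<integral>\<omega>. t / 2 * quad T (\<lambda>x. pmf a x + pmf b x) (?i \<Omega> \<omega>) +
      1 / (2 * t) * quad T (\<lambda>x. pmf a x - pmf b x) (?i \<Omega> \<omega>) \<partial>\<nu>)"
  proof (rule integral_mono)
    fix \<omega> assume "\<omega> \<in> space \<nu>"
    then have "\<omega> \<in> \<Omega>" by (simp add: inv_probD(3)[OF \<nu>])
    then show "\<bar>quad T (pmf a) (?i A \<omega>) - quad T (pmf b) (?i A \<omega>)\<bar> \<le>
       t / 2 * quad T (\<lambda>x. pmf a x + pmf b x) (?i \<Omega> \<omega>) + 1 / (2 * t) * quad T (\<lambda>x. pmf a x - pmf b x) (?i \<Omega> \<omega>)"
      by (rule quad_joined_diff[OF T _ t])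
  qed (intro integrable_abs Bochner_Integration.integrable_diff Bochner_Integration.integrable_add
      integrable_mult_right qi A Omega_sets)+
  also have "\<dots> = t / 2 * quad T (\<lambda>x. pmf a x + pmf b x) (?k \<Omega>) + 1 / (2 * t) * quad T (\<lambda>x. pmf a x - pmf b x) (?k \<Omega>)"
    by (subst Bochner_Integration.integral_add)
      (intro integrable_mult_right qi Omega_sets | simp add: qint[OF Omega_sets])+
  also have "quad T (\<lambda>x. pmf a x - pmf b x) (?k \<Omega>) =
      2 * quad T (pmf a) (?k \<Omega>) + 2 * quad T (pmf b) (?k \<Omega>) - quad T (\<lambda>x. pmf a x + pmf b x) (?k \<Omega>)"
    unfolding quad_def sum_distrib_left sum.distrib[symmetric] sum_subtractf[symmetric]
    by (intro sum.cong refl) (simp add: algebra_simps)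
  also have "quad T (\<lambda>x. pmf a x + pmf b x) (?k \<Omega>) = 4 * quad T (pmf (mid_pmf a b)) (?k \<Omega>)"
    unfolding quad_def sum_distrib_left by (intro sum.cong refl) (simp add: pmf_mid)
  finally show ?thesis
    using T by (simp add: lam_eq[of T] T_def set_pmf_mid)
qed

end

text \<open>Additivity survives pointwise limits, but continuity at the empty set does not in
  general; the error bound \<open>e n\<close>, the same for all sets, is what preserves it.\<close>

lemma measure_of_uniform_limit:
  fixes m :: "nat \<Rightarrow> 'x set \<Rightarrow> real"
  assumes add: "\<And>n A B. A \<in> sets M \<Longrightarrow> B \<in> sets M \<Longrightarrow> A \<inter> B = {} \<Longrightarrow> m n (A \<union> B) = m n A + m n B"
    and nonneg: "\<And>n A. A \<in> sets M \<Longrightarrow> 0 \<le> m n A"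
    and cont: "\<And>n A. range A \<subseteq> sets M \<Longrightarrow> decseq A \<Longrightarrow> (\<Inter>i. A i) = {} \<Longrightarrow> (\<lambda>i. m n (A i)) \<longlonglongrightarrow> 0"
    and unif: "\<And>n A. A \<in> sets M \<Longrightarrow> \<bar>m n A - L A\<bar> \<le> e n" and e: "e \<longlonglongrightarrow> 0"
  obtains \<mu> where "sets \<mu> = sets M" "\<And>A. A \<in> sets M \<Longrightarrow> emeasure \<mu> A = ennreal (L A)"
    "\<And>A. A \<in> sets M \<Longrightarrow> measure \<mu> A = L A"
proof -
  have lim: "(\<lambda>n. m n A) \<longlonglongrightarrow> L A" if "A \<in> sets M" for A
  proof (rule LIMSEQ_I)
    fix r :: real assume "r > 0"
    then obtain N where "\<forall>n\<ge>N. norm (e n - 0) < r" using LIMSEQ_D[OF e] by blast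
    then show "\<exists>N. \<forall>n\<ge>N. norm (m n A - L A) < r"
      using unif[OF that] by (intro exI[of _ N] allI impI) (smt (verit) real_norm_def)
  qed
  have L0: "0 \<le> L A" if "A \<in> sets M" for A
    using LIMSEQ_le_const[OF lim[OF that], of 0] nonneg[OF that] by auto
  have Ladd: "L (A \<union> B) = L A + L B" if "A \<in> sets M" "B \<in> sets M" "A \<inter> B = {}" for A B
  proof (rule LIMSEQ_unique)
    show "(\<lambda>n. m n (A \<union> B)) \<longlonglongrightarrow> L (A \<union> B)" using that by (intro lim) auto
    show "(\<lambda>n. m n (A \<union> B)) \<longlonglongrightarrow> L A + L B" using that by (simp add: add tendsto_add lim)
  qed
  have Lempty: "L {} = 0" using Ladd[of "{}" "{}"] by simp
  have Lcont: "(\<lambda>i. L (A i)) \<longlonglongrightarrow> 0" if A: "range A \<subseteq> sets M" "decseq A" "(\<Inter>i. A i) = {}" for A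
  proof (rule LIMSEQ_I)
    have Am: "A i \<in> sets M" for i using A by auto
    fix r :: real assume r: "r > 0"
    \<comment> \<open>One fixed \<open>n\<close> approximates \<open>L\<close> on all sets of the
      sequence simultaneously.\<close>
    obtain n where n: "\<bar>e n\<bar> < r / 2" using LIMSEQ_D[OF e, of "r/2"] r by auto
    obtain N where N: "\<forall>i\<ge>N. norm (m n (A i) - 0) < r / 2" using LIMSEQ_D[OF cont[OF A], of "r/2" n] r by auto
    have "norm (L (A i) - 0) < r" if "i \<ge> N" for i
      using N that unif[OF Am, of n i] n by force
    then show "\<exists>N. \<forall>i\<ge>N. norm (L (A i) - 0) < r" by blast
  qed
  define \<mu> where "\<mu> = measure_of (space M) (sets M) (\<lambda>A. ennreal (L A))"
  have pos: "positive (sets M) (\<lambda>A. ennreal (L A))" by (simp add: positive_def Lempty)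
  have "countably_additive (sets M) (\<lambda>A. ennreal (L A))"
  proof (rule sets.empty_continuous_imp_countably_additive[OF pos])
    show "additive (sets M) (\<lambda>A. ennreal (L A))"
      by (auto simp: additive_def Ladd L0 ennreal_plus[symmetric] simp del: ennreal_plus)
    show "(\<lambda>i. ennreal (L (A i))) \<longlonglongrightarrow> 0"
      if "range A \<subseteq> sets M" "decseq A" "(\<Inter>i. A i) = {}" for A
      using tendsto_ennrealI[OF Lcont[OF that]] by simp
  qed simp
  then have em: "emeasure \<mu> A = ennreal (L A)" if "A \<in> sets M" for A
    using that pos unfolding \<mu>_def by (intro emeasure_measure_of_sigma sets.sigma_algebra_axioms)
  moreover have "sets \<mu> = sets M" by (simp add: \<mu>_def)
  moreover have "measure \<mu> A = L A" if "A \<in> sets M" for A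
    using em[OF that] L0[OF that] by (simp add: measure_def)
  ultimately show ?thesis using that by blast
qed

section \<open>Minimizing the mass of the common cluster\<close>

context cayley
begin

definition closed_family :: "'a pmf set \<Rightarrow> bool" where
  "closed_family K \<longleftrightarrow> K \<noteq> {} \<and> K \<subseteq> finpmf \<and> (\<forall>a\<in>K. \<forall>b\<in>K. mid_pmf a b \<in> K) \<and>
     (\<forall>a\<in>K. \<forall>g\<in>carrier G. map_pmf ((\<otimes>) g) a \<in> K)"

lemma finpmf_mid: "a \<in> finpmf \<Longrightarrow> b \<in> finpmf \<Longrightarrow> mid_pmf a b \<in> finpmf"
  by (auto simp: finpmf_def set_pmf_mid)

text \<open>Convolving with \<open>k\<close> on the right commutes with left translation and is
  affine in \<open>a\<close>.\<close>

lemma closed_family_conv: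
  assumes k: "k \<in> finpmf" shows "closed_family {conv a k | a. a \<in> finpmf}"
  unfolding closed_family_def
proof (intro conjI ballI)
  show "{conv a k | a. a \<in> finpmf} \<noteq> {}" using k by blast
  show "{conv a k | a. a \<in> finpmf} \<subseteq> finpmf" using k by auto
next
  fix c c' assume "c \<in> {conv a k | a. a \<in> finpmf}" "c' \<in> {conv a k | a. a \<in> finpmf}"
  then obtain a b where ab: "c = conv a k" "c' = conv b k" "a \<in> finpmf" "b \<in> finpmf" by auto
  have "mid_pmf c c' = conv (mid_pmf a b) k"
    unfolding ab mid_pmf_def conv_def bind_assoc_pmf by (intro bind_pmf_cong) auto
  then show "mid_pmf c c' \<in> {conv a k | a. a \<in> finpmf}" using ab finpmf_mid by blast
next
  fix c g assume "c \<in> {conv a k | a. a \<in> finpmf}" and g: "g \<in> carrier G"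
  then obtain a where a: "c = conv a k" "a \<in> finpmf" by auto
  have "map_pmf ((\<otimes>) g) c = conv (map_pmf ((\<otimes>) g) a) k"
    unfolding a(1) conv_def map_bind_pmf bind_map_pmf map_pmf_comp
    using a(2) k g by (intro bind_pmf_cong map_pmf_cong refl) (auto simp: m_assoc finpmfD)
  moreover have "map_pmf ((\<otimes>) g) a \<in> finpmf" using a g by (intro finpmf_map) auto
  ultimately show "map_pmf ((\<otimes>) g) c \<in> {conv a k | a. a \<in> finpmf}" by blast
qed

text \<open>The midpoint also has mass at least \<open>d\<close>, so the parallelogram defect is at
  most \<open>4 * e\<^sup>2\<close>. Taking \<open>t = e\<close> in \<open>lam_diff\<close>, both
  terms are at most \<open>2 * e\<close>.\<close>

lemma lam_near_minimal:
  assumes \<nu>: "inv_prob \<nu>" and K: "closed_family K" and ab: "a \<in> K" "b \<in> K" and A: "A \<in> sets cG"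
    and d: "\<And>c. c \<in> K \<Longrightarrow> d \<le> lam \<nu> c \<Omega>" and e: "e > 0"
    and near: "lam \<nu> a \<Omega> \<le> d + e\<^sup>2" "lam \<nu> b \<Omega> \<le> d + e\<^sup>2"
  shows "\<bar>lam \<nu> a A - lam \<nu> b A\<bar> \<le> 4 * e"
proof -
  have fin: "a \<in> finpmf" "b \<in> finpmf" and m: "mid_pmf a b \<in> K" using K ab by (auto simp: closed_family_def)
  let ?m = "lam \<nu> (mid_pmf a b) \<Omega>"
  have m1: "?m \<le> 1" using lam_le_one[OF inv_probD(1)[OF \<nu>] finpmf_mid[OF fin]] .
  have "2 * lam \<nu> a \<Omega> + 2 * lam \<nu> b \<Omega> - 4 * ?m \<le> 4 * e\<^sup>2" using near d[OF m] by linarith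
  then have "1 / (2 * e) * (2 * lam \<nu> a \<Omega> + 2 * lam \<nu> b \<Omega> - 4 * ?m) \<le> 1 / (2 * e) * (4 * e\<^sup>2)"
    using e by (intro mult_left_mono) auto
  also have "\<dots> = 2 * e" using e by (simp add: power2_eq_square)
  finally have "1 / (2 * e) * (2 * lam \<nu> a \<Omega> + 2 * lam \<nu> b \<Omega> - 4 * ?m) \<le> 2 * e" .
  moreover have "2 * e * ?m \<le> 2 * e" using e m1 by simp
  ultimately show ?thesis using lam_diff[OF \<nu> fin A e] by linarith
qed

text \<open>If the common cluster of \<open>x\<close> and \<open>y\<close> contains
  \<open>g\<close>, then in particular \<open>g\<close> is open. Weak mixing makes openness of a
  suitable \<open>g\<close> almost independent of the finitely many connection events of the support
  of \<open>a\<close>.\<close>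

lemma lam_density:
  assumes \<nu>: "inv_prob \<nu>" "wmix \<nu>" and a: "a \<in> finpmf" and e: "e > 0"
  shows "\<exists>g\<in>carrier G. lam \<nu> a (tset g (cylG True {\<one>})) \<le> lam \<nu> a \<Omega> * dens \<nu> \<one> + e"
proof -
  interpret prob_space \<nu> by (rule inv_probD(1)[OF \<nu>(1)])
  let ?C = "cylG True {\<one>}"
  have C: "?C \<in> sets cG" by (intro cyl_sets) auto
  let ?T = "set_pmf a"
  let ?j = "\<lambda>x y. joined x y \<Omega>"
  define \<phi> where "\<phi> = (\<lambda>g. \<Sum>x\<in>?T. \<Sum>y\<in>?T. \<bar>measure \<nu> (?j x y \<inter> tset g ?C) - measure \<nu> (?j x y) * measure \<nu> ?C\<bar>)"
  have "null \<phi>" unfolding \<phi>_def by (intro null_sum wmixD[OF \<nu>(2)] joined_sets Omega_sets C)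
  then obtain g where g: "g \<in> carrier G" "\<phi> g \<le> e" using null_small e by blast
  have "measure \<nu> (joined x y (tset g ?C)) \<le> measure \<nu> (?j x y \<inter> tset g ?C)" if "x \<in> carrier G" for x y
  proof (rule finite_measure_mono)
    show "joined x y (tset g ?C) \<subseteq> ?j x y \<inter> tset g ?C"
    proof
      fix \<omega> assume "\<omega> \<in> joined x y (tset g ?C)"
      then have "\<omega> \<in> \<Omega>" "conn \<omega> x y" "conn \<omega> x g"
        using g(1) by (simp_all add: joined_def tset_def cyl_def clus_def)
      then show "\<omega> \<in> ?j x y \<inter> tset g ?C"
        using g(1) connD(4)[of \<omega> x g] by (simp add: joined_def tset_def cyl_def)
    qed
    show "?j x y \<inter> tset g ?C \<in> events"
      using joined_sets[OF Omega_sets] tset_sets[OF g(1) C] inv_probD(2)[OF \<nu>(1)] by auto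
  qed
  then have "lam \<nu> a (tset g ?C) \<le> (\<Sum>x\<in>?T. \<Sum>y\<in>?T. pmf a x * pmf a y * measure \<nu> (?j x y \<inter> tset g ?C))"
    unfolding lam_def quad_def using a by (intro sum_mono mult_left_mono) (auto simp: finpmfD)
  also have "\<dots> \<le> (\<Sum>x\<in>?T. \<Sum>y\<in>?T. pmf a x * pmf a y * measure \<nu> (?j x y) * measure \<nu> ?C +
      \<bar>measure \<nu> (?j x y \<inter> tset g ?C) - measure \<nu> (?j x y) * measure \<nu> ?C\<bar>)"
  proof (intro sum_mono)
    fix x y
    let ?p = "pmf a x * pmf a y" and ?u = "measure \<nu> (?j x y \<inter> tset g ?C)" and ?v = "measure \<nu> (?j x y) * measure \<nu> ?C"
    have "?p * (?u - ?v) \<le> ?p * \<bar>?u - ?v\<bar>" by (intro mult_left_mono) auto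
    also have "\<dots> \<le> \<bar>?u - ?v\<bar>" by (intro mult_left_le_one_le mult_le_one pmf_le_1) auto
    finally show "?p * ?u \<le> ?p * measure \<nu> (?j x y) * measure \<nu> ?C + \<bar>?u - ?v\<bar>" by (simp add: algebra_simps)
  qed
  also have "\<dots> = lam \<nu> a \<Omega> * dens \<nu> \<one> + \<phi> g"
    by (simp add: sum.distrib \<phi>_def lam_def quad_def dens_def sum_distrib_right)
  finally have "lam \<nu> a (tset g ?C) \<le> lam \<nu> a \<Omega> * dens \<nu> \<one> + e" using g(2) by linarith
  then show ?thesis using g(1) by blast
qed

lemma lam_outside_connset: "lam \<nu> a (\<Omega> - connset) = 0"
proof -
  have "joined x y (\<Omega> - connset) = {}" for x y
  proof -
    have "clus \<omega> x \<in> connset" if "conn \<omega> x y" for \<omega>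
      by (rule clus_connset[where \<omega> = \<omega>, OF connD(1,3)[OF that]])
    then show ?thesis by (simp add: joined_def)
  qed
  then show ?thesis by (simp add: lam_def quad_def)
qed

text \<open>Near-minimizers have uniformly close cluster laws, so these laws converge; the limit has
  mass \<open>d\<close>, the positive infimum, and is normalized by it.\<close>

lemma exists_random_connset:
  assumes \<nu>: "inv_prob \<nu>" "wmix \<nu>" and K: "closed_family K"
    and pos: "\<delta> > 0" "\<And>a. a \<in> K \<Longrightarrow> \<delta> \<le> lam \<nu> a \<Omega>"
  obtains \<Lambda> where "inv_prob \<Lambda>" "measure \<Lambda> connset = 1" "dens \<Lambda> \<one> \<le> dens \<nu> \<one>"
proof -
  interpret prob_space \<nu> by (rule inv_probD(1)[OF \<nu>(1)])
  have Kfin: "a \<in> finpmf" if "a \<in> K" for a using K that by (auto simp: closed_family_def)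
  define d where "d = (INF a\<in>K. lam \<nu> a \<Omega>)"
  have Kne: "K \<noteq> {}" using K by (simp add: closed_family_def)
  have bdd: "bdd_below ((\<lambda>a. lam \<nu> a \<Omega>) ` K)" by (intro bdd_belowI2[of _ 0] lam_nonneg)
  have d: "d \<le> lam \<nu> a \<Omega>" if "a \<in> K" for a unfolding d_def using bdd that by (rule cINF_lower)
  have "\<delta> \<le> d" unfolding d_def using Kne pos(2) by (rule cINF_greatest)
  then have d0: "d > 0" using pos(1) by simp
  define e :: "nat \<Rightarrow> real" where "e = (\<lambda>n. inverse (real (Suc n)))"
  have e0: "e n > 0" for n by (simp add: e_def)
  have elim: "e \<longlonglongrightarrow> 0" unfolding e_def by (rule LIMSEQ_inverse_real_of_nat)
  have emono: "e n \<le> e m" if "m \<le> n" for m n using that by (simp add: e_def)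
  \<comment> \<open>The excess is squared because near-minimality within \<open>e\<^sup>2\<close>
    gives closeness within \<open>4 * e\<close>.\<close>
  have "\<exists>a\<in>K. lam \<nu> a \<Omega> < d + (e n)\<^sup>2" for n
    using cINF_less_iff[OF Kne bdd, of "d + (e n)\<^sup>2"] e0[of n] unfolding d_def[symmetric] by simp
  then obtain a where a: "\<And>n. a n \<in> K" "\<And>n. lam \<nu> (a n) \<Omega> < d + (e n)\<^sup>2" by metis
  have near: "\<bar>lam \<nu> (a n) A - lam \<nu> (a m) A\<bar> \<le> 4 * e m" if "m \<le> n" "A \<in> sets cG" for m n A
  proof (rule lam_near_minimal[OF \<nu>(1) K a(1) a(1) that(2) d e0])
    have "(e n)\<^sup>2 \<le> (e m)\<^sup>2" using emono[OF that(1)] e0[of n] by (intro power_mono) auto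
    then show "lam \<nu> (a n) \<Omega> \<le> d + (e m)\<^sup>2" using a(2)[of n] by linarith
    show "lam \<nu> (a m) \<Omega> \<le> d + (e m)\<^sup>2" using a(2)[of m] by linarith
  qed
  have conv: "convergent (\<lambda>n. lam \<nu> (a n) A)" if A: "A \<in> sets cG" for A
  proof (rule Cauchy_convergent, rule metric_CauchyI)
    fix r :: real assume r: "r > 0"
    obtain N where "\<forall>n\<ge>N. norm (e n - 0) < r / 8" using LIMSEQ_D[OF elim, of "r/8"] r by auto
    then have N: "e N < r / 8" by (auto dest: spec[of _ N])
    have "dist (lam \<nu> (a m) A) (lam \<nu> (a n) A) < r" if "m \<ge> N" "n \<ge> N" for m n
      using near[OF that(1) A] near[OF that(2) A] N unfolding dist_real_def by linarith
    then show "\<exists>N. \<forall>m\<ge>N. \<forall>n\<ge>N. dist (lam \<nu> (a m) A) (lam \<nu> (a n) A) < r" by blast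
  qed
  define L where "L = (\<lambda>A. lim (\<lambda>n. lam \<nu> (a n) A))"
  have L: "(\<lambda>n. lam \<nu> (a n) A) \<longlonglongrightarrow> L A" if "A \<in> sets cG" for A
    unfolding L_def using conv[OF that] by (simp add: convergent_LIMSEQ_iff)
  have unif: "\<bar>lam \<nu> (a m) A - L A\<bar> \<le> 4 * e m" if A: "A \<in> sets cG" for m A
  proof -
    have "(\<lambda>n. \<bar>lam \<nu> (a n) A - lam \<nu> (a m) A\<bar>) \<longlonglongrightarrow> \<bar>L A - lam \<nu> (a m) A\<bar>"
      by (intro tendsto_intros L A)
    then have "\<bar>L A - lam \<nu> (a m) A\<bar> \<le> 4 * e m"
      by (rule LIMSEQ_le_const2) (use near[OF _ A] in blast)
    then show ?thesis by linarith
  qed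
  \<comment> \<open>The translate of \<open>a n\<close> stays in \<open>K\<close> and has the same
    mass, so it is equally near-minimal; its cluster law, which is the translated law, must
    therefore be close to the original.\<close>
  have Ltr: "L (tset g A) = L A" if g: "g \<in> carrier G" and A: "A \<in> sets cG" for g A
  proof (rule LIMSEQ_unique)
    have tA: "tset g A \<in> sets cG" using tset_sets[OF g A] .
    show "(\<lambda>n. lam \<nu> (a n) (tset g A)) \<longlonglongrightarrow> L (tset g A)" by (rule L[OF tA])
    have b: "\<bar>lam \<nu> (a n) (tset g A) - lam \<nu> (a n) A\<bar> \<le> 4 * e n" for n
    proof -
      let ?b = "map_pmf ((\<otimes>) g) (a n)"
      have b: "?b \<in> K" using K a(1) g by (auto simp: closed_family_def)
      have t\<Omega>: "tset g \<Omega> = \<Omega>" by (auto simp: tset_def)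
      have lb: "lam \<nu> ?b (tset g B) = lam \<nu> (a n) B" if "B \<in> sets cG" for B
        using lam_translate[OF \<nu>(1) g Kfin[OF a(1)] that] .
      have "\<bar>lam \<nu> (a n) (tset g A) - lam \<nu> ?b (tset g A)\<bar> \<le> 4 * e n"
      proof (rule lam_near_minimal[OF \<nu>(1) K a(1) b tA d e0])
        show "lam \<nu> (a n) \<Omega> \<le> d + (e n)\<^sup>2" using a(2)[of n] by linarith
        show "lam \<nu> ?b \<Omega> \<le> d + (e n)\<^sup>2" using a(2)[of n] lb[OF Omega_sets] t\<Omega> by simp
      qed
      then show ?thesis using lb[OF A] by simp
    qed
    have l: "(\<lambda>n. 4 * e n) \<longlonglongrightarrow> 0" by (rule tendsto_mult_right_zero[OF elim])
    have "(\<lambda>n. lam \<nu> (a n) (tset g A) - lam \<nu> (a n) A) \<longlonglongrightarrow> 0"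
      by (rule Lim_null_comparison[OF always_eventually l]) (simp only: real_norm_def b simp_thms)
    from tendsto_add[OF this L[OF A]] show "(\<lambda>n. lam \<nu> (a n) (tset g A)) \<longlonglongrightarrow> L A" by simp
  qed
  have Ld: "L \<Omega> = d"
  proof (rule LIMSEQ_unique[OF L[OF Omega_sets]])
    have "(\<lambda>n. d + (e n)\<^sup>2) \<longlonglongrightarrow> d + 0\<^sup>2" by (intro tendsto_intros elim)
    then have lim: "(\<lambda>n. d + (e n)\<^sup>2) \<longlonglongrightarrow> d" by simp
    show "(\<lambda>n. lam \<nu> (a n) \<Omega>) \<longlonglongrightarrow> d"
      by (rule tendsto_sandwich[OF _ _ tendsto_const lim]) (use d[OF a(1)] a(2) in \<open>simp_all add: less_imp_le\<close>)
  qed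
  obtain \<Lambda> where \<Lambda>: "sets \<Lambda> = sets cG" "\<And>A. A \<in> sets cG \<Longrightarrow> emeasure \<Lambda> A = ennreal (L A / d)"
    "\<And>A. A \<in> sets cG \<Longrightarrow> measure \<Lambda> A = L A / d"
  proof (rule measure_of_uniform_limit[of cG "\<lambda>n A. lam \<nu> (a n) A / d" "\<lambda>A. L A / d" "\<lambda>n. 4 * e n / d"])
    show "lam \<nu> (a n) (A \<union> B) / d = lam \<nu> (a n) A / d + lam \<nu> (a n) B / d"
      if "A \<in> sets cG" "B \<in> sets cG" "A \<inter> B = {}" for n A B
      using lam_add[OF \<nu>(1) that] by (simp add: add_divide_distrib)
    show "0 \<le> lam \<nu> (a n) A / d" for n A using d0 lam_nonneg by simp
    show "\<bar>lam \<nu> (a n) A / d - L A / d\<bar> \<le> 4 * e n / d" if "A \<in> sets cG" for n A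
      using unif[OF that, of n] d0 by (simp add: diff_divide_distrib[symmetric] divide_right_mono)
    have "(\<lambda>n. 4 * e n / d) \<longlonglongrightarrow> 4 * 0 / d" using d0 by (intro tendsto_intros elim) auto
    then show "(\<lambda>n. 4 * e n / d) \<longlonglongrightarrow> 0" by simp
    fix n and A :: "nat \<Rightarrow> ('a \<Rightarrow> bool) set"
    assume A: "range A \<subseteq> sets cG" "decseq A" "(\<Inter>i. A i) = {}"
    have "(\<lambda>i. measure \<nu> (joined x y (A i))) \<longlonglongrightarrow> 0" for x y
    proof -
      have "(\<lambda>i. measure \<nu> (joined x y (A i))) \<longlonglongrightarrow> measure \<nu> (\<Inter>i. joined x y (A i))"
      proof (rule finite_Lim_measure_decseq)
        show "range (\<lambda>i. joined x y (A i)) \<subseteq> events"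
          using A joined_sets inv_probD(2)[OF \<nu>(1)] by auto
        show "decseq (\<lambda>i. joined x y (A i))" using A(2) by (auto simp: decseq_def joined_def)
      qed
      moreover have "(\<Inter>i. joined x y (A i)) = {}" using A(3) by (auto simp: joined_def)
      ultimately show ?thesis by simp
    qed
    then have "(\<lambda>i. lam \<nu> (a n) (A i) / d) \<longlonglongrightarrow>
        (\<Sum>x\<in>set_pmf (a n). \<Sum>y\<in>set_pmf (a n). pmf (a n) x * pmf (a n) y * 0) / d"
      unfolding lam_def quad_def using d0 by (intro tendsto_intros) auto
    then show "(\<lambda>i. lam \<nu> (a n) (A i) / d) \<longlonglongrightarrow> 0" by simp
  qed blast
  have sp: "space \<Lambda> = \<Omega>" using sets_eq_imp_space_eq[OF \<Lambda>(1)] by simp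
  have pr: "prob_space \<Lambda>" by (rule prob_spaceI) (use \<Lambda>(2)[OF Omega_sets] d0 Ld in \<open>simp add: sp\<close>)
  have inv: "inv_prob \<Lambda>"
    unfolding inv_prob_def using pr \<Lambda>(1) by (auto simp: \<Lambda>(3) tset_sets Ltr)
  interpret Lam: prob_space \<Lambda> by (rule pr)
  have cs: "\<Omega> - connset \<in> sets cG" using Omega_sets connset_sets by auto
  have "L (\<Omega> - connset) = 0"
    using LIMSEQ_unique[OF L[OF cs]] lam_outside_connset by simp
  then have "measure \<Lambda> (space \<Lambda> - connset) = 0" using \<Lambda>(3)[OF cs] sp by simp
  then have "measure \<Lambda> connset = 1"
    using Lam.prob_compl[of connset] connset_sets \<Lambda>(1) by simp
  moreover have "dens \<Lambda> \<one> \<le> dens \<nu> \<one>"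
  proof -
    let ?C = "cylG True {\<one>}"
    have C: "?C \<in> sets cG" by (intro cyl_sets) auto
    \<comment> \<open>Four units of \<open>e n\<close> pay for passing to the limit, one for the
      decorrelation. Invariance of \<open>L\<close> permits moving the identity to the good
      \<open>g\<close>, which depends on \<open>n\<close>.\<close>
    have "L ?C \<le> lam \<nu> (a n) \<Omega> * dens \<nu> \<one> + 5 * e n" for n
    proof -
      obtain g where g: "g \<in> carrier G" "lam \<nu> (a n) (tset g ?C) \<le> lam \<nu> (a n) \<Omega> * dens \<nu> \<one> + e n"
        using lam_density[OF \<nu> Kfin[OF a(1)] e0] by blast
      have "L ?C = L (tset g ?C)" using Ltr[OF g(1) C] by simp
      then show ?thesis using unif[OF tset_sets[OF g(1) C], of n] g(2) by linarith
    qed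
    moreover have "(\<lambda>n. lam \<nu> (a n) \<Omega> * dens \<nu> \<one> + 5 * e n) \<longlonglongrightarrow> d * dens \<nu> \<one> + 5 * 0"
      using L[OF Omega_sets] Ld by (intro tendsto_intros elim) auto
    ultimately have "L ?C \<le> d * dens \<nu> \<one> + 5 * 0" by (intro LIMSEQ_le_const[where X = "\<lambda>n. lam \<nu> (a n) \<Omega> * dens \<nu> \<one> + 5 * e n"]) auto
    then have "L ?C / d \<le> dens \<nu> \<one>" using d0 by (simp add: pos_divide_le_eq mult.commute)
    then show ?thesis using \<Lambda>(3)[OF C] by (simp add: dens_def[of \<Lambda>])
  qed
  ultimately show ?thesis using inv that by blast
qed

text \<open>Cauchy-Schwarz for \<open>W\<close>, the \<open>c\<close>-mass of the cluster of
  \<open>u\<close>: its mean is at least \<delta>, and two vertices both connected to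
  \<open>u\<close> are connected to each other, so the second moment is at most the form.\<close>

lemma connection_square_le_lam:
  assumes \<nu>: "inv_prob \<nu>" and c: "c \<in> finpmf" and \<delta>: "\<delta> \<ge> 0"
    and big: "\<delta> \<le> expect c (\<lambda>z. measure \<nu> (together u z))"
  shows "\<delta>\<^sup>2 \<le> lam \<nu> c \<Omega>"
proof -
  interpret prob_space \<nu> by (rule inv_probD(1)[OF \<nu>])
  let ?T = "set_pmf c"
  define X where "X = (\<lambda>z. together u z)"
  have T: "finite ?T" using c by (simp add: finpmfD)
  have X: "X z \<in> events" for z using conn_sets inv_probD(2)[OF \<nu>] by (simp add: X_def)
  have XO: "X z \<inter> space \<nu> = X z" "X z \<inter> X z' \<inter> space \<nu> = X z \<inter> X z'" for z z'
    by (auto simp: inv_probD(3)[OF \<nu>] X_def)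
  have XX: "X z \<inter> X z' \<in> events" for z z' by (intro sets.Int X)
  have ii: "integrable \<nu> (indicator Y :: _ \<Rightarrow> real)" if "Y \<in> events" for Y
    using that by (intro integrable_real_indicator) (auto simp: emeasure_eq_measure)
  define W where "W = (\<lambda>\<omega>. \<Sum>z\<in>?T. pmf c z * indicator (X z) \<omega>)"
  have Wi: "integrable \<nu> W" unfolding W_def
    by (intro Bochner_Integration.integrable_sum integrable_mult_right ii X)
  have W1: "(\<integral>\<omega>. W \<omega> \<partial>\<nu>) = expect c (\<lambda>z. measure \<nu> (X z))"
    unfolding W_def expect_sum_pmf[OF T order_refl]
    by (simp add: Bochner_Integration.integral_sum ii X XO del: sum_mult_indicator sum_indicator_mult)
  have W2eq: "(W \<omega>)\<^sup>2 = (\<Sum>z\<in>?T. \<Sum>z'\<in>?T. pmf c z * pmf c z' * indicator (X z \<inter> X z') \<omega>)" for \<omega>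
    by (simp add: W_def power2_eq_square sum_product indicator_inter_arith mult_ac
        del: sum_mult_indicator sum_indicator_mult)
  have W2i: "integrable \<nu> (\<lambda>\<omega>. (W \<omega>)\<^sup>2)" unfolding W2eq
    by (intro Bochner_Integration.integrable_sum integrable_mult_right ii sets.Int X)
  have "(\<integral>\<omega>. (W \<omega>)\<^sup>2 \<partial>\<nu>) = (\<Sum>z\<in>?T. \<Sum>z'\<in>?T. pmf c z * pmf c z' * measure \<nu> (X z \<inter> X z'))"
    unfolding W2eq
    by (simp add: Bochner_Integration.integral_sum Bochner_Integration.integrable_sum ii XX XO
        del: sum_mult_indicator sum_indicator_mult)
  also have "\<dots> \<le> lam \<nu> c \<Omega>" unfolding lam_def quad_def
  proof (intro sum_mono mult_left_mono finite_measure_mono)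
    fix z z'
    show "X z \<inter> X z' \<subseteq> joined z z' \<Omega>"
      by (auto simp: joined_def X_def intro: conn_trans[OF conn_sym])
    show "joined z z' \<Omega> \<in> events"
      using joined_sets[of \<Omega>] sets.top[of cG] inv_probD(2)[OF \<nu>] by simp
  qed simp
  finally have 1: "(\<integral>\<omega>. (W \<omega>)\<^sup>2 \<partial>\<nu>) \<le> lam \<nu> c \<Omega>" .
  \<comment> \<open>Expanding this square gives the second-moment bound without a separate variance
    inequality.\<close>
  have "0 \<le> (\<integral>\<omega>. (W \<omega> - \<delta>)\<^sup>2 \<partial>\<nu>)" by simp
  also have "\<dots> = (\<integral>\<omega>. (W \<omega>)\<^sup>2 - 2 * \<delta> * W \<omega> + \<delta>\<^sup>2 \<partial>\<nu>)"
    by (intro Bochner_Integration.integral_cong refl) (simp add: power2_diff mult_ac)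
  also have "\<dots> = (\<integral>\<omega>. (W \<omega>)\<^sup>2 \<partial>\<nu>) - 2 * \<delta> * (\<integral>\<omega>. W \<omega> \<partial>\<nu>) + \<delta>\<^sup>2"
    using W2i Wi prob_space by simp
  also have "\<dots> \<le> lam \<nu> c \<Omega> - 2 * \<delta> * \<delta> + \<delta>\<^sup>2"
    using 1 big \<delta> by (intro add_mono diff_mono mult_left_mono) (auto simp: W1 X_def)
  finally show ?thesis by (simp add: power2_eq_square)
qed

text \<open>The vertex \<open>h\<close> supplied by the failure of \<open>null\<close> depends on
  \<open>a\<close>. Invariance of \<nu> moves it to the base point \<open>inv h \<otimes> x\<close>,
  which the bound \<delta>^2 does not see, so the bound holds on the whole family.\<close>

lemma kazhdan_sparse_connset:
  assumes T: "kazhdan_property_T G" and p: "0 < p" "p < 1"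
  obtains \<Lambda> where "inv_prob \<Lambda>" "measure \<Lambda> connset = 1" "dens \<Lambda> \<one> \<le> 2 * p"
proof -
  obtain \<nu> x y where \<nu>: "inv_prob \<nu>" "wmix \<nu>" and dens: "\<And>z. z \<in> carrier G \<Longrightarrow> dens \<nu> z \<le> 2 * p"
    and xy: "x \<in> carrier G" "y \<in> carrier G"
    and nn: "\<not> null (\<lambda>g. measure \<nu> (together x (g \<otimes> y)))"
    using kazhdan_imp_long_connections[OF T p] by blast
  obtain k \<delta> where k: "k \<in> finpmf" and \<delta>: "\<delta> > 0"
    and big: "\<And>a. a \<in> finpmf \<Longrightarrow> \<exists>h\<in>carrier G.
      expect (conv a k) (\<lambda>z. measure \<nu> (together x (h \<otimes> z \<otimes> y))) > \<delta>"
    using nn unfolding null_def by (auto simp: not_le)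
  \<comment> \<open>The right factor \<open>y\<close> is absorbed into the smearing measure, so that
    the family has the form \<open>conv a k'\<close>.\<close>
  define k' where "k' = map_pmf (\<lambda>l. l \<otimes> y) k"
  have k': "k' \<in> finpmf" unfolding k'_def using k xy by (intro finpmf_map) auto
  have low: "\<delta>\<^sup>2 \<le> lam \<nu> c \<Omega>" if c: "c \<in> {conv a k' | a. a \<in> finpmf}" for c
  proof -
    obtain a where a: "a \<in> finpmf" "c = conv a k'" using c by blast
    obtain h where h: "h \<in> carrier G"
      "expect (conv a k) (\<lambda>z. measure \<nu> (together x (h \<otimes> z \<otimes> y))) > \<delta>" using big[OF a(1)] by blast
    have tr: "measure \<nu> (together (inv h \<otimes> x) z) = measure \<nu> (together x (h \<otimes> z))"
      if z: "z \<in> carrier G" for z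
    proof -
      have "tset h (together (inv h \<otimes> x) z) = together x (h \<otimes> z)"
        using h xy z by (auto simp: tset_def conn_tr m_assoc[symmetric])
      then show ?thesis using inv_probD(4)[OF \<nu>(1) h(1) conn_sets, of "inv h \<otimes> x" z] by simp
    qed
    have "expect (conv a k) (\<lambda>z. measure \<nu> (together x (h \<otimes> z \<otimes> y))) =
        expect a (\<lambda>g. expect k (\<lambda>l. measure \<nu> (together x (h \<otimes> (g \<otimes> l) \<otimes> y))))"
      by (rule expect_conv[OF a(1) k])
    also have "\<dots> = expect a (\<lambda>g. expect k (\<lambda>l. measure \<nu> (together (inv h \<otimes> x) (g \<otimes> (l \<otimes> y)))))"
      using h xy by (intro expect_cong[OF a(1)] expect_cong[OF k]) (simp add: tr m_assoc)
    also have "\<dots> = expect c (\<lambda>z. measure \<nu> (together (inv h \<otimes> x) z))"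
      unfolding a(2) expect_conv[OF a(1) k'] by (simp add: k'_def)
    finally have "\<delta> \<le> expect c (\<lambda>z. measure \<nu> (together (inv h \<otimes> x) z))" using h(2) by simp
    then show ?thesis using \<delta> a k' by (intro connection_square_le_lam[OF \<nu>(1)]) auto
  qed
  have "\<delta>\<^sup>2 > 0" using \<delta> by simp
  then obtain \<Lambda> where "inv_prob \<Lambda>" "measure \<Lambda> connset = 1" and \<Lambda>: "dens \<Lambda> \<one> \<le> dens \<nu> \<one>"
    using exists_random_connset[OF \<nu> closed_family_conv[OF k'] _ low] by blast
  then show ?thesis using that order_trans[OF \<Lambda> dens[OF one_closed]] by blast
qed

section \<open>Attaching all vertices to the random connected set\<close>


text \<open>On group elements, the ball of radius \<open>n\<close> around \<open>W\<close> in the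
  Cayley graph.\<close>

primrec lvl :: "('a \<Rightarrow> bool) \<Rightarrow> nat \<Rightarrow> 'a \<Rightarrow> bool" where
  "lvl W 0 x = W x"
| "lvl W (Suc n) x = (lvl W n x \<or> (\<exists>s\<in>S. lvl W n (x \<otimes> s)))"

text \<open>One ordering of the generators, the same at every vertex, breaks ties between possible
  parents equivariantly.\<close>

definition gens :: "'a list" where
  "gens = (SOME ss. set ss = S)"

lemma set_gens: "set gens = S"
  unfolding gens_def using finite_list[OF S_fin] by (rule someI_ex)

lemma gens_carrier [simp]: "j < length gens \<Longrightarrow> gens ! j \<in> carrier G"
  using set_gens S_sub nth_mem by blast

text \<open>\<open>par W x j\<close>: the vertex \<open>x\<close> lies outside \<open>W\<close>, and \<open>j\<close> is the first index for which
  \<open>x \<otimes> gens ! j\<close> is closer to \<open>W\<close> than \<open>x\<close>.\<close>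

definition par :: "('a \<Rightarrow> bool) \<Rightarrow> 'a \<Rightarrow> nat \<Rightarrow> bool" where
  "par W x j \<longleftrightarrow> j < length gens \<and>
     (\<exists>n. \<not> lvl W n x \<and> lvl W n (x \<otimes> gens ! j) \<and> (\<forall>i. i < j \<longrightarrow> \<not> lvl W n (x \<otimes> gens ! i)))"

definition edge :: "('a \<Rightarrow> bool) \<Rightarrow> 'a \<Rightarrow> 'a \<Rightarrow> bool" where
  "edge W a b \<longleftrightarrow> cayley_adj G S a b \<and>
     (W a \<and> W b \<or> (\<exists>j. par W a j \<and> b = a \<otimes> gens ! j) \<or> (\<exists>j. par W b j \<and> a = b \<otimes> gens ! j))"

definition graph :: "('a \<Rightarrow> bool) \<Rightarrow> ('a \<times> 'a \<Rightarrow> bool)" where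
  "graph W = (\<lambda>z\<in>carrier G \<times> carrier G. edge W (fst z) (snd z))"

abbreviation "cE \<equiv> cfg (carrier G \<times> carrier G)"

lemma countable_edges: "countable (carrier G \<times> carrier G)"
  using countable_carrier by simp

lemma lvl_mono: "lvl W m x \<Longrightarrow> m \<le> n \<Longrightarrow> lvl W n x"
  by (induction n) (auto simp: le_Suc_eq)

text \<open>The witness \<open>n\<close> in \<open>par\<close> is forced, since \<open>Suc n\<close>
  is the distance from \<open>x\<close> to \<open>W\<close>; for this \<open>n\<close> the index is
  the least possible one.\<close>

lemma par_unique:
  assumes "par W x i" "par W x j" shows "i = j"
proof -
  obtain m where m: "i < length gens" "\<not> lvl W m x" "lvl W m (x \<otimes> gens ! i)" "\<And>k. k < i \<Longrightarrow> \<not> lvl W m (x \<otimes> gens ! k)"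
    using assms(1) by (auto simp: par_def)
  obtain n where n: "j < length gens" "\<not> lvl W n x" "lvl W n (x \<otimes> gens ! j)" "\<And>k. k < j \<Longrightarrow> \<not> lvl W n (x \<otimes> gens ! k)"
    using assms(2) by (auto simp: par_def)
  have "lvl W (Suc m) x" "lvl W (Suc n) x" using m n set_gens nth_mem by (auto intro!: bexI)
  then have "m = n" using m(2) n(2) lvl_mono by (metis linorder_neqE_nat Suc_leI)
  then show "i = j" using m n by (metis linorder_neqE_nat)
qed

lemma par_exists:
  assumes "lvl W (Suc n) x" "\<not> lvl W n x"
  obtains j where "par W x j" "lvl W n (x \<otimes> gens ! j)"
proof -
  obtain s where "s \<in> S" "lvl W n (x \<otimes> s)" using assms by auto
  then have ex: "\<exists>j. j < length gens \<and> lvl W n (x \<otimes> gens ! j)" by (metis in_set_conv_nth set_gens)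
  define j where "j = (LEAST j. j < length gens \<and> lvl W n (x \<otimes> gens ! j))"
  have j: "j < length gens" "lvl W n (x \<otimes> gens ! j)" using LeastI_ex[OF ex] by (auto simp: j_def)
  have "\<not> lvl W n (x \<otimes> gens ! i)" if "i < j" for i
    using not_less_Least[of i "\<lambda>j. j < length gens \<and> lvl W n (x \<otimes> gens ! j)"] that j(1)
    unfolding j_def[symmetric] by simp
  then have "par W x j" using j assms(2) by (auto simp: par_def)
  then show ?thesis using j(2) that by blast
qed

lemma par_adj:
  assumes "par W x j" "x \<in> carrier G" shows "cayley_adj G S x (x \<otimes> gens ! j)"
proof -
  \<comment> \<open>A trivial generator is excluded because the parent lies in a smaller ball than
    \<open>x\<close>.\<close>
  have j: "j < length gens" and ne: "x \<noteq> x \<otimes> gens ! j" using assms(1) unfolding par_def by metis+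
  then have "gens ! j \<in> S" using set_gens nth_mem by blast
  then show ?thesis using j ne assms(2) by (simp add: cayley_adj_def m_assoc[symmetric])
qed

lemma lvl_tr: "g \<in> carrier G \<Longrightarrow> x \<in> carrier G \<Longrightarrow> lvl (tr g W) n x \<longleftrightarrow> lvl W n (g \<otimes> x)"
proof (induction n arbitrary: x)
  case (Suc n)
  have "lvl (tr g W) n (x \<otimes> s) \<longleftrightarrow> lvl W n (g \<otimes> x \<otimes> s)" if "s \<in> S" for s
    using Suc that S_sub by (auto simp: m_assoc subset_iff)
  then show ?case using Suc by simp
qed simp

lemma par_tr:
  assumes "g \<in> carrier G" "x \<in> carrier G"
  shows "par (tr g W) x j \<longleftrightarrow> par W (g \<otimes> x) j"
proof -
  have "lvl (tr g W) n (x \<otimes> gens ! i) \<longleftrightarrow> lvl W n (g \<otimes> x \<otimes> gens ! i)" if "i < length gens" for n i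
    using that assms by (simp add: lvl_tr m_assoc)
  then show ?thesis using assms by (auto simp: par_def lvl_tr intro: less_trans)
qed

lemma edge_tr:
  assumes "g \<in> carrier G" "a \<in> carrier G" "b \<in> carrier G"
  shows "edge (tr g W) a b \<longleftrightarrow> edge W (g \<otimes> a) (g \<otimes> b)"
proof -
  have eq: "y = x \<otimes> gens ! j \<longleftrightarrow> g \<otimes> y = g \<otimes> x \<otimes> gens ! j"
    if "par W (g \<otimes> x) j" "x \<in> carrier G" "y \<in> carrier G" for x y j
  proof -
    have "j < length gens" using that by (simp add: par_def)
    then show ?thesis using that assms by (simp add: m_assoc)
  qed
  have "(\<exists>j. par W (g \<otimes> a) j \<and> b = a \<otimes> gens ! j) \<longleftrightarrow> (\<exists>j. par W (g \<otimes> a) j \<and> g \<otimes> b = g \<otimes> a \<otimes> gens ! j)"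
    "(\<exists>j. par W (g \<otimes> b) j \<and> a = b \<otimes> gens ! j) \<longleftrightarrow> (\<exists>j. par W (g \<otimes> b) j \<and> g \<otimes> a = g \<otimes> b \<otimes> gens ! j)"
    using eq assms by blast+
  then show ?thesis using assms by (simp add: edge_def par_tr cayley_adj_mult)
qed

lemma pred_lvl: "x \<in> carrier G \<Longrightarrow> Measurable.pred cG (\<lambda>W. lvl W n x)"
proof (induction n arbitrary: x)
  case 0
  then show ?case using pred_cfg by simp
next
  case (Suc n)
  have "Measurable.pred cG (\<lambda>W. lvl W n x \<or> (\<exists>s\<in>S. lvl W n (x \<otimes> s)))"
    using Suc.prems S_sub by (intro pred_intros_logic(5) pred_Bex_countable countable_finite[OF S_fin] Suc.IH) auto
  then show ?case by simp
qed

lemma pred_par: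
  assumes "x \<in> carrier G" shows "Measurable.pred cG (\<lambda>W. par W x j)"
proof (cases "j < length gens")
  case True
  have "Measurable.pred cG (\<lambda>W. \<exists>n. \<not> lvl W n x \<and> lvl W n (x \<otimes> gens ! j) \<and> (\<forall>i\<in>{..<j}. \<not> lvl W n (x \<otimes> gens ! i)))"
    using True assms
    by (intro pred_intros_countable(2) pred_intros_logic(3) pred_Ball_countable
          pred_lvl pred_intros_logic(2)) (auto intro: countable_finite)
  then show ?thesis using True by (simp add: par_def Ball_def)
qed (simp add: par_def)

lemma graph_measurable: "graph \<in> measurable cG cE"
  unfolding graph_def[abs_def]
proof (rule measurable_cfg)
  fix z assume "z \<in> carrier G \<times> carrier G"
  then obtain a b where z: "z = (a, b)" "a \<in> carrier G" "b \<in> carrier G" by auto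
  have "Measurable.pred cG (\<lambda>W. edge W a b)"
    unfolding edge_def using z
    by (intro pred_intros_logic(3,5) pred_intros_countable(2) pred_cfg pred_par measurable_const) auto
  then show "Measurable.pred cG (\<lambda>W. edge W (fst z) (snd z))" by (simp add: z)
qed

lemma graph_measurable_inv_prob: "inv_prob \<Lambda> \<Longrightarrow> graph \<in> measurable \<Lambda> cE"
  using graph_measurable measurable_cong_sets[OF inv_probD(2) refl] by blast

lemma edge_sym: "edge W a b \<Longrightarrow> edge W b a"
  by (auto simp: edge_def intro: cayley_adj_sym)

text \<open>Every vertex has finite distance to the non-empty set \<open>W\<close>; parent edges
  decrease that distance until \<open>W\<close> is reached, and inside \<open>W\<close> all Cayley
  edges are kept.\<close>

lemma graph_connected:
  assumes W: "W \<in> connset" shows "graph W \<in> connected_spanning_subgraphs G S"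
proof -
  let ?R = "{(u, v). u \<in> carrier G \<and> v \<in> carrier G \<and> graph W (u, v)}"
  have R: "?R = {(u, v). edge W u v}" by (auto simp: graph_def edge_def dest: cayley_adj_carrier)
  have symR: "sym (?R\<^sup>*)" unfolding R by (rule sym_rtrancl) (auto simp: sym_def intro: edge_sym)
  obtain w where w: "w \<in> carrier G" "W w" using W by (auto simp: connset_def)
  \<comment> \<open>Finite distance to \<open>W\<close> propagates along words in the generators;
    starting from a point of \<open>W\<close> this reaches the whole group.\<close>
  have ex: "\<forall>x\<in>carrier G. (\<exists>n. lvl W n x) \<longrightarrow> (\<exists>n. lvl W n (x \<otimes> h))" if "h \<in> generate G S" for h
    using that
  proof (induction rule: generate.induct)
    case one
    then show ?case by simp
  next
    case (incl s)
    show ?case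
    proof (intro ballI impI)
      fix x assume x: "x \<in> carrier G" "\<exists>n. lvl W n x"
      then obtain n where "lvl W n x" by blast
      moreover have "x \<otimes> s \<otimes> inv s = x" using x incl S_sub by (auto simp: m_assoc)
      ultimately have "lvl W n (x \<otimes> s \<otimes> inv s)" by simp
      then have "lvl W (Suc n) (x \<otimes> s)" using S_inv[OF incl] by auto
      then show "\<exists>n. lvl W n (x \<otimes> s)" by blast
    qed
  next
    case (inv s)
    show ?case
    proof (intro ballI impI)
      fix x assume x: "x \<in> carrier G" "\<exists>n. lvl W n x"
      then obtain n where "lvl W n x" by blast
      moreover have "x \<otimes> inv s \<otimes> s = x" using x inv S_sub by (auto simp: m_assoc)
      ultimately have "lvl W n (x \<otimes> inv s \<otimes> s)" by simp
      then have "lvl W (Suc n) (x \<otimes> inv s)" using inv by auto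
      then show "\<exists>n. lvl W n (x \<otimes> inv s)" by blast
    qed
  next
    case (eng h1 h2)
    then have h: "h1 \<in> carrier G" "h2 \<in> carrier G" using S_gen by auto
    show ?case using eng h by (auto simp: m_assoc[symmetric])
  qed
  have level: "\<exists>n. lvl W n x" if x: "x \<in> carrier G" for x
  proof -
    have "inv w \<otimes> x \<in> generate G S" using w x S_gen by simp
    moreover have "lvl W 0 w" using w by simp
    ultimately have "\<exists>n. lvl W n (w \<otimes> (inv w \<otimes> x))" using ex w(1) by blast
    then show ?thesis using w x by (simp add: m_assoc[symmetric])
  qed
  have toW: "\<exists>v\<in>carrier G. W v \<and> (x, v) \<in> ?R\<^sup>*" if "lvl W n x" "x \<in> carrier G" for n x
    using that
  proof (induction n arbitrary: x)
    case 0
    then show ?case by auto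
  next
    case (Suc n)
    show ?case
    proof (cases "lvl W n x")
      case False
      then obtain j where j: "par W x j" "lvl W n (x \<otimes> gens ! j)" using par_exists Suc.prems by blast
      have xj: "x \<otimes> gens ! j \<in> carrier G" using j(1) Suc.prems by (simp add: par_def)
      have "edge W x (x \<otimes> gens ! j)" using j(1) par_adj[OF j(1) Suc.prems(2)] by (auto simp: edge_def)
      then have "(x, x \<otimes> gens ! j) \<in> ?R" unfolding R by simp
      moreover obtain v where "v \<in> carrier G" "W v" "(x \<otimes> gens ! j, v) \<in> ?R\<^sup>*" using Suc.IH[OF j(2) xj] by blast
      ultimately show ?thesis by (meson converse_rtrancl_into_rtrancl)
    qed (use Suc in blast)
  qed
  have inW: "(u, v) \<in> ?R\<^sup>*" if "u \<in> carrier G" "v \<in> carrier G" "W u" "W v" for u v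
  proof -
    have "(u, v) \<in> (crel W)\<^sup>*" using W that by (auto simp: connset_def conn_def)
    moreover have "crel W \<subseteq> ?R" unfolding R by (auto simp: crel_def edge_def)
    ultimately show ?thesis using rtrancl_mono by blast
  qed
  have "(a, b) \<in> ?R\<^sup>*" if ab: "a \<in> carrier G" "b \<in> carrier G" for a b
  proof -
    obtain u where u: "u \<in> carrier G" "W u" "(a, u) \<in> ?R\<^sup>*" using level[OF ab(1)] toW ab(1) by blast
    obtain v where v: "v \<in> carrier G" "W v" "(b, v) \<in> ?R\<^sup>*" using level[OF ab(2)] toW ab(2) by blast
    have "(u, v) \<in> ?R\<^sup>*" using u v inW by blast
    moreover have "(v, b) \<in> ?R\<^sup>*" using symD[OF symR v(3)] .
    ultimately show ?thesis using u(3) by (meson rtrancl_trans)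
  qed
  then show ?thesis
    unfolding connected_spanning_subgraphs_def
    by (auto simp: graph_def intro: edge_sym) (auto simp: edge_def)
qed

section \<open>Measurability and expectation of the degree\<close>

lemma css_sets: "connected_spanning_subgraphs G S \<in> sets cE"
proof -
  have R: "Measurable.pred cE (\<lambda>\<omega>. (a, b) \<in> {(u, v). u \<in> carrier G \<and> v \<in> carrier G \<and> \<omega> (u, v)}\<^sup>*)" for a b
    by (rule pred_rtrancl[OF countable_carrier]) (auto intro: pred_cfg)
  have eq: "connected_spanning_subgraphs G S = {\<omega> \<in> space cE.
      (\<forall>a\<in>carrier G. \<forall>b\<in>carrier G. \<omega> (a, b) = \<omega> (b, a)) \<and>
      (\<forall>a\<in>carrier G. \<forall>b\<in>carrier G. \<omega> (a, b) \<longrightarrow> cayley_adj G S a b) \<and>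
      (\<forall>a\<in>carrier G. \<forall>b\<in>carrier G. (a, b) \<in> {(u, v). u \<in> carrier G \<and> v \<in> carrier G \<and> \<omega> (u, v)}\<^sup>*)}"
    by (simp add: connected_spanning_subgraphs_def)
  show ?thesis unfolding eq
    by (intro pred_sets pred_intros_logic(3) pred_Ball_countable countable_carrier pred_intros_logic(6)
        pred_intros_logic(4) pred_cfg measurable_const R) auto
qed

text \<open>On the full configuration space a neighbourhood may be infinite, and \<open>card\<close>
  then returns 0. Positive values are therefore described by finite neighbourhoods, and the value 0
  as the complement of the finite non-empty ones.\<close>

lemma degree_measurable: "(\<lambda>\<omega>. real (subgraph_degree G \<omega> \<one>)) \<in> borel_measurable cE"
proof -
  let ?N = "\<lambda>\<omega>. {b \<in> carrier G. \<omega> (\<one>, b)}"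
  let ?\<F> = "{F. finite F \<and> F \<subseteq> carrier G}"
  have c: "countable {F \<in> ?\<F>. P F}" for P
    by (rule countable_subset[OF _ countable_Collect_finite_subset[OF countable_carrier]]) auto
  have eq: "Measurable.pred cE (\<lambda>\<omega>. ?N \<omega> = F)" if "F \<in> ?\<F>" for F
  proof -
    have "?N \<omega> = F \<longleftrightarrow> (\<forall>b\<in>carrier G. \<omega> (\<one>, b) = (b \<in> F))" for \<omega> using that by auto
    moreover have "Measurable.pred cE (\<lambda>\<omega>. \<forall>b\<in>carrier G. \<omega> (\<one>, b) = (b \<in> F))"
      by (intro pred_Ball_countable countable_carrier pred_intros_logic(6) pred_cfg measurable_const) auto
    ultimately show ?thesis by simp
  qed
  have m: "Measurable.pred cE (\<lambda>\<omega>. \<exists>F\<in>{F \<in> ?\<F>. P F}. ?N \<omega> = F)" for P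
    by (intro pred_Bex_countable c eq) simp
  have "Measurable.pred cE (\<lambda>\<omega>. subgraph_degree G \<omega> \<one> = n)" for n
  proof (cases "n = 0")
    case True
    have "subgraph_degree G \<omega> \<one> = n \<longleftrightarrow> \<not> (\<exists>F\<in>{F \<in> ?\<F>. F \<noteq> {}}. ?N \<omega> = F)" for \<omega>
      using True by (auto simp: subgraph_degree_def card_eq_0_iff)
    then show ?thesis using pred_intros_logic(2)[OF m[of "\<lambda>F. F \<noteq> {}"]] by presburger
  next
    case False
    have "subgraph_degree G \<omega> \<one> = n \<longleftrightarrow> (\<exists>F\<in>{F \<in> ?\<F>. card F = n}. ?N \<omega> = F)" for \<omega>
      using False by (auto simp: subgraph_degree_def intro: card_ge_0_finite)
    then show ?thesis using m[of "\<lambda>F. card F = n"] by presburger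
  qed
  then have "(\<lambda>\<omega>. subgraph_degree G \<omega> \<one>) \<in> measurable cE (count_space UNIV)"
    by (subst measurable_count_space_eq2_countable)
      (auto simp: pred_def vimage_def Int_def conj_commute)
  then show ?thesis by (rule measurable_compose) simp
qed

abbreviation "deg W \<equiv> subgraph_degree G (graph W) \<one>"

lemma graph_degree_le_card: "deg W \<le> card S"
  unfolding subgraph_degree_def
proof (rule card_mono[OF S_fin])
  show "{b \<in> carrier G. graph W (\<one>, b)} \<subseteq> S"
    by (auto simp: graph_def edge_def cayley_adj_def)
qed

text \<open>Edges at the identity are of three kinds: inside \<open>W\<close>, to its own parent, or
  from a child. A child choosing the generator with index \<open>j\<close> can only be
  \<open>inv (gens ! j)\<close>.\<close>

lemma graph_degree_bound:
  "real (deg W) \<le> real (card S) * of_bool (W \<one>) +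
     ((\<Sum>j<length gens. of_bool (par W \<one> j)) + (\<Sum>j<length gens. of_bool (par W (inv (gens ! j)) j)))"
proof -
  let ?k = "length gens"
  define A where "A = (if W \<one> then S else {})"
  define B where "B = (\<lambda>j. gens ! j) ` {j\<in>{..<?k}. par W \<one> j}"
  define C where "C = (\<lambda>j. inv (gens ! j)) ` {j\<in>{..<?k}. par W (inv (gens ! j)) j}"
  have "{b \<in> carrier G. graph W (\<one>, b)} \<subseteq> A \<union> (B \<union> C)"
  proof
    fix b assume "b \<in> {b \<in> carrier G. graph W (\<one>, b)}"
    then have b: "b \<in> carrier G" and e: "edge W \<one> b" by (auto simp: graph_def)
    then have bS: "b \<in> S" by (auto simp: edge_def cayley_adj_def)
    from e consider "W \<one>" | j where "par W \<one> j" "b = \<one> \<otimes> gens ! j" | j where "par W b j" "\<one> = b \<otimes> gens ! j"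
      unfolding edge_def by blast
    then show "b \<in> A \<union> (B \<union> C)"
    proof cases
      case 1
      then show ?thesis using bS by (simp add: A_def)
    next
      case 2
      then show ?thesis by (auto simp: B_def par_def)
    next
      case 3
      then have j: "j < ?k" by (simp add: par_def)
      then have "b = inv (gens ! j)" using 3(2) b by (intro inv_equality[symmetric]) auto
      then show ?thesis using 3(1) j by (auto simp: C_def)
    qed
  qed
  then have "deg W \<le> card (A \<union> (B \<union> C))"
    unfolding subgraph_degree_def using S_fin by (intro card_mono) (auto simp: A_def B_def C_def)
  also have "\<dots> \<le> card A + (card B + card C)"
    by (intro order_trans[OF card_Un_le] add_mono card_Un_le order_refl)
  also have "\<dots> \<le> card S * of_bool (W \<one>) + (card {j\<in>{..<?k}. par W \<one> j} + card {j\<in>{..<?k}. par W (inv (gens ! j)) j})"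
    unfolding B_def C_def by (intro add_mono card_image_le) (auto simp: A_def)
  finally have "real (deg W) \<le> real (card S * of_bool (W \<one>) +
      (card {j\<in>{..<?k}. par W \<one> j} + card {j\<in>{..<?k}. par W (inv (gens ! j)) j}))"
    by (rule of_nat_mono)
  moreover have "(\<Sum>j<?k. of_bool (P j)) = real (card {j\<in>{..<?k}. P j})" for P
    by (simp add: sum_of_bool_eq Int_def)
  ultimately show ?thesis by simp
qed

lemma par_sets: "x \<in> carrier G \<Longrightarrow> {W\<in>\<Omega>. par W x j} \<in> sets cG"
  using pred_sets[OF pred_par] by simp

text \<open>Mass transport: every vertex sends mass 1 to its parent, if it has one, so the expected
  mass received equals the expected mass sent and both are at most 1.\<close>

lemma expected_degree_bound:
  assumes \<Lambda>: "inv_prob \<Lambda>"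
  shows "integrable \<Lambda> (\<lambda>W. real (deg W))"
    and "(\<integral>W. real (deg W) \<partial>\<Lambda>) \<le> 2 + real (card S) * dens \<Lambda> \<one>"
proof -
  interpret prob_space \<Lambda> by (rule inv_probD(1)[OF \<Lambda>])
  let ?k = "length gens"
  define P where "P = (\<lambda>x j. {W\<in>\<Omega>. par W x j})"
  define C where "C = cylG True {\<one>}"
  have sp: "space \<Lambda> = \<Omega>" by (rule inv_probD(3)[OF \<Lambda>])
  have Pm: "P x j \<in> events" if "x \<in> carrier G" for x j
    using par_sets[OF that] inv_probD(2)[OF \<Lambda>] by (simp add: P_def)
  have Cm: "C \<in> events" unfolding C_def using inv_probD(2)[OF \<Lambda>] by (simp add: cyl_sets)
  have int: "integrable \<Lambda> (indicator A :: _ \<Rightarrow> real)" if "A \<in> events" for A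
    using that by (intro integrable_real_indicator) (auto simp: emeasure_eq_measure)
  have sub: "A \<inter> space \<Lambda> = A" if "A \<in> events" for A
    using sets.sets_into_space[OF that] by blast
  have gm: "graph \<in> measurable \<Lambda> cE"
    by (rule graph_measurable_inv_prob[OF \<Lambda>])
  show i: "integrable \<Lambda> (\<lambda>W. real (deg W))"
    by (rule integrable_const_bound[of _ "real (card S)"])
      (use graph_degree_le_card in \<open>auto intro!: measurable_compose[OF gm degree_measurable]\<close>)
  let ?b = "\<lambda>W. real (card S) * indicator C W +
     ((\<Sum>j<?k. indicator (P \<one> j) W) + (\<Sum>j<?k. indicator (P (inv (gens ! j)) j) W)) :: real"
  have "(\<integral>W. real (deg W) \<partial>\<Lambda>) \<le> (\<integral>W. ?b W \<partial>\<Lambda>)"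
  proof (rule integral_mono[OF i])
    show "integrable \<Lambda> ?b"
      by (intro Bochner_Integration.integrable_add Bochner_Integration.integrable_sum
          integrable_mult_right int Cm Pm) auto
    fix W assume W: "W \<in> space \<Lambda>"
    have "of_bool (W \<one>) = (indicator C W :: real)" using W by (auto simp: C_def cyl_def sp indicator_def)
    moreover have "of_bool (par W x j) = (indicator (P x j) W :: real)" for x j
      using W by (auto simp: P_def sp indicator_def)
    ultimately show "real (deg W) \<le> ?b W"
      using graph_degree_bound[of W] by simp
  qed
  also have "\<dots> = real (card S) * prob C +
      ((\<Sum>j<?k. prob (P \<one> j)) + (\<Sum>j<?k. prob (P (inv (gens ! j)) j)))"
  proof -
    have sumi: "integrable \<Lambda> (\<lambda>W. \<Sum>j<?k. indicator (P (x j) j) W :: real)"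
      and sum: "(\<integral>W. (\<Sum>j<?k. indicator (P (x j) j) W) \<partial>\<Lambda>) = (\<Sum>j<?k. prob (P (x j) j))"
      if "\<And>j. j < ?k \<Longrightarrow> x j \<in> carrier G" for x
    proof -
      have e: "P (x j) j \<in> events" if "j \<in> {..<?k}" for j using that \<open>\<And>j. j < ?k \<Longrightarrow> x j \<in> carrier G\<close> Pm by simp
      show "integrable \<Lambda> (\<lambda>W. \<Sum>j<?k. indicator (P (x j) j) W :: real)"
        by (intro Bochner_Integration.integrable_sum int e)
      show "(\<integral>W. (\<Sum>j<?k. indicator (P (x j) j) W) \<partial>\<Lambda>) = (\<Sum>j<?k. prob (P (x j) j))"
        by (subst Bochner_Integration.integral_sum) (simp_all add: int e sub)
    qed
    have 1: "\<And>j. j < ?k \<Longrightarrow> \<one> \<in> carrier G" "\<And>j. j < ?k \<Longrightarrow> inv (gens ! j) \<in> carrier G" by simp_all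
    have "(\<integral>W. ?b W \<partial>\<Lambda>) = (\<integral>W. real (card S) * indicator C W \<partial>\<Lambda>) +
        (\<integral>W. (\<Sum>j<?k. indicator (P \<one> j) W) + (\<Sum>j<?k. indicator (P (inv (gens ! j)) j) W) \<partial>\<Lambda>)"
      by (intro Bochner_Integration.integral_add Bochner_Integration.integrable_add integrable_mult_right
          int Cm sumi[OF 1(1)] sumi[OF 1(2)])
    also have "(\<integral>W. (\<Sum>j<?k. indicator (P \<one> j) W) + (\<Sum>j<?k. indicator (P (inv (gens ! j)) j) W :: real) \<partial>\<Lambda>) =
        (\<integral>W. (\<Sum>j<?k. indicator (P \<one> j) W) \<partial>\<Lambda>) + (\<integral>W. (\<Sum>j<?k. indicator (P (inv (gens ! j)) j) W) \<partial>\<Lambda>)"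
      by (intro Bochner_Integration.integral_add sumi[OF 1(1)] sumi[OF 1(2)])
    finally show ?thesis
      using sum[of "\<lambda>_. \<one>"] sum[of "\<lambda>j. inv (gens ! j)"] by (simp add: sub[OF Cm])
  qed
  \<comment> \<open>The transport step, index by index: translation carries the child event at
    \<open>inv (gens ! j)\<close> to the parent event at the identity.\<close>
  also have "(\<Sum>j<?k. prob (P (inv (gens ! j)) j)) = (\<Sum>j<?k. prob (P \<one> j))"
  proof (intro sum.cong refl)
    fix j assume "j \<in> {..<?k}"
    then have g: "inv (gens ! j) \<in> carrier G" by simp
    have "tset (inv (gens ! j)) (P \<one> j) = P (inv (gens ! j)) j"
      using g by (auto simp: tset_def P_def par_tr)
    then show "prob (P (inv (gens ! j)) j) = prob (P \<one> j)"
      using inv_probD(4)[OF \<Lambda> g, of "P \<one> j"] Pm[OF one_closed] inv_probD(2)[OF \<Lambda>] by simp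
  qed
  \<comment> \<open>A vertex has at most one parent index, so the events are disjoint and their
    probabilities add up to at most 1.\<close>
  also have "(\<Sum>j<?k. prob (P \<one> j)) = prob (\<Union>j<?k. P \<one> j)"
    using Pm[OF one_closed] par_unique
    by (intro finite_measure_finite_Union[symmetric]) (auto simp: disjoint_family_on_def P_def)
  also have "real (card S) * prob C + (prob (\<Union>j<?k. P \<one> j) + prob (\<Union>j<?k. P \<one> j)) \<le> real (card S) * prob C + (1 + 1)"
    by (intro add_mono order_refl prob_le_1)
  finally show "(\<integral>W. real (deg W) \<partial>\<Lambda>) \<le> 2 + real (card S) * dens \<Lambda> \<one>"
    by (simp add: dens_def C_def)
qed

lemma graph_translate:
  assumes g: "g \<in> carrier G"
  shows "translate G (carrier G \<times> carrier G) (diagonal_action G) g (graph W) = graph (tr (inv g) W)"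
  unfolding translate_def graph_def
proof (rule restrict_ext)
  fix z assume "z \<in> carrier G \<times> carrier G"
  then obtain a b where z: "z = (a, b)" "a \<in> carrier G" "b \<in> carrier G" by auto
  then show "(\<lambda>z\<in>carrier G \<times> carrier G. edge W (fst z) (snd z)) (diagonal_action G (inv g) z) =
      edge (tr (inv g) W) (fst z) (snd z)"
    using g by (simp add: diagonal_action_def edge_tr)
qed

text \<open>The graph is an equivariant function of the set, so its law inherits invariance.\<close>

lemma distr_graph_invariant:
  assumes \<Lambda>: "inv_prob \<Lambda>"
  shows "distr \<Lambda> cE graph \<in> invariant_measures G (carrier G \<times> carrier G) (diagonal_action G)"
proof -
  interpret prob_space \<Lambda> by (rule inv_probD(1)[OF \<Lambda>])
  let ?\<mu> = "distr \<Lambda> cE graph"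
  have gm: "graph \<in> measurable \<Lambda> cE"
    by (rule graph_measurable_inv_prob[OF \<Lambda>])
  have "distr ?\<mu> ?\<mu> (translate G (carrier G \<times> carrier G) (diagonal_action G) g) = ?\<mu>" if g: "g \<in> carrier G" for g
  proof -
    let ?t = "translate G (carrier G \<times> carrier G) (diagonal_action G) g"
    have t: "?t \<in> measurable cE cE"
      unfolding translate_def[abs_def] using g
      by (intro measurable_cfg pred_cfg) (auto simp: diagonal_action_def)
    have tg: "tr (inv g) \<in> measurable \<Lambda> \<Lambda>"
      using tr_measurable[of "inv g"] g measurable_cong_sets[OF inv_probD(2)[OF \<Lambda>] inv_probD(2)[OF \<Lambda>]] by blast
    have "distr ?\<mu> ?\<mu> ?t = distr ?\<mu> cE ?t" by (rule distr_cong) auto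
    also have "\<dots> = distr \<Lambda> cE (?t \<circ> graph)" by (rule distr_distr[OF t gm])
    also have "?t \<circ> graph = graph \<circ> tr (inv g)" using graph_translate[OF g] by (auto simp: fun_eq_iff)
    also have "distr \<Lambda> cE (graph \<circ> tr (inv g)) = distr (distr \<Lambda> \<Lambda> (tr (inv g))) cE graph"
      by (rule distr_distr[OF gm tg, symmetric])
    also have "distr \<Lambda> \<Lambda> (tr (inv g)) = \<Lambda>"
      using distr_eq_iff_inv[OF inv_probD(1,2)[OF \<Lambda>], of "inv g"] inv_probD(4)[OF \<Lambda>] g by simp
    finally show ?thesis .
  qed
  then show ?thesis
    unfolding invariant_measures_def borel_prob_measures_def
    using prob_space_distr[OF gm] by (simp add: sets_borel_config[OF countable_edges])
qed

lemma graph_connected_prob: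
  assumes \<Lambda>: "inv_prob \<Lambda>" "measure \<Lambda> connset = 1"
  shows "measure (distr \<Lambda> cE graph) (connected_spanning_subgraphs G S) = 1"
proof -
  interpret prob_space \<Lambda> by (rule inv_probD(1)[OF \<Lambda>(1)])
  have gm: "graph \<in> measurable \<Lambda> cE"
    by (rule graph_measurable_inv_prob[OF \<Lambda>(1)])
  let ?A = "graph -` connected_spanning_subgraphs G S \<inter> space \<Lambda>"
  have "measure \<Lambda> connset \<le> measure \<Lambda> ?A"
  proof (rule finite_measure_mono)
    show "connset \<subseteq> ?A" using graph_connected by (auto simp: inv_probD(3)[OF \<Lambda>(1)] connset_def)
    show "?A \<in> events" by (rule measurable_sets[OF gm css_sets])
  qed
  then have "measure \<Lambda> ?A = 1" using \<Lambda>(2) prob_le_1[of ?A] by linarith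
  then show ?thesis by (simp add: measure_distr[OF gm css_sets])
qed

end

theorem mainTheorem2:
  fixes G :: "('a, 'b) monoid_scheme"
    and S :: "'a set"
    and \<epsilon> :: real
  assumes "group G"
    and "countable (carrier G)"
    and "infinite (carrier G)"
    and "kazhdan_property_T G"
    and "S \<subseteq> carrier G"
    and "finite S"
    and "\<And>s. s \<in> S \<Longrightarrow> inv\<^bsub>G\<^esub> s \<in> S"
    and "generate G S = carrier G"
    and "\<epsilon> > 0"
  shows "\<exists>\<mu> \<in> invariant_measures G (carrier G \<times> carrier G) (diagonal_action G).
           measure \<mu> (connected_spanning_subgraphs G S) = 1 \<and>
           integrable \<mu> (\<lambda>\<omega>. real (subgraph_degree G \<omega> \<one>\<^bsub>G\<^esub>)) \<and>
           (\<integral>\<omega>. real (subgraph_degree G \<omega> \<one>\<^bsub>G\<^esub>) \<partial>\<mu>) \<le> 2 + \<epsilon>"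
proof -
  interpret cayley G S
    using assms by (intro cayley.intro inf_group.intro inf_group_axioms.intro cayley_axioms.intro)
  \<comment> \<open>Chosen so that the degree inside the random set, at most \<open>card S\<close>
    times the density \<open>2 * p\<close>, costs at most \<epsilon>. The 1 keeps the denominator
    positive and the minimum keeps \<open>p\<close> below 1.\<close>
  define p where "p = min (1/2) (\<epsilon> / (2 * real (card S) + 1))"
  have p: "0 < p" "p < 1" using \<open>\<epsilon> > 0\<close> by (auto simp: p_def)
  have "p \<le> \<epsilon> / (2 * real (card S) + 1)" by (simp add: p_def)
  then have "p * (2 * real (card S) + 1) \<le> \<epsilon>" by (simp add: field_simps)
  then have p\<epsilon>: "real (card S) * (2 * p) \<le> \<epsilon>" using p by (simp add: algebra_simps)
  obtain \<Lambda> where \<Lambda>: "inv_prob \<Lambda>" "measure \<Lambda> connset = 1" "dens \<Lambda> \<one>\<^bsub>G\<^esub> \<le> 2 * p"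
    using kazhdan_sparse_connset[OF assms(4) p] by blast
  have gm: "graph \<in> measurable \<Lambda> cE"
    by (rule graph_measurable_inv_prob[OF \<Lambda>(1)])
  have "real (card S) * dens \<Lambda> \<one>\<^bsub>G\<^esub> \<le> \<epsilon>"
    using mult_left_mono[OF \<Lambda>(3), of "real (card S)"] p\<epsilon> by simp
  then have "(\<integral>W. real (subgraph_degree G (graph W) \<one>\<^bsub>G\<^esub>) \<partial>\<Lambda>) \<le> 2 + \<epsilon>"
    using expected_degree_bound(2)[OF \<Lambda>(1)] by linarith
  then show ?thesis
    using distr_graph_invariant[OF \<Lambda>(1)] graph_connected_prob[OF \<Lambda>(1,2)] expected_degree_bound(1)[OF \<Lambda>(1)]
    by (intro bexI[of _ "distr \<Lambda> cE graph"] conjI)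
      (simp_all add: integrable_distr_eq[OF gm degree_measurable] integral_distr[OF gm degree_measurable])
qed

end
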